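(* Suppose $A$, $B$, and $C$ are permutative categories. There is an adjoint equivalence $$j\colon\mathrm{PermCat}_s(A\otimes B,C)\rightleftarrows\mathrm{PermCat}(A\otimes B,C)\colon(-)^s$$ where $j$ is the fully faithful inclusion and $(-)^s$ is the strictification functor defined in the context. Moreover, the following statements hold. (i) Each of $j$ and $(-)^s$ is 2-natural with respect to strict symmetric monoidal functors $C\to\overline{C}$ and not-necessarily-strict symmetric monoidal functors $\overline{A}\to A$ and $\overline{B}\to B$. (ii) With respect to the bilinear permutative structure on $\mathrm{PermCat}_s(A\otimes B,C)$ and the pointwise permutative structure on $\mathrm{PermCat}(A\otimes B,C)$, the inclusion $j$ is symmetric monoidal while $(-)^s$ is strict symmetric monoidal.
   Context: **Permutative categories.** A permutative category $C=(C,+,0,\beta)$ is a strict monoidal category $(C,+,0)$ with a natural isomorphism $\beta_{x,y}\colon x+y\to y+x$ such that $\beta_{y,x}\beta_{x,y}=1$ and $\beta_{x,y+z}=(1_y+\beta_{x,z})\circ(\beta_{x,y}+1_z)$. A symmetric monoidal functor $F\colon C\to C'$ (always in the strong sense) is a functor with a natural isomorphism $F_2\colon Fx+Fy\to F(x+y)$ and an isomorphism $F_0\colon 0\to F0$ satisfying the usual associativity, unity and symmetry axioms; it is strict if $F_2,F_0$ are identities. A monoidal transformation $\phi\colon F\Rightarrow G$ is a natural transformation with $\phi_{x+y}\circ F_2=G_2\circ(\phi_x+\phi_y)$ and $\phi_0\circ F_0=G_0$. $\mathrm{PermCat}$ is the 2-category of permutative categories, symmetric monoidal functors and monoidal transformations;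 $\mathrm{PermCat}_s$ is the sub-2-category with the same objects, strict symmetric monoidal functors, and all monoidal transformations between them. **Pointwise structure.** $\mathrm{PermCat}(A,B)$ is a permutative category pointwise: $(F+F')(a)=Fa+F'a$, $(F+F')_2=(F_2+F'_2)\circ(1+\beta+1)$, $(F+F')_0=F_0+F'_0$, $(\phi+\phi')_a=\phi_a+\phi'_a$; the unit is the constant functor at $0$ and the symmetry is that of $B$ pointwise. **Tensor product of objects.** For permutative categories $A,B$, start with the free strict monoidal category $\coprod_{n\ge 0}(A\times B)^n$ on $A\times B$, writing objects as finite formal sums $\sum a_i.b_i$ (the empty sum is $0$) and morphisms of $A\times B$ as $f.g$. Freely adjoin (in strict monoidal categories) isomorphisms $\delta^L_a(b,b')\colon a.b+a.b'\to a.(b+b')$, $\delta^R_b(a,a')\colon a.b+a'.b\to(a+a').b$, $\beta_{a.b,a'.b'}\colon a.b+a'.b'\to a'.b'+a.b$, $\zeta^L_a\colon 0\to a.0$, $\zeta^R_b\colon 0\to 0.b$ for all $a,a'\in A$, $b,b'\in B$. Impose the relations: (1) all of these are natural in every variable; (2) $\beta$ together with $+,0$ gives a permutative structure; (3) each $a.(-)$ is a symmetric monoidal functor with constraints $\delta^L_a,\zeta^L_a$ and each $(-).b$ is a symmetric monoidal functor with constraints $\delta^R_b,\zeta^R_b$; (4) $\delta^L_{a+a'}\circ(\delta^R_b+\delta^R_{b'})=\delta^R_{b+b'}\circ(\delta^L_a+\delta^L_{a'})\circ(1+\beta+1)$ as morphisms $a.b+a'.b+a.b'+a'.b'\to(a+a').(b+b')$;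 (5) $\zeta^L_0=\zeta^R_0\colon 0\to 0.0$; (6) $\delta^R_0(a,a')\circ(\zeta^L_a+\zeta^L_{a'})=\zeta^L_{a+a'}$ and $\delta^L_0(b,b')\circ(\zeta^R_b+\zeta^R_{b'})=\zeta^R_{b+b'}$. The result is the permutative category $A\otimes B$. **Tensor product of 1- and 2-cells.** For symmetric monoidal functors $F\colon A\to A'$, $G\colon B\to B'$, the strict symmetric monoidal functor $F\otimes G$ is given by $a.b\mapsto Fa.Gb$, $f.g\mapsto Ff.Gg$, $\delta^L_a\mapsto(1.G_2)\circ\delta^L_{Fa}$, $\delta^R_b\mapsto(F_2.1)\circ\delta^R_{Gb}$, $\beta\mapsto\beta$, $\zeta^L_a\mapsto(1.G_0)\circ\zeta^L_{Fa}$, $\zeta^R_b\mapsto(F_0.1)\circ\zeta^R_{Gb}$. For monoidal transformations, $(\phi\otimes\psi)_{\sum a_i.b_i}=\sum\phi_{a_i}.\psi_{b_i}$ and $(\phi\otimes\psi)_0=1_0$. **Strictification.** For a symmetric monoidal functor $F\colon A\otimes B\to C$, $F^s\colon A\otimes B\to C$ is the strict symmetric monoidal functor with $F^s(0)=0$, $F^s(\sum a_i.b_i)=\sum F(a_i.b_i)$, $F^s(f.g)=F(f.g)$, $F^s(\beta)=\beta$, $F^s(\delta^L_a)=F(\delta^L_a)\circ F_2$, $F^s(\delta^R_b)=F(\delta^R_b)\circ F_2$, $F^s(\zeta^L_a)=F(\zeta^L_a)\circ F_0$, $F^s(\zeta^R_b)=F(\zeta^R_b)\circ F_0$, extended additively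 to formal sums of morphisms. For a monoidal transformation $\alpha\colon F\Rightarrow F'$, $\alpha^s_0=1_0$ and $\alpha^s_{\sum a_i.b_i}=\sum\alpha_{a_i.b_i}$. **Bilinear permutative structure** on $\mathrm{PermCat}_s(A\otimes B,C)$. The sum $F\boxplus G$ of strict symmetric monoidal functors is the strict symmetric monoidal functor with $(F\boxplus G)(0)=0$, $(F\boxplus G)(\sum a_i.b_i)=\sum(F(a_i.b_i)+G(a_i.b_i))$, $(F\boxplus G)(f.g)=F(f.g)+G(f.g)$, $(F\boxplus G)(\delta^L_a(b,b'))=(F(\delta^L_a)+G(\delta^L_a))\circ(1+\beta_{G(a.b),F(a.b')}+1)$, $(F\boxplus G)(\delta^R_b(a,a'))=(F(\delta^R_b)+G(\delta^R_b))\circ(1+\beta_{G(a.b),F(a'.b)}+1)$, $(F\boxplus G)(\beta)=\beta$, $(F\boxplus G)(\zeta^L_a)=F(\zeta^L_a)+G(\zeta^L_a)$, $(F\boxplus G)(\zeta^R_b)=F(\zeta^R_b)+G(\zeta^R_b)$; on transformations $(\phi\boxplus\psi)_{\sum a_i.b_i}=\sum(\phi_{a_i.b_i}+\psi_{a_i.b_i})$, $(\phi\boxplus\psi)_0=1_0$. The unit is the constant functor at $0$, and the symmetry at $\sum a_i.b_i$ is $\sum\beta_{F(a_i.b_i),G(a_i.b_i)}$. (This is the structure transported from the pointwise sum of bilinear maps $A,B\to C$.) *)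

theory Defs
  imports Main "HOL-Library.FuncSet"
begin

section \<open>Categories, functors and natural transformations\<close>

text \<open>Categories have explicit carriers of objects and arrows; the structure maps are only
  meaningful on these carriers. Composition is written in the usual order,
  \<open>g \<cdot>\<^bsub>C\<^esub> f\<close> being \<open>g\<close> after \<open>f\<close>. Functors and transformations, in contrast, are themselves objects
  and arrows of categories below and are compared by equality, so they are required to take the value
  \<open>undefined\<close> outside the carriers (\<open>extensional\<close>).\<close>

record ('o, 'm) cat =
  Obj :: "'o set"
  Arr :: "'m set"
  Dom :: "'m \<Rightarrow> 'o"
  Cod :: "'m \<Rightarrow> 'o"
  Id :: "'o \<Rightarrow> 'm"
  Comp :: "'m \<Rightarrow> 'm \<Rightarrow> 'm" (infixr "\<cdot>\<index>" 70)

definition hom :: "('o, 'm, 'z) cat_scheme \<Rightarrow> 'o \<Rightarrow> 'o \<Rightarrow> 'm set" where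
  "hom C x y = {f \<in> Arr C. Dom C f = x \<and> Cod C f = y}"

definition is_cat :: "('o, 'm, 'z) cat_scheme \<Rightarrow> bool" where
  "is_cat C \<longleftrightarrow>
    (\<forall>f \<in> Arr C. Dom C f \<in> Obj C \<and> Cod C f \<in> Obj C) \<and>
    (\<forall>x \<in> Obj C. Id C x \<in> hom C x x) \<and>
    (\<forall>f \<in> Arr C. \<forall>g \<in> Arr C. Cod C f = Dom C g \<longrightarrow> g \<cdot>\<^bsub>C\<^esub> f \<in> hom C (Dom C f) (Cod C g)) \<and>
    (\<forall>f \<in> Arr C. f \<cdot>\<^bsub>C\<^esub> Id C (Dom C f) = f \<and> Id C (Cod C f) \<cdot>\<^bsub>C\<^esub> f = f) \<and>
    (\<forall>f \<in> Arr C. \<forall>g \<in> Arr C. \<forall>h \<in> Arr C. Cod C f = Dom C g \<and> Cod C g = Dom C h \<longrightarrow>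
      (h \<cdot>\<^bsub>C\<^esub> g) \<cdot>\<^bsub>C\<^esub> f = h \<cdot>\<^bsub>C\<^esub> (g \<cdot>\<^bsub>C\<^esub> f))"

definition inverse_arrs :: "('o, 'm, 'z) cat_scheme \<Rightarrow> 'm \<Rightarrow> 'm \<Rightarrow> bool" where
  "inverse_arrs C f g \<longleftrightarrow> f \<in> Arr C \<and> g \<in> hom C (Cod C f) (Dom C f) \<and>
    g \<cdot>\<^bsub>C\<^esub> f = Id C (Dom C f) \<and> f \<cdot>\<^bsub>C\<^esub> g = Id C (Cod C f)"

definition is_iso :: "('o, 'm, 'z) cat_scheme \<Rightarrow> 'm \<Rightarrow> bool" where
  "is_iso C f \<longleftrightarrow> (\<exists>g. inverse_arrs C f g)"

definition inv_arr :: "('o, 'm, 'z) cat_scheme \<Rightarrow> 'm \<Rightarrow> 'm" where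
  "inv_arr C f = (THE g. inverse_arrs C f g)"

record ('o, 'm, 'p, 'n) func =
  fobj :: "'o \<Rightarrow> 'p"
  farr :: "'m \<Rightarrow> 'n"

definition is_functor ::
  "('o, 'm, 'z) cat_scheme \<Rightarrow> ('p, 'n, 'y) cat_scheme \<Rightarrow> ('o, 'm, 'p, 'n, 'x) func_scheme \<Rightarrow> bool" where
  "is_functor X Y F \<longleftrightarrow>
    is_cat X \<and> is_cat Y \<and>
    fobj F \<in> extensional (Obj X) \<and> farr F \<in> extensional (Arr X) \<and>
    (\<forall>x \<in> Obj X. fobj F x \<in> Obj Y) \<and>
    (\<forall>f \<in> Arr X. farr F f \<in> hom Y (fobj F (Dom X f)) (fobj F (Cod X f))) \<and>
    (\<forall>x \<in> Obj X. farr F (Id X x) = Id Y (fobj F x)) \<and>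
    (\<forall>f \<in> Arr X. \<forall>g \<in> Arr X. Cod X f = Dom X g \<longrightarrow> farr F (g \<cdot>\<^bsub>X\<^esub> f) = farr F g \<cdot>\<^bsub>Y\<^esub> farr F f)"

definition func_id :: "('o, 'm, 'z) cat_scheme \<Rightarrow> ('o, 'm, 'o, 'm) func" where
  "func_id X = \<lparr>fobj = \<lambda>x \<in> Obj X. x, farr = \<lambda>f \<in> Arr X. f\<rparr>"

definition func_comp ::
  "('o, 'm, 'z) cat_scheme \<Rightarrow> ('p, 'n, 'q, 'k, 'y) func_scheme \<Rightarrow> ('o, 'm, 'p, 'n, 'x) func_scheme
    \<Rightarrow> ('o, 'm, 'q, 'k) func" where
  "func_comp X G F =
    \<lparr>fobj = \<lambda>x \<in> Obj X. fobj G (fobj F x), farr = \<lambda>f \<in> Arr X. farr G (farr F f)\<rparr>"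

definition fully_faithful ::
  "('o, 'm, 'z) cat_scheme \<Rightarrow> ('p, 'n, 'y) cat_scheme \<Rightarrow> ('o, 'm, 'p, 'n, 'x) func_scheme \<Rightarrow> bool" where
  "fully_faithful X Y F \<longleftrightarrow> is_functor X Y F \<and>
    (\<forall>x \<in> Obj X. \<forall>y \<in> Obj X. bij_betw (farr F) (hom X x y) (hom Y (fobj F x) (fobj F y)))"

definition nat_trans ::
  "('o, 'm, 'z) cat_scheme \<Rightarrow> ('p, 'n, 'y) cat_scheme \<Rightarrow>
    ('o, 'm, 'p, 'n, 'x) func_scheme \<Rightarrow> ('o, 'm, 'p, 'n, 'w) func_scheme \<Rightarrow> ('o \<Rightarrow> 'n) \<Rightarrow> bool" where
  "nat_trans X Y F G \<tau> \<longleftrightarrow> is_functor X Y F \<and> is_functor X Y G \<and>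
    (\<forall>x \<in> Obj X. \<tau> x \<in> hom Y (fobj F x) (fobj G x)) \<and>
    (\<forall>f \<in> Arr X. \<tau> (Cod X f) \<cdot>\<^bsub>Y\<^esub> farr F f = farr G f \<cdot>\<^bsub>Y\<^esub> \<tau> (Dom X f))"

definition nat_iso ::
  "('o, 'm, 'z) cat_scheme \<Rightarrow> ('p, 'n, 'y) cat_scheme \<Rightarrow>
    ('o, 'm, 'p, 'n, 'x) func_scheme \<Rightarrow> ('o, 'm, 'p, 'n, 'w) func_scheme \<Rightarrow> ('o \<Rightarrow> 'n) \<Rightarrow> bool" where
  "nat_iso X Y F G \<tau> \<longleftrightarrow> nat_trans X Y F G \<tau> \<and> (\<forall>x \<in> Obj X. is_iso Y (\<tau> x))"

text \<open>\<open>F\<close> is left adjoint to \<open>G\<close>, with unit \<open>\<eta>\<close> and counit \<open>\<epsilon>\<close> both invertible.\<close>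

definition adjoint_equivalence ::
  "('o, 'm, 'z) cat_scheme \<Rightarrow> ('p, 'n, 'y) cat_scheme \<Rightarrow>
    ('o, 'm, 'p, 'n, 'x) func_scheme \<Rightarrow> ('p, 'n, 'o, 'm, 'w) func_scheme \<Rightarrow>
    ('o \<Rightarrow> 'm) \<Rightarrow> ('p \<Rightarrow> 'n) \<Rightarrow> bool" where
  "adjoint_equivalence X Y F G \<eta> \<epsilon> \<longleftrightarrow>
    is_functor X Y F \<and> is_functor Y X G \<and>
    nat_iso X X (func_id X) (func_comp X G F) \<eta> \<and>
    nat_iso Y Y (func_comp Y F G) (func_id Y) \<epsilon> \<and>
    (\<forall>x \<in> Obj X. \<epsilon> (fobj F x) \<cdot>\<^bsub>Y\<^esub> farr F (\<eta> x) = Id Y (fobj F x)) \<and>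
    (\<forall>y \<in> Obj Y. farr G (\<epsilon> y) \<cdot>\<^bsub>X\<^esub> \<eta> (fobj G y) = Id X (fobj G y))"

section \<open>Permutative categories\<close>

text \<open>The sum is \<open>\<oplus>\<^sub>o\<close> on objects and \<open>\<oplus>\<^sub>a\<close> on arrows.\<close>

record ('o, 'm) pcat = "('o, 'm) cat" +
  plusO :: "'o \<Rightarrow> 'o \<Rightarrow> 'o" (infixl "\<oplus>\<^sub>o\<index>" 75)
  plusA :: "'m \<Rightarrow> 'm \<Rightarrow> 'm" (infixl "\<oplus>\<^sub>a\<index>" 75)
  zero :: "'o"
  sym :: "'o \<Rightarrow> 'o \<Rightarrow> 'm"

definition is_strict_monoidal :: "('o, 'm, 'z) pcat_scheme \<Rightarrow> bool" where
  "is_strict_monoidal C \<longleftrightarrow> is_cat C \<and>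
    zero C \<in> Obj C \<and>
    (\<forall>x \<in> Obj C. \<forall>y \<in> Obj C. x \<oplus>\<^sub>o\<^bsub>C\<^esub> y \<in> Obj C) \<and>
    (\<forall>f \<in> Arr C. \<forall>g \<in> Arr C.
      f \<oplus>\<^sub>a\<^bsub>C\<^esub> g \<in> hom C (Dom C f \<oplus>\<^sub>o\<^bsub>C\<^esub> Dom C g) (Cod C f \<oplus>\<^sub>o\<^bsub>C\<^esub> Cod C g)) \<and>
    (\<forall>x \<in> Obj C. \<forall>y \<in> Obj C. Id C x \<oplus>\<^sub>a\<^bsub>C\<^esub> Id C y = Id C (x \<oplus>\<^sub>o\<^bsub>C\<^esub> y)) \<and>
    (\<forall>f \<in> Arr C. \<forall>f' \<in> Arr C. \<forall>g \<in> Arr C. \<forall>g' \<in> Arr C. Cod C f = Dom C f' \<and> Cod C g = Dom C g' \<longrightarrow>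
      (f' \<cdot>\<^bsub>C\<^esub> f) \<oplus>\<^sub>a\<^bsub>C\<^esub> (g' \<cdot>\<^bsub>C\<^esub> g) = (f' \<oplus>\<^sub>a\<^bsub>C\<^esub> g') \<cdot>\<^bsub>C\<^esub> (f \<oplus>\<^sub>a\<^bsub>C\<^esub> g)) \<and>
    (\<forall>x \<in> Obj C. \<forall>y \<in> Obj C. \<forall>z \<in> Obj C. (x \<oplus>\<^sub>o\<^bsub>C\<^esub> y) \<oplus>\<^sub>o\<^bsub>C\<^esub> z = x \<oplus>\<^sub>o\<^bsub>C\<^esub> (y \<oplus>\<^sub>o\<^bsub>C\<^esub> z)) \<and>
    (\<forall>f \<in> Arr C. \<forall>g \<in> Arr C. \<forall>h \<in> Arr C. (f \<oplus>\<^sub>a\<^bsub>C\<^esub> g) \<oplus>\<^sub>a\<^bsub>C\<^esub> h = f \<oplus>\<^sub>a\<^bsub>C\<^esub> (g \<oplus>\<^sub>a\<^bsub>C\<^esub> h)) \<and>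
    (\<forall>x \<in> Obj C. zero C \<oplus>\<^sub>o\<^bsub>C\<^esub> x = x \<and> x \<oplus>\<^sub>o\<^bsub>C\<^esub> zero C = x) \<and>
    (\<forall>f \<in> Arr C. Id C (zero C) \<oplus>\<^sub>a\<^bsub>C\<^esub> f = f \<and> f \<oplus>\<^sub>a\<^bsub>C\<^esub> Id C (zero C) = f)"

definition is_permutative :: "('o, 'm, 'z) pcat_scheme \<Rightarrow> bool" where
  "is_permutative C \<longleftrightarrow> is_strict_monoidal C \<and>
    (\<forall>x \<in> Obj C. \<forall>y \<in> Obj C. sym C x y \<in> hom C (x \<oplus>\<^sub>o\<^bsub>C\<^esub> y) (y \<oplus>\<^sub>o\<^bsub>C\<^esub> x)) \<and>
    (\<forall>f \<in> Arr C. \<forall>g \<in> Arr C.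
      sym C (Cod C f) (Cod C g) \<cdot>\<^bsub>C\<^esub> (f \<oplus>\<^sub>a\<^bsub>C\<^esub> g) = (g \<oplus>\<^sub>a\<^bsub>C\<^esub> f) \<cdot>\<^bsub>C\<^esub> sym C (Dom C f) (Dom C g)) \<and>
    (\<forall>x \<in> Obj C. \<forall>y \<in> Obj C. sym C y x \<cdot>\<^bsub>C\<^esub> sym C x y = Id C (x \<oplus>\<^sub>o\<^bsub>C\<^esub> y)) \<and>
    (\<forall>x \<in> Obj C. \<forall>y \<in> Obj C. \<forall>z \<in> Obj C.
      sym C x (y \<oplus>\<^sub>o\<^bsub>C\<^esub> z) = (Id C y \<oplus>\<^sub>a\<^bsub>C\<^esub> sym C x z) \<cdot>\<^bsub>C\<^esub> (sym C x y \<oplus>\<^sub>a\<^bsub>C\<^esub> Id C z))"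

text \<open>The map \<open>1 + \<beta> + 1\<close> from \<open>w + x + y + z\<close> to \<open>w + y + x + z\<close>.\<close>

definition midswap :: "('o, 'm, 'z) pcat_scheme \<Rightarrow> 'o \<Rightarrow> 'o \<Rightarrow> 'o \<Rightarrow> 'o \<Rightarrow> 'm" where
  "midswap C w x y z = Id C w \<oplus>\<^sub>a\<^bsub>C\<^esub> sym C x y \<oplus>\<^sub>a\<^bsub>C\<^esub> Id C z"

definition osum :: "('o, 'm, 'z) pcat_scheme \<Rightarrow> ('i \<Rightarrow> 'o) \<Rightarrow> 'i list \<Rightarrow> 'o" where
  "osum C h xs = foldr (\<lambda>p s. h p \<oplus>\<^sub>o\<^bsub>C\<^esub> s) xs (zero C)"

definition asum :: "('o, 'm, 'z) pcat_scheme \<Rightarrow> ('i \<Rightarrow> 'm) \<Rightarrow> 'i list \<Rightarrow> 'm" where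
  "asum C h xs = foldr (\<lambda>p s. h p \<oplus>\<^sub>a\<^bsub>C\<^esub> s) xs (Id C (zero C))"

section \<open>Symmetric monoidal functors and monoidal transformations\<close>

record ('o, 'm, 'p, 'n) smf = "('o, 'm, 'p, 'n) func" +
  fmult :: "'o \<Rightarrow> 'o \<Rightarrow> 'n"
  funit :: "'n"

definition is_smf ::
  "('o, 'm, 'z) pcat_scheme \<Rightarrow> ('p, 'n, 'y) pcat_scheme \<Rightarrow> ('o, 'm, 'p, 'n) smf \<Rightarrow> bool" where
  "is_smf A B F \<longleftrightarrow> is_permutative A \<and> is_permutative B \<and> is_functor A B F \<and>
    fmult F \<in> extensional (Obj A) \<and> (\<forall>x \<in> Obj A. fmult F x \<in> extensional (Obj A)) \<and>
    (\<forall>x \<in> Obj A. \<forall>y \<in> Obj A.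
      fmult F x y \<in> hom B (fobj F x \<oplus>\<^sub>o\<^bsub>B\<^esub> fobj F y) (fobj F (x \<oplus>\<^sub>o\<^bsub>A\<^esub> y)) \<and> is_iso B (fmult F x y)) \<and>
    funit F \<in> hom B (zero B) (fobj F (zero A)) \<and> is_iso B (funit F) \<and>
    (\<forall>f \<in> Arr A. \<forall>g \<in> Arr A.
      fmult F (Cod A f) (Cod A g) \<cdot>\<^bsub>B\<^esub> (farr F f \<oplus>\<^sub>a\<^bsub>B\<^esub> farr F g) =
      farr F (f \<oplus>\<^sub>a\<^bsub>A\<^esub> g) \<cdot>\<^bsub>B\<^esub> fmult F (Dom A f) (Dom A g)) \<and>
    (\<forall>x \<in> Obj A. \<forall>y \<in> Obj A. \<forall>z \<in> Obj A.
      fmult F (x \<oplus>\<^sub>o\<^bsub>A\<^esub> y) z \<cdot>\<^bsub>B\<^esub> (fmult F x y \<oplus>\<^sub>a\<^bsub>B\<^esub> Id B (fobj F z)) =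
      fmult F x (y \<oplus>\<^sub>o\<^bsub>A\<^esub> z) \<cdot>\<^bsub>B\<^esub> (Id B (fobj F x) \<oplus>\<^sub>a\<^bsub>B\<^esub> fmult F y z)) \<and>
    (\<forall>x \<in> Obj A.
      fmult F x (zero A) \<cdot>\<^bsub>B\<^esub> (Id B (fobj F x) \<oplus>\<^sub>a\<^bsub>B\<^esub> funit F) = Id B (fobj F x) \<and>
      fmult F (zero A) x \<cdot>\<^bsub>B\<^esub> (funit F \<oplus>\<^sub>a\<^bsub>B\<^esub> Id B (fobj F x)) = Id B (fobj F x)) \<and>
    (\<forall>x \<in> Obj A. \<forall>y \<in> Obj A.
      farr F (sym A x y) \<cdot>\<^bsub>B\<^esub> fmult F x y = fmult F y x \<cdot>\<^bsub>B\<^esub> sym B (fobj F x) (fobj F y))"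

definition is_strict_smf ::
  "('o, 'm, 'z) pcat_scheme \<Rightarrow> ('p, 'n, 'y) pcat_scheme \<Rightarrow> ('o, 'm, 'p, 'n) smf \<Rightarrow> bool" where
  "is_strict_smf A B F \<longleftrightarrow> is_smf A B F \<and>
    (\<forall>x \<in> Obj A. \<forall>y \<in> Obj A. fmult F x y = Id B (fobj F (x \<oplus>\<^sub>o\<^bsub>A\<^esub> y))) \<and>
    funit F = Id B (fobj F (zero A))"

definition smf_comp ::
  "('o, 'm, 'z) pcat_scheme \<Rightarrow> ('q, 'k, 'y) pcat_scheme \<Rightarrow>
    ('p, 'n, 'q, 'k) smf \<Rightarrow> ('o, 'm, 'p, 'n) smf \<Rightarrow> ('o, 'm, 'q, 'k) smf" where
  "smf_comp A C G F =
    \<lparr>fobj = \<lambda>x \<in> Obj A. fobj G (fobj F x),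
     farr = \<lambda>f \<in> Arr A. farr G (farr F f),
     fmult = \<lambda>x \<in> Obj A. \<lambda>y \<in> Obj A. farr G (fmult F x y) \<cdot>\<^bsub>C\<^esub> fmult G (fobj F x) (fobj F y),
     funit = farr G (funit F) \<cdot>\<^bsub>C\<^esub> funit G\<rparr>"

record ('o, 'm, 'p, 'n) mtrans =
  msrc :: "('o, 'm, 'p, 'n) smf"
  mtgt :: "('o, 'm, 'p, 'n) smf"
  mcomp :: "'o \<Rightarrow> 'n"

definition is_mtrans ::
  "('o, 'm, 'z) pcat_scheme \<Rightarrow> ('p, 'n, 'y) pcat_scheme \<Rightarrow> ('o, 'm, 'p, 'n) mtrans \<Rightarrow> bool" where
  "is_mtrans A B \<phi> \<longleftrightarrow> is_smf A B (msrc \<phi>) \<and> is_smf A B (mtgt \<phi>) \<and>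
    mcomp \<phi> \<in> extensional (Obj A) \<and>
    nat_trans A B (msrc \<phi>) (mtgt \<phi>) (mcomp \<phi>) \<and>
    (\<forall>x \<in> Obj A. \<forall>y \<in> Obj A.
      mcomp \<phi> (x \<oplus>\<^sub>o\<^bsub>A\<^esub> y) \<cdot>\<^bsub>B\<^esub> fmult (msrc \<phi>) x y =
      fmult (mtgt \<phi>) x y \<cdot>\<^bsub>B\<^esub> (mcomp \<phi> x \<oplus>\<^sub>a\<^bsub>B\<^esub> mcomp \<phi> y)) \<and>
    mcomp \<phi> (zero A) \<cdot>\<^bsub>B\<^esub> funit (msrc \<phi>) = funit (mtgt \<phi>)"

definition mtrans_id ::
  "('o, 'm, 'z) pcat_scheme \<Rightarrow> ('p, 'n, 'y) pcat_scheme \<Rightarrow> ('o, 'm, 'p, 'n) smf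
    \<Rightarrow> ('o, 'm, 'p, 'n) mtrans" where
  "mtrans_id A B F = \<lparr>msrc = F, mtgt = F, mcomp = \<lambda>x \<in> Obj A. Id B (fobj F x)\<rparr>"

definition mtrans_vcomp ::
  "('o, 'm, 'z) pcat_scheme \<Rightarrow> ('p, 'n, 'y) pcat_scheme \<Rightarrow>
    ('o, 'm, 'p, 'n) mtrans \<Rightarrow> ('o, 'm, 'p, 'n) mtrans \<Rightarrow> ('o, 'm, 'p, 'n) mtrans" where
  "mtrans_vcomp A B \<psi> \<phi> =
    \<lparr>msrc = msrc \<phi>, mtgt = mtgt \<psi>, mcomp = \<lambda>x \<in> Obj A. mcomp \<psi> x \<cdot>\<^bsub>B\<^esub> mcomp \<phi> x\<rparr>"

text \<open>Horizontal composite \<open>\<psi> * \<phi>\<close> of \<open>\<phi>\<close> between functors \<open>A \<rightarrow> B\<close> and \<open>\<psi>\<close> between functors \<open>B \<rightarrow> C\<close>.\<close>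

definition mtrans_hcomp ::
  "('o, 'm, 'z) pcat_scheme \<Rightarrow> ('q, 'k, 'y) pcat_scheme \<Rightarrow>
    ('p, 'n, 'q, 'k) mtrans \<Rightarrow> ('o, 'm, 'p, 'n) mtrans \<Rightarrow> ('o, 'm, 'q, 'k) mtrans" where
  "mtrans_hcomp A C \<psi> \<phi> =
    \<lparr>msrc = smf_comp A C (msrc \<psi>) (msrc \<phi>),
     mtgt = smf_comp A C (mtgt \<psi>) (mtgt \<phi>),
     mcomp = \<lambda>x \<in> Obj A. mcomp \<psi> (fobj (mtgt \<phi>) x) \<cdot>\<^bsub>C\<^esub> farr (msrc \<psi>) (mcomp \<phi> x)\<rparr>"

section \<open>The pointwise permutative category \<open>PermCat(A, B)\<close>\<close>

definition pw_sum ::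
  "('o, 'm, 'z) pcat_scheme \<Rightarrow> ('p, 'n, 'y) pcat_scheme \<Rightarrow>
    ('o, 'm, 'p, 'n) smf \<Rightarrow> ('o, 'm, 'p, 'n) smf \<Rightarrow> ('o, 'm, 'p, 'n) smf" where
  "pw_sum A B F G =
    \<lparr>fobj = \<lambda>x \<in> Obj A. fobj F x \<oplus>\<^sub>o\<^bsub>B\<^esub> fobj G x,
     farr = \<lambda>f \<in> Arr A. farr F f \<oplus>\<^sub>a\<^bsub>B\<^esub> farr G f,
     fmult = \<lambda>x \<in> Obj A. \<lambda>y \<in> Obj A.
       (fmult F x y \<oplus>\<^sub>a\<^bsub>B\<^esub> fmult G x y) \<cdot>\<^bsub>B\<^esub> midswap B (fobj F x) (fobj G x) (fobj F y) (fobj G y),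
     funit = funit F \<oplus>\<^sub>a\<^bsub>B\<^esub> funit G\<rparr>"

definition pw_sum_mtrans ::
  "('o, 'm, 'z) pcat_scheme \<Rightarrow> ('p, 'n, 'y) pcat_scheme \<Rightarrow>
    ('o, 'm, 'p, 'n) mtrans \<Rightarrow> ('o, 'm, 'p, 'n) mtrans \<Rightarrow> ('o, 'm, 'p, 'n) mtrans" where
  "pw_sum_mtrans A B \<phi> \<psi> =
    \<lparr>msrc = pw_sum A B (msrc \<phi>) (msrc \<psi>), mtgt = pw_sum A B (mtgt \<phi>) (mtgt \<psi>),
     mcomp = \<lambda>x \<in> Obj A. mcomp \<phi> x \<oplus>\<^sub>a\<^bsub>B\<^esub> mcomp \<psi> x\<rparr>"

definition zero_smf ::
  "('o, 'm, 'z) pcat_scheme \<Rightarrow> ('p, 'n, 'y) pcat_scheme \<Rightarrow> ('o, 'm, 'p, 'n) smf" where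
  "zero_smf A B =
    \<lparr>fobj = \<lambda>x \<in> Obj A. zero B, farr = \<lambda>f \<in> Arr A. Id B (zero B),
     fmult = \<lambda>x \<in> Obj A. \<lambda>y \<in> Obj A. Id B (zero B), funit = Id B (zero B)\<rparr>"

definition pw_sym ::
  "('o, 'm, 'z) pcat_scheme \<Rightarrow> ('p, 'n, 'y) pcat_scheme \<Rightarrow>
    ('o, 'm, 'p, 'n) smf \<Rightarrow> ('o, 'm, 'p, 'n) smf \<Rightarrow> ('o, 'm, 'p, 'n) mtrans" where
  "pw_sym A B F G =
    \<lparr>msrc = pw_sum A B F G, mtgt = pw_sum A B G F,
     mcomp = \<lambda>x \<in> Obj A. sym B (fobj F x) (fobj G x)\<rparr>"

definition PermCat ::
  "('o, 'm, 'z) pcat_scheme \<Rightarrow> ('p, 'n, 'y) pcat_scheme \<Rightarrow>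
    (('o, 'm, 'p, 'n) smf, ('o, 'm, 'p, 'n) mtrans) pcat" where
  "PermCat A B =
    \<lparr>Obj = {F. is_smf A B F}, Arr = {\<phi>. is_mtrans A B \<phi>},
     Dom = msrc, Cod = mtgt, Id = mtrans_id A B, Comp = mtrans_vcomp A B,
     plusO = pw_sum A B, plusA = pw_sum_mtrans A B,
     zero = zero_smf A B, sym = pw_sym A B\<rparr>"

section \<open>The tensor product of permutative categories\<close>

text \<open>Objects of \<open>A \<otimes> B\<close> are lists of pairs, \<open>[(a\<^sub>1, b\<^sub>1), \<dots>, (a\<^sub>n, b\<^sub>n)]\<close> being the formal sum of the
  \<open>a\<^sub>i.b\<^sub>i\<close>. Arrows are equivalence classes of formal expressions. The adjoined isomorphisms are
  \<open>DeltaL a b b'\<close> for \<open>\<delta>\<^sup>L\<^sub>a(b, b')\<close>, \<open>DeltaR b a a'\<close> for \<open>\<delta>\<^sup>R\<^sub>b(a, a')\<close>, \<open>Beta p q\<close> for \<open>\<beta>\<close> on two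
  one-term sums, \<open>ZetaL a\<close> for \<open>\<zeta>\<^sup>L\<^sub>a\<close>, and \<open>ZetaR b\<close> for \<open>\<zeta>\<^sup>R\<^sub>b\<close>.\<close>

datatype ('a, 'b) cell =
    DeltaL 'a 'b 'b
  | DeltaR 'b 'a 'a
  | Beta "'a \<times> 'b" "'a \<times> 'b"
  | ZetaL 'a
  | ZetaR 'b

datatype ('a, 'f, 'b, 'g) trm =
    Gen 'f 'g
  | Iso "('a, 'b) cell"
  | Inv "('a, 'b) cell"
  | TId "('a \<times> 'b) list"
  | TComp "('a, 'f, 'b, 'g) trm" "('a, 'f, 'b, 'g) trm" (infixr "\<odot>" 70)
  | TPlus "('a, 'f, 'b, 'g) trm" "('a, 'f, 'b, 'g) trm" (infixl "\<uplus>" 75)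

definition tobj :: "('a, 'f, 'z) pcat_scheme \<Rightarrow> ('b, 'g, 'y) pcat_scheme \<Rightarrow> ('a \<times> 'b) list set" where
  "tobj A B = {xs. set xs \<subseteq> Obj A \<times> Obj B}"

primrec cell_dom :: "('a, 'f, 'z) pcat_scheme \<Rightarrow> ('b, 'g, 'y) pcat_scheme \<Rightarrow> ('a, 'b) cell \<Rightarrow> ('a \<times> 'b) list" where
  "cell_dom A B (DeltaL a b b') = [(a, b), (a, b')]"
| "cell_dom A B (DeltaR b a a') = [(a, b), (a', b)]"
| "cell_dom A B (Beta p q) = [p, q]"
| "cell_dom A B (ZetaL a) = []"
| "cell_dom A B (ZetaR b) = []"

primrec cell_cod :: "('a, 'f, 'z) pcat_scheme \<Rightarrow> ('b, 'g, 'y) pcat_scheme \<Rightarrow> ('a, 'b) cell \<Rightarrow> ('a \<times> 'b) list" where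
  "cell_cod A B (DeltaL a b b') = [(a, b \<oplus>\<^sub>o\<^bsub>B\<^esub> b')]"
| "cell_cod A B (DeltaR b a a') = [(a \<oplus>\<^sub>o\<^bsub>A\<^esub> a', b)]"
| "cell_cod A B (Beta p q) = [q, p]"
| "cell_cod A B (ZetaL a) = [(a, zero B)]"
| "cell_cod A B (ZetaR b) = [(zero A, b)]"

primrec cell_wf :: "('a, 'f, 'z) pcat_scheme \<Rightarrow> ('b, 'g, 'y) pcat_scheme \<Rightarrow> ('a, 'b) cell \<Rightarrow> bool" where
  "cell_wf A B (DeltaL a b b') \<longleftrightarrow> a \<in> Obj A \<and> b \<in> Obj B \<and> b' \<in> Obj B"
| "cell_wf A B (DeltaR b a a') \<longleftrightarrow> b \<in> Obj B \<and> a \<in> Obj A \<and> a' \<in> Obj A"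
| "cell_wf A B (Beta p q) \<longleftrightarrow> p \<in> Obj A \<times> Obj B \<and> q \<in> Obj A \<times> Obj B"
| "cell_wf A B (ZetaL a) \<longleftrightarrow> a \<in> Obj A"
| "cell_wf A B (ZetaR b) \<longleftrightarrow> b \<in> Obj B"

primrec tdom :: "('a, 'f, 'z) pcat_scheme \<Rightarrow> ('b, 'g, 'y) pcat_scheme \<Rightarrow> ('a, 'f, 'b, 'g) trm \<Rightarrow> ('a \<times> 'b) list" where
  "tdom A B (Gen f g) = [(Dom A f, Dom B g)]"
| "tdom A B (Iso c) = cell_dom A B c"
| "tdom A B (Inv c) = cell_cod A B c"
| "tdom A B (TId xs) = xs"
| "tdom A B (t \<odot> u) = tdom A B u"
| "tdom A B (t \<uplus> u) = tdom A B t @ tdom A B u"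

primrec tcod :: "('a, 'f, 'z) pcat_scheme \<Rightarrow> ('b, 'g, 'y) pcat_scheme \<Rightarrow> ('a, 'f, 'b, 'g) trm \<Rightarrow> ('a \<times> 'b) list" where
  "tcod A B (Gen f g) = [(Cod A f, Cod B g)]"
| "tcod A B (Iso c) = cell_cod A B c"
| "tcod A B (Inv c) = cell_dom A B c"
| "tcod A B (TId xs) = xs"
| "tcod A B (t \<odot> u) = tcod A B t"
| "tcod A B (t \<uplus> u) = tcod A B t @ tcod A B u"

primrec twf :: "('a, 'f, 'z) pcat_scheme \<Rightarrow> ('b, 'g, 'y) pcat_scheme \<Rightarrow> ('a, 'f, 'b, 'g) trm \<Rightarrow> bool" where
  "twf A B (Gen f g) \<longleftrightarrow> f \<in> Arr A \<and> g \<in> Arr B"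
| "twf A B (Iso c) \<longleftrightarrow> cell_wf A B c"
| "twf A B (Inv c) \<longleftrightarrow> cell_wf A B c"
| "twf A B (TId xs) \<longleftrightarrow> xs \<in> tobj A B"
| "twf A B (t \<odot> u) \<longleftrightarrow> twf A B t \<and> twf A B u \<and> tcod A B u = tdom A B t"
| "twf A B (t \<uplus> u) \<longleftrightarrow> twf A B t \<and> twf A B u"

text \<open>Only \<open>\<beta>\<close> on one-term sums is adjoined. Its extension to arbitrary sums is forced by the two
  hexagon identities; \<open>beta1\<close> moves one summand past a sum.\<close>

primrec beta1 :: "'a \<times> 'b \<Rightarrow> ('a \<times> 'b) list \<Rightarrow> ('a, 'f, 'b, 'g) trm" where
  "beta1 p [] = TId [p]"
| "beta1 p (q # ys) = (TId [q] \<uplus> beta1 p ys) \<odot> (Iso (Beta p q) \<uplus> TId ys)"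

primrec tbeta :: "('a \<times> 'b) list \<Rightarrow> ('a \<times> 'b) list \<Rightarrow> ('a, 'f, 'b, 'g) trm" where
  "tbeta [] ys = TId ys"
| "tbeta (p # xs) ys = (beta1 p ys \<uplus> TId xs) \<odot> (TId [p] \<uplus> tbeta xs ys)"

inductive teq ::
  "('a, 'f, 'z) pcat_scheme \<Rightarrow> ('b, 'g, 'y) pcat_scheme \<Rightarrow>
    ('a, 'f, 'b, 'g) trm \<Rightarrow> ('a, 'f, 'b, 'g) trm \<Rightarrow> bool"
  for A :: "('a, 'f, 'z) pcat_scheme" and B :: "('b, 'g, 'y) pcat_scheme"
where
  refl: "twf A B t \<Longrightarrow> teq A B t t"
| symm: "teq A B t u \<Longrightarrow> teq A B u t"
| trans: "teq A B t u \<Longrightarrow> teq A B u v \<Longrightarrow> teq A B t v"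
| cong_comp: "teq A B t t' \<Longrightarrow> teq A B u u' \<Longrightarrow> tcod A B u = tdom A B t \<Longrightarrow> teq A B (t \<odot> u) (t' \<odot> u')"
| cong_plus: "teq A B t t' \<Longrightarrow> teq A B u u' \<Longrightarrow> teq A B (t \<uplus> u) (t' \<uplus> u')"
| id_left: "twf A B t \<Longrightarrow> teq A B (TId (tcod A B t) \<odot> t) t"
| id_right: "twf A B t \<Longrightarrow> teq A B (t \<odot> TId (tdom A B t)) t"
| comp_assoc: "twf A B (t \<odot> u) \<Longrightarrow> twf A B (u \<odot> v) \<Longrightarrow> teq A B ((t \<odot> u) \<odot> v) (t \<odot> (u \<odot> v))"
| plus_id: "xs \<in> tobj A B \<Longrightarrow> ys \<in> tobj A B \<Longrightarrow> teq A B (TId xs \<uplus> TId ys) (TId (xs @ ys))"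
| interchange: "twf A B (t' \<odot> t) \<Longrightarrow> twf A B (u' \<odot> u) \<Longrightarrow>
    teq A B ((t' \<odot> t) \<uplus> (u' \<odot> u)) ((t' \<uplus> u') \<odot> (t \<uplus> u))"
| plus_assoc: "twf A B t \<Longrightarrow> twf A B u \<Longrightarrow> twf A B v \<Longrightarrow> teq A B ((t \<uplus> u) \<uplus> v) (t \<uplus> (u \<uplus> v))"
| plus_zero_left: "twf A B t \<Longrightarrow> teq A B (TId [] \<uplus> t) t"
| plus_zero_right: "twf A B t \<Longrightarrow> teq A B (t \<uplus> TId []) t"
  \<comment> \<open>\<open>Gen\<close> is a functor on \<open>A \<times> B\<close>\<close>
| gen_id: "a \<in> Obj A \<Longrightarrow> b \<in> Obj B \<Longrightarrow> teq A B (Gen (Id A a) (Id B b)) (TId [(a, b)])"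
| gen_comp: "f \<in> Arr A \<Longrightarrow> f' \<in> Arr A \<Longrightarrow> Cod A f = Dom A f' \<Longrightarrow>
    g \<in> Arr B \<Longrightarrow> g' \<in> Arr B \<Longrightarrow> Cod B g = Dom B g' \<Longrightarrow>
    teq A B (Gen (f' \<cdot>\<^bsub>A\<^esub> f) (g' \<cdot>\<^bsub>B\<^esub> g)) (Gen f' g' \<odot> Gen f g)"
| inv_left: "cell_wf A B c \<Longrightarrow> teq A B (Inv c \<odot> Iso c) (TId (cell_dom A B c))"
| inv_right: "cell_wf A B c \<Longrightarrow> teq A B (Iso c \<odot> Inv c) (TId (cell_cod A B c))"
| deltaL_nat: "f \<in> Arr A \<Longrightarrow> g \<in> Arr B \<Longrightarrow> g' \<in> Arr B \<Longrightarrow>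
    teq A B (Iso (DeltaL (Cod A f) (Cod B g) (Cod B g')) \<odot> (Gen f g \<uplus> Gen f g'))
            (Gen f (g \<oplus>\<^sub>a\<^bsub>B\<^esub> g') \<odot> Iso (DeltaL (Dom A f) (Dom B g) (Dom B g')))"
| deltaR_nat: "g \<in> Arr B \<Longrightarrow> f \<in> Arr A \<Longrightarrow> f' \<in> Arr A \<Longrightarrow>
    teq A B (Iso (DeltaR (Cod B g) (Cod A f) (Cod A f')) \<odot> (Gen f g \<uplus> Gen f' g))
            (Gen (f \<oplus>\<^sub>a\<^bsub>A\<^esub> f') g \<odot> Iso (DeltaR (Dom B g) (Dom A f) (Dom A f')))"
| zetaL_nat: "f \<in> Arr A \<Longrightarrow>
    teq A B (Iso (ZetaL (Cod A f))) (Gen f (Id B (zero B)) \<odot> Iso (ZetaL (Dom A f)))"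
| zetaR_nat: "g \<in> Arr B \<Longrightarrow>
    teq A B (Iso (ZetaR (Cod B g))) (Gen (Id A (zero A)) g \<odot> Iso (ZetaR (Dom B g)))"
  \<comment> \<open>permutative structure; naturality is imposed with respect to all arrows\<close>
| beta_nat: "twf A B t \<Longrightarrow> twf A B u \<Longrightarrow>
    teq A B (tbeta (tcod A B t) (tcod A B u) \<odot> (t \<uplus> u))
            ((u \<uplus> t) \<odot> tbeta (tdom A B t) (tdom A B u))"
| beta_inv: "xs \<in> tobj A B \<Longrightarrow> ys \<in> tobj A B \<Longrightarrow>
    teq A B (tbeta ys xs \<odot> tbeta xs ys) (TId (xs @ ys))"
| beta_hex: "xs \<in> tobj A B \<Longrightarrow> ys \<in> tobj A B \<Longrightarrow> zs \<in> tobj A B \<Longrightarrow>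
    teq A B (tbeta xs (ys @ zs)) ((TId ys \<uplus> tbeta xs zs) \<odot> (tbeta xs ys \<uplus> TId zs))"
  \<comment> \<open>\<open>a.(-)\<close> is a symmetric monoidal functor\<close>
| deltaL_assoc: "a \<in> Obj A \<Longrightarrow> b \<in> Obj B \<Longrightarrow> b' \<in> Obj B \<Longrightarrow> b'' \<in> Obj B \<Longrightarrow>
    teq A B (Iso (DeltaL a (b \<oplus>\<^sub>o\<^bsub>B\<^esub> b') b'') \<odot> (Iso (DeltaL a b b') \<uplus> TId [(a, b'')]))
            (Iso (DeltaL a b (b' \<oplus>\<^sub>o\<^bsub>B\<^esub> b'')) \<odot> (TId [(a, b)] \<uplus> Iso (DeltaL a b' b'')))"
| deltaL_unit_right: "a \<in> Obj A \<Longrightarrow> b \<in> Obj B \<Longrightarrow>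
    teq A B (Iso (DeltaL a b (zero B)) \<odot> (TId [(a, b)] \<uplus> Iso (ZetaL a))) (TId [(a, b)])"
| deltaL_unit_left: "a \<in> Obj A \<Longrightarrow> b \<in> Obj B \<Longrightarrow>
    teq A B (Iso (DeltaL a (zero B) b) \<odot> (Iso (ZetaL a) \<uplus> TId [(a, b)])) (TId [(a, b)])"
| deltaL_sym: "a \<in> Obj A \<Longrightarrow> b \<in> Obj B \<Longrightarrow> b' \<in> Obj B \<Longrightarrow>
    teq A B (Gen (Id A a) (sym B b b') \<odot> Iso (DeltaL a b b'))
            (Iso (DeltaL a b' b) \<odot> Iso (Beta (a, b) (a, b')))"
  \<comment> \<open>\<open>(-).b\<close> is a symmetric monoidal functor\<close>
| deltaR_assoc: "b \<in> Obj B \<Longrightarrow> a \<in> Obj A \<Longrightarrow> a' \<in> Obj A \<Longrightarrow> a'' \<in> Obj A \<Longrightarrow>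
    teq A B (Iso (DeltaR b (a \<oplus>\<^sub>o\<^bsub>A\<^esub> a') a'') \<odot> (Iso (DeltaR b a a') \<uplus> TId [(a'', b)]))
            (Iso (DeltaR b a (a' \<oplus>\<^sub>o\<^bsub>A\<^esub> a'')) \<odot> (TId [(a, b)] \<uplus> Iso (DeltaR b a' a'')))"
| deltaR_unit_right: "b \<in> Obj B \<Longrightarrow> a \<in> Obj A \<Longrightarrow>
    teq A B (Iso (DeltaR b a (zero A)) \<odot> (TId [(a, b)] \<uplus> Iso (ZetaR b))) (TId [(a, b)])"
| deltaR_unit_left: "b \<in> Obj B \<Longrightarrow> a \<in> Obj A \<Longrightarrow>
    teq A B (Iso (DeltaR b (zero A) a) \<odot> (Iso (ZetaR b) \<uplus> TId [(a, b)])) (TId [(a, b)])"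
| deltaR_sym: "b \<in> Obj B \<Longrightarrow> a \<in> Obj A \<Longrightarrow> a' \<in> Obj A \<Longrightarrow>
    teq A B (Gen (sym A a a') (Id B b) \<odot> Iso (DeltaR b a a'))
            (Iso (DeltaR b a' a) \<odot> Iso (Beta (a, b) (a', b)))"
| delta_delta: "a \<in> Obj A \<Longrightarrow> a' \<in> Obj A \<Longrightarrow> b \<in> Obj B \<Longrightarrow> b' \<in> Obj B \<Longrightarrow>
    teq A B (Iso (DeltaL (a \<oplus>\<^sub>o\<^bsub>A\<^esub> a') b b') \<odot> (Iso (DeltaR b a a') \<uplus> Iso (DeltaR b' a a')))
            (Iso (DeltaR (b \<oplus>\<^sub>o\<^bsub>B\<^esub> b') a a') \<odot> (Iso (DeltaL a b b') \<uplus> Iso (DeltaL a' b b')) \<odot>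
              (TId [(a, b)] \<uplus> Iso (Beta (a', b) (a, b')) \<uplus> TId [(a', b')]))"
| zeta_zeta: "teq A B (Iso (ZetaL (zero A))) (Iso (ZetaR (zero B)))"
| deltaR_zetaL: "a \<in> Obj A \<Longrightarrow> a' \<in> Obj A \<Longrightarrow>
    teq A B (Iso (DeltaR (zero B) a a') \<odot> (Iso (ZetaL a) \<uplus> Iso (ZetaL a')))
            (Iso (ZetaL (a \<oplus>\<^sub>o\<^bsub>A\<^esub> a')))"
| deltaL_zetaR: "b \<in> Obj B \<Longrightarrow> b' \<in> Obj B \<Longrightarrow>
    teq A B (Iso (DeltaL (zero A) b b') \<odot> (Iso (ZetaR b) \<uplus> Iso (ZetaR b')))
            (Iso (ZetaR (b \<oplus>\<^sub>o\<^bsub>B\<^esub> b')))"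

definition tcls ::
  "('a, 'f, 'z) pcat_scheme \<Rightarrow> ('b, 'g, 'y) pcat_scheme \<Rightarrow> ('a, 'f, 'b, 'g) trm \<Rightarrow> ('a, 'f, 'b, 'g) trm set" where
  "tcls A B t = {u. teq A B t u}"

definition rep :: "'t set \<Rightarrow> 't" where
  "rep X = (SOME t. t \<in> X)"

definition tensor ::
  "('a, 'f, 'z) pcat_scheme \<Rightarrow> ('b, 'g, 'y) pcat_scheme \<Rightarrow>
    (('a \<times> 'b) list, ('a, 'f, 'b, 'g) trm set) pcat" where
  "tensor A B =
    \<lparr>Obj = tobj A B, Arr = {tcls A B t | t. twf A B t},
     Dom = \<lambda>X. tdom A B (rep X), Cod = \<lambda>X. tcod A B (rep X),
     Id = \<lambda>xs. tcls A B (TId xs),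
     Comp = \<lambda>X Y. tcls A B (rep X \<odot> rep Y),
     plusO = (@), plusA = \<lambda>X Y. tcls A B (rep X \<uplus> rep Y),
     zero = [], sym = \<lambda>xs ys. tcls A B (tbeta xs ys)\<rparr>"

section \<open>Strict symmetric monoidal functors out of the tensor product\<close>

text \<open>A strict symmetric monoidal functor on \<open>A \<otimes> B\<close> is determined by the images of the generators
  \<open>a.b\<close>, \<open>f.g\<close>, \<open>\<delta>\<^sup>L\<^sub>a(b, b')\<close>, \<open>\<delta>\<^sup>R\<^sub>b(a, a')\<close>, \<open>\<zeta>\<^sup>L\<^sub>a\<close>, \<open>\<zeta>\<^sup>R\<^sub>b\<close>, while \<open>\<beta>\<close> is sent to \<open>\<beta>\<close>. The following
  record collects these images; the order of arguments is that of the constructors of \<open>cell\<close>.\<close>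

record ('a, 'f, 'b, 'g, 'o, 'm) images =
  im_obj :: "'a \<times> 'b \<Rightarrow> 'o"
  im_gen :: "'f \<Rightarrow> 'g \<Rightarrow> 'm"
  im_deltaL :: "'a \<Rightarrow> 'b \<Rightarrow> 'b \<Rightarrow> 'm"
  im_deltaR :: "'b \<Rightarrow> 'a \<Rightarrow> 'a \<Rightarrow> 'm"
  im_zetaL :: "'a \<Rightarrow> 'm"
  im_zetaR :: "'b \<Rightarrow> 'm"

primrec cell_val ::
  "('o, 'm, 'z) pcat_scheme \<Rightarrow> ('a, 'f, 'b, 'g, 'o, 'm) images \<Rightarrow> ('a, 'b) cell \<Rightarrow> 'm" where
  "cell_val C I (DeltaL a b b') = im_deltaL I a b b'"
| "cell_val C I (DeltaR b a a') = im_deltaR I b a a'"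
| "cell_val C I (Beta p q) = sym C (im_obj I p) (im_obj I q)"
| "cell_val C I (ZetaL a) = im_zetaL I a"
| "cell_val C I (ZetaR b) = im_zetaR I b"

primrec trm_val ::
  "('o, 'm, 'z) pcat_scheme \<Rightarrow> ('a, 'f, 'b, 'g, 'o, 'm) images \<Rightarrow> ('a, 'f, 'b, 'g) trm \<Rightarrow> 'm" where
  "trm_val C I (Gen f g) = im_gen I f g"
| "trm_val C I (Iso c) = cell_val C I c"
| "trm_val C I (Inv c) = inv_arr C (cell_val C I c)"
| "trm_val C I (TId xs) = Id C (osum C (im_obj I) xs)"
| "trm_val C I (t \<odot> u) = trm_val C I t \<cdot>\<^bsub>C\<^esub> trm_val C I u"
| "trm_val C I (t \<uplus> u) = trm_val C I t \<oplus>\<^sub>a\<^bsub>C\<^esub> trm_val C I u"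

definition strict_extension ::
  "('a, 'f, 'z) pcat_scheme \<Rightarrow> ('b, 'g, 'y) pcat_scheme \<Rightarrow> ('o, 'm, 'x) pcat_scheme \<Rightarrow>
    ('a, 'f, 'b, 'g, 'o, 'm) images \<Rightarrow> (('a \<times> 'b) list, ('a, 'f, 'b, 'g) trm set, 'o, 'm) smf" where
  "strict_extension A B C I =
    \<lparr>fobj = \<lambda>xs \<in> tobj A B. osum C (im_obj I) xs,
     farr = \<lambda>X \<in> Arr (tensor A B). trm_val C I (rep X),
     fmult = \<lambda>xs \<in> tobj A B. \<lambda>ys \<in> tobj A B. Id C (osum C (im_obj I) (xs @ ys)),
     funit = Id C (zero C)\<rparr>"

definition tensor_smf ::
  "('a, 'f, 'z) pcat_scheme \<Rightarrow> ('b, 'g, 'y) pcat_scheme \<Rightarrow>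
    ('a1, 'f1, 'x) pcat_scheme \<Rightarrow> ('b1, 'g1, 'w) pcat_scheme \<Rightarrow>
    ('a, 'f, 'a1, 'f1) smf \<Rightarrow> ('b, 'g, 'b1, 'g1) smf \<Rightarrow>
    (('a \<times> 'b) list, ('a, 'f, 'b, 'g) trm set, ('a1 \<times> 'b1) list, ('a1, 'f1, 'b1, 'g1) trm set) smf" where
  "tensor_smf A B A' B' F G = strict_extension A B (tensor A' B')
    \<lparr>im_obj = \<lambda>(a, b). [(fobj F a, fobj G b)],
     im_gen = \<lambda>f g. tcls A' B' (Gen (farr F f) (farr G g)),
     im_deltaL = \<lambda>a b b'. tcls A' B' (Gen (Id A' (fobj F a)) (fmult G b b')) \<cdot>\<^bsub>tensor A' B'\<^esub>
       tcls A' B' (Iso (DeltaL (fobj F a) (fobj G b) (fobj G b'))),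
     im_deltaR = \<lambda>b a a'. tcls A' B' (Gen (fmult F a a') (Id B' (fobj G b))) \<cdot>\<^bsub>tensor A' B'\<^esub>
       tcls A' B' (Iso (DeltaR (fobj G b) (fobj F a) (fobj F a'))),
     im_zetaL = \<lambda>a. tcls A' B' (Gen (Id A' (fobj F a)) (funit G)) \<cdot>\<^bsub>tensor A' B'\<^esub>
       tcls A' B' (Iso (ZetaL (fobj F a))),
     im_zetaR = \<lambda>b. tcls A' B' (Gen (funit F) (Id B' (fobj G b))) \<cdot>\<^bsub>tensor A' B'\<^esub>
       tcls A' B' (Iso (ZetaR (fobj G b)))\<rparr>"

definition tensor_mtrans ::
  "('a, 'f, 'z) pcat_scheme \<Rightarrow> ('b, 'g, 'y) pcat_scheme \<Rightarrow>
    ('a1, 'f1, 'x) pcat_scheme \<Rightarrow> ('b1, 'g1, 'w) pcat_scheme \<Rightarrow>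
    ('a, 'f, 'a1, 'f1) mtrans \<Rightarrow> ('b, 'g, 'b1, 'g1) mtrans \<Rightarrow>
    (('a \<times> 'b) list, ('a, 'f, 'b, 'g) trm set, ('a1 \<times> 'b1) list, ('a1, 'f1, 'b1, 'g1) trm set) mtrans" where
  "tensor_mtrans A B A' B' \<phi> \<psi> =
    \<lparr>msrc = tensor_smf A B A' B' (msrc \<phi>) (msrc \<psi>),
     mtgt = tensor_smf A B A' B' (mtgt \<phi>) (mtgt \<psi>),
     mcomp = \<lambda>xs \<in> tobj A B.
       asum (tensor A' B') (\<lambda>(a, b). tcls A' B' (Gen (mcomp \<phi> a) (mcomp \<psi> b))) xs\<rparr>"

section \<open>Strictification\<close>

definition strictify ::
  "('a, 'f, 'z) pcat_scheme \<Rightarrow> ('b, 'g, 'y) pcat_scheme \<Rightarrow> ('c, 'h, 'x) pcat_scheme \<Rightarrow>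
    (('a \<times> 'b) list, ('a, 'f, 'b, 'g) trm set, 'c, 'h) smf \<Rightarrow>
    (('a \<times> 'b) list, ('a, 'f, 'b, 'g) trm set, 'c, 'h) smf" where
  "strictify A B C F = strict_extension A B C
    \<lparr>im_obj = \<lambda>p. fobj F [p],
     im_gen = \<lambda>f g. farr F (tcls A B (Gen f g)),
     im_deltaL = \<lambda>a b b'. farr F (tcls A B (Iso (DeltaL a b b'))) \<cdot>\<^bsub>C\<^esub> fmult F [(a, b)] [(a, b')],
     im_deltaR = \<lambda>b a a'. farr F (tcls A B (Iso (DeltaR b a a'))) \<cdot>\<^bsub>C\<^esub> fmult F [(a, b)] [(a', b)],
     im_zetaL = \<lambda>a. farr F (tcls A B (Iso (ZetaL a))) \<cdot>\<^bsub>C\<^esub> funit F,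
     im_zetaR = \<lambda>b. farr F (tcls A B (Iso (ZetaR b))) \<cdot>\<^bsub>C\<^esub> funit F\<rparr>"

definition strictify_mtrans ::
  "('a, 'f, 'z) pcat_scheme \<Rightarrow> ('b, 'g, 'y) pcat_scheme \<Rightarrow> ('c, 'h, 'x) pcat_scheme \<Rightarrow>
    (('a \<times> 'b) list, ('a, 'f, 'b, 'g) trm set, 'c, 'h) mtrans \<Rightarrow>
    (('a \<times> 'b) list, ('a, 'f, 'b, 'g) trm set, 'c, 'h) mtrans" where
  "strictify_mtrans A B C \<alpha> =
    \<lparr>msrc = strictify A B C (msrc \<alpha>), mtgt = strictify A B C (mtgt \<alpha>),
     mcomp = \<lambda>xs \<in> tobj A B. asum C (\<lambda>p. mcomp \<alpha> [p]) xs\<rparr>"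

section \<open>The bilinear permutative category \<open>PermCat\<^sub>s(A \<otimes> B, C)\<close>\<close>

definition bil_sum ::
  "('a, 'f, 'z) pcat_scheme \<Rightarrow> ('b, 'g, 'y) pcat_scheme \<Rightarrow> ('c, 'h, 'x) pcat_scheme \<Rightarrow>
    (('a \<times> 'b) list, ('a, 'f, 'b, 'g) trm set, 'c, 'h) smf \<Rightarrow>
    (('a \<times> 'b) list, ('a, 'f, 'b, 'g) trm set, 'c, 'h) smf \<Rightarrow>
    (('a \<times> 'b) list, ('a, 'f, 'b, 'g) trm set, 'c, 'h) smf" where
  "bil_sum A B C F G = strict_extension A B C
    \<lparr>im_obj = \<lambda>p. fobj F [p] \<oplus>\<^sub>o\<^bsub>C\<^esub> fobj G [p],
     im_gen = \<lambda>f g. farr F (tcls A B (Gen f g)) \<oplus>\<^sub>a\<^bsub>C\<^esub> farr G (tcls A B (Gen f g)),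
     im_deltaL = \<lambda>a b b'.
       (farr F (tcls A B (Iso (DeltaL a b b'))) \<oplus>\<^sub>a\<^bsub>C\<^esub> farr G (tcls A B (Iso (DeltaL a b b')))) \<cdot>\<^bsub>C\<^esub>
       midswap C (fobj F [(a, b)]) (fobj G [(a, b)]) (fobj F [(a, b')]) (fobj G [(a, b')]),
     im_deltaR = \<lambda>b a a'.
       (farr F (tcls A B (Iso (DeltaR b a a'))) \<oplus>\<^sub>a\<^bsub>C\<^esub> farr G (tcls A B (Iso (DeltaR b a a')))) \<cdot>\<^bsub>C\<^esub>
       midswap C (fobj F [(a, b)]) (fobj G [(a, b)]) (fobj F [(a', b)]) (fobj G [(a', b)]),
     im_zetaL = \<lambda>a. farr F (tcls A B (Iso (ZetaL a))) \<oplus>\<^sub>a\<^bsub>C\<^esub> farr G (tcls A B (Iso (ZetaL a))),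
     im_zetaR = \<lambda>b. farr F (tcls A B (Iso (ZetaR b))) \<oplus>\<^sub>a\<^bsub>C\<^esub> farr G (tcls A B (Iso (ZetaR b)))\<rparr>"

definition bil_sum_mtrans ::
  "('a, 'f, 'z) pcat_scheme \<Rightarrow> ('b, 'g, 'y) pcat_scheme \<Rightarrow> ('c, 'h, 'x) pcat_scheme \<Rightarrow>
    (('a \<times> 'b) list, ('a, 'f, 'b, 'g) trm set, 'c, 'h) mtrans \<Rightarrow>
    (('a \<times> 'b) list, ('a, 'f, 'b, 'g) trm set, 'c, 'h) mtrans \<Rightarrow>
    (('a \<times> 'b) list, ('a, 'f, 'b, 'g) trm set, 'c, 'h) mtrans" where
  "bil_sum_mtrans A B C \<phi> \<psi> =
    \<lparr>msrc = bil_sum A B C (msrc \<phi>) (msrc \<psi>), mtgt = bil_sum A B C (mtgt \<phi>) (mtgt \<psi>),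
     mcomp = \<lambda>xs \<in> tobj A B. asum C (\<lambda>p. mcomp \<phi> [p] \<oplus>\<^sub>a\<^bsub>C\<^esub> mcomp \<psi> [p]) xs\<rparr>"

definition bil_sym ::
  "('a, 'f, 'z) pcat_scheme \<Rightarrow> ('b, 'g, 'y) pcat_scheme \<Rightarrow> ('c, 'h, 'x) pcat_scheme \<Rightarrow>
    (('a \<times> 'b) list, ('a, 'f, 'b, 'g) trm set, 'c, 'h) smf \<Rightarrow>
    (('a \<times> 'b) list, ('a, 'f, 'b, 'g) trm set, 'c, 'h) smf \<Rightarrow>
    (('a \<times> 'b) list, ('a, 'f, 'b, 'g) trm set, 'c, 'h) mtrans" where
  "bil_sym A B C F G =
    \<lparr>msrc = bil_sum A B C F G, mtgt = bil_sum A B C G F,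
     mcomp = \<lambda>xs \<in> tobj A B. asum C (\<lambda>p. sym C (fobj F [p]) (fobj G [p])) xs\<rparr>"

definition PermCat_s ::
  "('a, 'f, 'z) pcat_scheme \<Rightarrow> ('b, 'g, 'y) pcat_scheme \<Rightarrow> ('c, 'h, 'x) pcat_scheme \<Rightarrow>
    ((('a \<times> 'b) list, ('a, 'f, 'b, 'g) trm set, 'c, 'h) smf,
     (('a \<times> 'b) list, ('a, 'f, 'b, 'g) trm set, 'c, 'h) mtrans) pcat" where
  "PermCat_s A B C =
    \<lparr>Obj = {F. is_strict_smf (tensor A B) C F},
     Arr = {\<phi>. is_mtrans (tensor A B) C \<phi> \<and>
       is_strict_smf (tensor A B) C (msrc \<phi>) \<and> is_strict_smf (tensor A B) C (mtgt \<phi>)},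
     Dom = msrc, Cod = mtgt, Id = mtrans_id (tensor A B) C, Comp = mtrans_vcomp (tensor A B) C,
     plusO = bil_sum A B C, plusA = bil_sum_mtrans A B C,
     zero = zero_smf (tensor A B) C, sym = bil_sym A B C\<rparr>"

definition inclusion ::
  "('a, 'f, 'z) pcat_scheme \<Rightarrow> ('b, 'g, 'y) pcat_scheme \<Rightarrow> ('c, 'h, 'x) pcat_scheme \<Rightarrow>
    ((('a \<times> 'b) list, ('a, 'f, 'b, 'g) trm set, 'c, 'h) smf,
     (('a \<times> 'b) list, ('a, 'f, 'b, 'g) trm set, 'c, 'h) mtrans,
     (('a \<times> 'b) list, ('a, 'f, 'b, 'g) trm set, 'c, 'h) smf,
     (('a \<times> 'b) list, ('a, 'f, 'b, 'g) trm set, 'c, 'h) mtrans) func" where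
  "inclusion A B C =
    \<lparr>fobj = \<lambda>F \<in> Obj (PermCat_s A B C). F, farr = \<lambda>\<phi> \<in> Arr (PermCat_s A B C). \<phi>\<rparr>"

definition strictification ::
  "('a, 'f, 'z) pcat_scheme \<Rightarrow> ('b, 'g, 'y) pcat_scheme \<Rightarrow> ('c, 'h, 'x) pcat_scheme \<Rightarrow>
    ((('a \<times> 'b) list, ('a, 'f, 'b, 'g) trm set, 'c, 'h) smf,
     (('a \<times> 'b) list, ('a, 'f, 'b, 'g) trm set, 'c, 'h) mtrans,
     (('a \<times> 'b) list, ('a, 'f, 'b, 'g) trm set, 'c, 'h) smf,
     (('a \<times> 'b) list, ('a, 'f, 'b, 'g) trm set, 'c, 'h) mtrans) func" where
  "strictification A B C =
    \<lparr>fobj = \<lambda>F \<in> Obj (PermCat (tensor A B) C). strictify A B C F,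
     farr = \<lambda>\<phi> \<in> Arr (PermCat (tensor A B) C). strictify_mtrans A B C \<phi>\<rparr>"

section \<open>Action of 1-cells and 2-cells on hom categories; 2-naturality\<close>

text \<open>For \<open>T : P' \<rightarrow> P\<close> and \<open>H : C \<rightarrow> C'\<close>, the functor sending \<open>K\<close> to \<open>H K T\<close> and \<open>\<alpha>\<close> to the whiskering
  \<open>H \<alpha> T\<close>, defined on a hom category \<open>X\<close> of functors \<open>P \<rightarrow> C\<close>.\<close>

definition hom_act1 ::
  "(('p, 'n, 'c, 'h) smf, ('p, 'n, 'c, 'h) mtrans, 'w) cat_scheme \<Rightarrow>
    ('p1, 'n1, 'z) pcat_scheme \<Rightarrow> ('p, 'n, 'y) pcat_scheme \<Rightarrow>
    ('c, 'h, 'x) pcat_scheme \<Rightarrow> ('c1, 'h1, 'v) pcat_scheme \<Rightarrow>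
    ('p1, 'n1, 'p, 'n) smf \<Rightarrow> ('c, 'h, 'c1, 'h1) smf \<Rightarrow>
    (('p, 'n, 'c, 'h) smf, ('p, 'n, 'c, 'h) mtrans,
     ('p1, 'n1, 'c1, 'h1) smf, ('p1, 'n1, 'c1, 'h1) mtrans) func" where
  "hom_act1 X P' P C C' T H =
    \<lparr>fobj = \<lambda>K \<in> Obj X. smf_comp P' C' H (smf_comp P' C K T),
     farr = \<lambda>\<alpha> \<in> Arr X.
       mtrans_hcomp P' C' (mtrans_id C C' H) (mtrans_hcomp P' C \<alpha> (mtrans_id P' P T))\<rparr>"

text \<open>For 2-cells \<open>\<tau> : T \<Rightarrow> T'\<close> and \<open>\<chi> : H \<Rightarrow> H'\<close>, the natural transformation with component
  \<open>\<chi> * K * \<tau> : H K T \<Rightarrow> H' K T'\<close> at \<open>K\<close>.\<close>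

definition hom_act2 ::
  "('p1, 'n1, 'z) pcat_scheme \<Rightarrow> ('p, 'n, 'y) pcat_scheme \<Rightarrow>
    ('c, 'h, 'x) pcat_scheme \<Rightarrow> ('c1, 'h1, 'v) pcat_scheme \<Rightarrow>
    ('p1, 'n1, 'p, 'n) mtrans \<Rightarrow> ('c, 'h, 'c1, 'h1) mtrans \<Rightarrow>
    ('p, 'n, 'c, 'h) smf \<Rightarrow> ('p1, 'n1, 'c1, 'h1) mtrans" where
  "hom_act2 P' P C C' \<tau> \<chi> K =
    mtrans_hcomp P' C' \<chi> (mtrans_hcomp P' C (mtrans_id P C K) \<tau>)"

text \<open>The naturality conditions of a 2-natural transformation with components \<open>J : X \<rightarrow> Y\<close> and
  \<open>J' : X' \<rightarrow> Y'\<close>, at a 1-cell acting by \<open>U : X \<rightarrow> X'\<close> and \<open>V : Y \<rightarrow> Y'\<close> and at a 2-cell acting by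
  \<open>u : U \<Rightarrow> U'\<close> and \<open>v : V \<Rightarrow> V'\<close>. The latter is the equality of whiskerings \<open>J' u = v J\<close>.\<close>

definition natural_at_1cell ::
  "('o, 'm, 'z) cat_scheme \<Rightarrow> ('p, 'n, 'y) cat_scheme \<Rightarrow>
    ('o1, 'm1, 'x) cat_scheme \<Rightarrow> ('p1, 'n1, 'w) cat_scheme \<Rightarrow>
    ('o, 'm, 'p, 'n) func \<Rightarrow> ('o1, 'm1, 'p1, 'n1) func \<Rightarrow>
    ('o, 'm, 'o1, 'm1) func \<Rightarrow> ('p, 'n, 'p1, 'n1) func \<Rightarrow> bool" where
  "natural_at_1cell X Y X' Y' J J' U V \<longleftrightarrow>
    is_functor X Y J \<and> is_functor X' Y' J' \<and> is_functor X X' U \<and> is_functor Y Y' V \<and>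
    func_comp X J' U = func_comp X V J"

definition natural_at_2cell ::
  "('o, 'm, 'z) cat_scheme \<Rightarrow> ('p, 'n, 'y) cat_scheme \<Rightarrow>
    ('o1, 'm1, 'x) cat_scheme \<Rightarrow> ('p1, 'n1, 'w) cat_scheme \<Rightarrow>
    ('o, 'm, 'p, 'n) func \<Rightarrow> ('o1, 'm1, 'p1, 'n1) func \<Rightarrow>
    ('o, 'm, 'o1, 'm1) func \<Rightarrow> ('o, 'm, 'o1, 'm1) func \<Rightarrow> ('o \<Rightarrow> 'm1) \<Rightarrow>
    ('p, 'n, 'p1, 'n1) func \<Rightarrow> ('p, 'n, 'p1, 'n1) func \<Rightarrow> ('p \<Rightarrow> 'n1) \<Rightarrow> bool" where
  "natural_at_2cell X Y X' Y' J J' U U' u V V' v \<longleftrightarrow>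
    is_functor X Y J \<and> is_functor X' Y' J' \<and> nat_trans X X' U U' u \<and> nat_trans Y Y' V V' v \<and>
    (\<forall>x \<in> Obj X. farr J' (u x) = v (fobj J x))"

end

theory Submission
  imports Defs
begin

text \<open>For a symmetric monoidal \<open>F\<close> on \<open>A \<otimes> B\<close>, the iterated constraints
  \<open>\<Sum> F(a\<^sub>i.b\<^sub>i) \<rightarrow> F(\<Sum> a\<^sub>i.b\<^sub>i)\<close> are invertible. Conjugating \<open>F\<close> by them yields a strict functor that has
  the prescribed values of \<open>F\<^sup>s\<close> on generators, so it is \<open>F\<^sup>s\<close>; thus \<open>F\<^sup>s\<close> respects the relations of
  \<open>A \<otimes> B\<close>, and the constraints form an invertible counit \<open>F\<^sup>s \<Rightarrow> F\<close>, which is the identity for strict \<open>F\<close>.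
  Since \<open>(F + G)\<^sup>s = F\<^sup>s \<boxplus> G\<^sup>s\<close> and strict functors are fixed by \<open>(-)\<^sup>s\<close>, the permutative structure of
  \<open>PermCat\<^sub>s\<close> is the image of the pointwise one, and the constraint of \<open>j\<close> at \<open>F, G\<close> is the inverse of the
  counit at \<open>F + G\<close>. Only \<open>F \<otimes> G\<close> needs the relations: it is induced by the pullback along \<open>F, G\<close> of the
  universal bilinear map. For 2-naturality, the two sides are strict and agree on generators.\<close>

section \<open>Categories and permutative categories\<close>

text \<open>\<open>strict_extension\<close> evaluates a chosen representative of an arrow class, so
  it is a functor only if evaluation respects every clause of \<open>teq\<close>. For
  \<open>F^s\<close> a direct check would redo the coherence of \<open>F\<close> relation by
  relation; conjugation avoids this because \<open>F\<close> is already given on classes.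

  A pointwise sum of strict functors is in general not strict: its constraint is a middle swap.
  Hence \<open>PermCat_s\<close> carries another sum, and \<open>j\<close> is monoidal only up to
  isomorphism. Its constraint has to run from \<open>F + G\<close> to
  \<open>F \<boxplus> G = (F + G)^s\<close>, against the counit, which explains the inverse.

  \<open>F \<otimes> G\<close> is strict even if \<open>F\<close> and \<open>G\<close> are not, as
  their constraints are absorbed into the images of \<delta> and \<zeta>, and it sends a one-term
  sum to a one-term sum. Together with strictness of the functor out of \<open>C\<close>, this is
  why strictifying commutes with the action of 1-cells.\<close>

locale category =
  fixes C :: "('o, 'm, 'z) cat_scheme" (structure)
  assumes is_cat: "is_cat C"
begin

lemma dom_obj [simp]: "f \<in> Arr C \<Longrightarrow> Dom C f \<in> Obj C"
  and cod_obj [simp]: "f \<in> Arr C \<Longrightarrow> Cod C f \<in> Obj C"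
  using is_cat by (auto simp: is_cat_def)

lemma id_arr [simp]: "x \<in> Obj C \<Longrightarrow> Id C x \<in> Arr C"
  and dom_id [simp]: "x \<in> Obj C \<Longrightarrow> Dom C (Id C x) = x"
  and cod_id [simp]: "x \<in> Obj C \<Longrightarrow> Cod C (Id C x) = x"
  using is_cat by (auto simp: is_cat_def hom_def)

lemma comp_arr [simp]: "f \<in> Arr C \<Longrightarrow> g \<in> Arr C \<Longrightarrow> Cod C f = Dom C g \<Longrightarrow> g \<cdot> f \<in> Arr C"
  and dom_comp [simp]: "f \<in> Arr C \<Longrightarrow> g \<in> Arr C \<Longrightarrow> Cod C f = Dom C g \<Longrightarrow> Dom C (g \<cdot> f) = Dom C f"
  and cod_comp [simp]: "f \<in> Arr C \<Longrightarrow> g \<in> Arr C \<Longrightarrow> Cod C f = Dom C g \<Longrightarrow> Cod C (g \<cdot> f) = Cod C g"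
  using is_cat by (auto simp: is_cat_def hom_def)

lemma comp_id [simp]: "f \<in> Arr C \<Longrightarrow> Dom C f = x \<Longrightarrow> f \<cdot> Id C x = f"
  and id_comp [simp]: "f \<in> Arr C \<Longrightarrow> Cod C f = x \<Longrightarrow> Id C x \<cdot> f = f"
  using is_cat by (auto simp: is_cat_def)

lemma comp_assoc [simp]:
  "f \<in> Arr C \<Longrightarrow> g \<in> Arr C \<Longrightarrow> h \<in> Arr C \<Longrightarrow> Cod C f = Dom C g \<Longrightarrow> Cod C g = Dom C h \<Longrightarrow>
    (h \<cdot> g) \<cdot> f = h \<cdot> (g \<cdot> f)"
  using is_cat by (simp add: is_cat_def)

text \<open>Composites are kept nested to the right, where an equation for
  \<open>k \<cdot> h\<close> no longer matches once something precedes \<open>h\<close>.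
  Instantiated with such an equation, this rule yields the form that rewrites in front of a
  tail.\<close>

lemma comp_reassoc:
  assumes "k \<cdot> h = e" "h \<in> Arr C" "k \<in> Arr C" "Cod C h = Dom C k" "f \<in> Arr C" "Cod C f = Dom C h"
  shows "k \<cdot> (h \<cdot> f) = e \<cdot> f"
  using assms by (metis comp_assoc)

section \<open>Inverses and cancellation in a category\<close>

lemma inverse_arrs_unique:
  assumes "inverse_arrs C f g" "inverse_arrs C f h"
  shows "g = h"
proof -
  have "g = g \<cdot> (f \<cdot> h)"
    using assms by (auto simp: inverse_arrs_def hom_def)
  also have "\<dots> = (g \<cdot> f) \<cdot> h"
    using assms by (subst comp_assoc) (auto simp: inverse_arrs_def hom_def)
  also have "\<dots> = h"
    using assms by (auto simp: inverse_arrs_def hom_def)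
  finally show ?thesis .
qed

lemma inv_arr_eq: "inverse_arrs C f g \<Longrightarrow> inv_arr C f = g"
  unfolding inv_arr_def using inverse_arrs_unique by blast

lemma inverse_arrs_inv: "is_iso C f \<Longrightarrow> inverse_arrs C f (inv_arr C f)"
  using inv_arr_eq by (auto simp: is_iso_def)

lemma iso_arr: "is_iso C f \<Longrightarrow> f \<in> Arr C"
  and inv_arr_arr [simp]: "is_iso C f \<Longrightarrow> inv_arr C f \<in> Arr C"
  and dom_inv [simp]: "is_iso C f \<Longrightarrow> Dom C (inv_arr C f) = Cod C f"
  and cod_inv [simp]: "is_iso C f \<Longrightarrow> Cod C (inv_arr C f) = Dom C f"
  and inv_comp [simp]: "is_iso C f \<Longrightarrow> inv_arr C f \<cdot> f = Id C (Dom C f)"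
  and comp_inv [simp]: "is_iso C f \<Longrightarrow> f \<cdot> inv_arr C f = Id C (Cod C f)"
  using inverse_arrs_inv[of f] by (auto simp: inverse_arrs_def hom_def)

lemma inv_comp_cancel [simp]:
  assumes "is_iso C f" "g \<in> Arr C"
  shows "Cod C g = Dom C f \<Longrightarrow> inv_arr C f \<cdot> (f \<cdot> g) = g"
    and "Cod C g = Cod C f \<Longrightarrow> f \<cdot> (inv_arr C f \<cdot> g) = g"
  using assms by (auto simp: comp_reassoc[OF inv_comp] comp_reassoc[OF comp_inv] iso_arr)

lemma iso_cancel_left:
  assumes "is_iso C f" "g \<in> Arr C" "h \<in> Arr C" "Cod C g = Dom C f" "Cod C h = Dom C f" "f \<cdot> g = f \<cdot> h"
  shows "g = h"
  using assms by (metis inv_comp_cancel(1))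

lemma iso_cancel_right:
  assumes "is_iso C f" "g \<in> Arr C" "h \<in> Arr C" "Dom C g = Cod C f" "Dom C h = Cod C f" "g \<cdot> f = h \<cdot> f"
  shows "g = h"
proof -
  have "g = (g \<cdot> f) \<cdot> inv_arr C f"
    using assms(1-5) by (simp add: iso_arr)
  also have "\<dots> = (h \<cdot> f) \<cdot> inv_arr C f"
    using assms(6) by simp
  also have "\<dots> = h"
    using assms(1-5) by (simp add: iso_arr)
  finally show ?thesis .
qed

lemma is_isoI:
  assumes "f \<in> Arr C" "g \<in> Arr C" "Dom C g = Cod C f" "Cod C g = Dom C f"
    "g \<cdot> f = Id C (Dom C f)" "f \<cdot> g = Id C (Cod C f)"
  shows "is_iso C f" and "inv_arr C f = g"
proof -
  have i: "inverse_arrs C f g"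
    using assms by (auto simp: inverse_arrs_def hom_def)
  then show "is_iso C f" by (auto simp: is_iso_def)
  show "inv_arr C f = g" using i by (rule inv_arr_eq)
qed

lemma iso_id [simp]: "x \<in> Obj C \<Longrightarrow> is_iso C (Id C x)"
  and inv_id [simp]: "x \<in> Obj C \<Longrightarrow> inv_arr C (Id C x) = Id C x"
  by - (rule is_isoI[of _ "Id C x"]; simp)+

lemma iso_inv [simp]: "is_iso C f \<Longrightarrow> is_iso C (inv_arr C f)"
  and inv_inv [simp]: "is_iso C f \<Longrightarrow> inv_arr C (inv_arr C f) = f"
  by - (rule is_isoI[where g = f]; simp add: iso_arr)+

lemma iso_comp [simp]:
    "is_iso C f \<Longrightarrow> is_iso C g \<Longrightarrow> Cod C f = Dom C g \<Longrightarrow> is_iso C (g \<cdot> f)"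
  and inv_of_comp:
    "is_iso C f \<Longrightarrow> is_iso C g \<Longrightarrow> Cod C f = Dom C g \<Longrightarrow> inv_arr C (g \<cdot> f) = inv_arr C f \<cdot> inv_arr C g"
  by - (rule is_isoI[where g = "inv_arr C f \<cdot> inv_arr C g"]; simp add: iso_arr)+

end

section \<open>Consequences of the axioms of a permutative category\<close>

locale permcat =
  fixes C :: "('o, 'm, 'z) pcat_scheme" (structure)
  assumes is_permutative: "is_permutative C"

sublocale permcat \<subseteq> category
  using is_permutative by unfold_locales (simp add: is_permutative_def is_strict_monoidal_def)

context permcat
begin

lemma is_strict_monoidal: "is_strict_monoidal C"
  using is_permutative by (simp add: is_permutative_def)

lemma zero_obj [simp]: "zero C \<in> Obj C"
  and plus_obj [simp]: "x \<in> Obj C \<Longrightarrow> y \<in> Obj C \<Longrightarrow> x \<oplus>\<^sub>o y \<in> Obj C"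
  using is_strict_monoidal by (auto simp: is_strict_monoidal_def)

lemma plus_arr [simp]: "f \<in> Arr C \<Longrightarrow> g \<in> Arr C \<Longrightarrow> f \<oplus>\<^sub>a g \<in> Arr C"
  and dom_plus [simp]: "f \<in> Arr C \<Longrightarrow> g \<in> Arr C \<Longrightarrow> Dom C (f \<oplus>\<^sub>a g) = Dom C f \<oplus>\<^sub>o Dom C g"
  and cod_plus [simp]: "f \<in> Arr C \<Longrightarrow> g \<in> Arr C \<Longrightarrow> Cod C (f \<oplus>\<^sub>a g) = Cod C f \<oplus>\<^sub>o Cod C g"
  using is_strict_monoidal by (auto simp: is_strict_monoidal_def hom_def)

lemma id_plus [simp]: "x \<in> Obj C \<Longrightarrow> y \<in> Obj C \<Longrightarrow> Id C x \<oplus>\<^sub>a Id C y = Id C (x \<oplus>\<^sub>o y)"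
  using is_strict_monoidal by (auto simp: is_strict_monoidal_def)

lemma interchange:
  "f \<in> Arr C \<Longrightarrow> f' \<in> Arr C \<Longrightarrow> g \<in> Arr C \<Longrightarrow> g' \<in> Arr C \<Longrightarrow> Cod C f = Dom C f' \<Longrightarrow> Cod C g = Dom C g' \<Longrightarrow>
    (f' \<oplus>\<^sub>a g') \<cdot> (f \<oplus>\<^sub>a g) = (f' \<cdot> f) \<oplus>\<^sub>a (g' \<cdot> g)"
  using is_strict_monoidal by (simp add: is_strict_monoidal_def)

lemma interchange2:
  "f \<in> Arr C \<Longrightarrow> f' \<in> Arr C \<Longrightarrow> g \<in> Arr C \<Longrightarrow> g' \<in> Arr C \<Longrightarrow> Cod C f = Dom C f' \<Longrightarrow> Cod C g = Dom C g' \<Longrightarrow>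
    h \<in> Arr C \<Longrightarrow> Cod C h = Dom C f \<oplus>\<^sub>o Dom C g \<Longrightarrow>
    (f' \<oplus>\<^sub>a g') \<cdot> ((f \<oplus>\<^sub>a g) \<cdot> h) = ((f' \<cdot> f) \<oplus>\<^sub>a (g' \<cdot> g)) \<cdot> h"
  by (subst comp_reassoc[OF interchange]) simp_all

lemma plusO_assoc [simp]:
    "x \<in> Obj C \<Longrightarrow> y \<in> Obj C \<Longrightarrow> z \<in> Obj C \<Longrightarrow> (x \<oplus>\<^sub>o y) \<oplus>\<^sub>o z = x \<oplus>\<^sub>o (y \<oplus>\<^sub>o z)"
  and plusA_assoc [simp]:
    "f \<in> Arr C \<Longrightarrow> g \<in> Arr C \<Longrightarrow> h \<in> Arr C \<Longrightarrow> (f \<oplus>\<^sub>a g) \<oplus>\<^sub>a h = f \<oplus>\<^sub>a (g \<oplus>\<^sub>a h)"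
  and zero_plusO [simp]: "x \<in> Obj C \<Longrightarrow> zero C \<oplus>\<^sub>o x = x" "x \<in> Obj C \<Longrightarrow> x \<oplus>\<^sub>o zero C = x"
  and zero_plusA [simp]: "f \<in> Arr C \<Longrightarrow> Id C (zero C) \<oplus>\<^sub>a f = f" "f \<in> Arr C \<Longrightarrow> f \<oplus>\<^sub>a Id C (zero C) = f"
  using is_strict_monoidal by (simp_all add: is_strict_monoidal_def)

lemma id_plus2 [simp]:
  "x \<in> Obj C \<Longrightarrow> y \<in> Obj C \<Longrightarrow> f \<in> Arr C \<Longrightarrow> Id C x \<oplus>\<^sub>a (Id C y \<oplus>\<^sub>a f) = Id C (x \<oplus>\<^sub>o y) \<oplus>\<^sub>a f"
  by (simp flip: plusA_assoc)

lemma whisker_left: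
  "x \<in> Obj C \<Longrightarrow> f \<in> Arr C \<Longrightarrow> g \<in> Arr C \<Longrightarrow> Cod C f = Dom C g \<Longrightarrow>
    Id C x \<oplus>\<^sub>a (g \<cdot> f) = (Id C x \<oplus>\<^sub>a g) \<cdot> (Id C x \<oplus>\<^sub>a f)"
  and whisker_right:
  "x \<in> Obj C \<Longrightarrow> f \<in> Arr C \<Longrightarrow> g \<in> Arr C \<Longrightarrow> Cod C f = Dom C g \<Longrightarrow>
    (g \<cdot> f) \<oplus>\<^sub>a Id C x = (g \<oplus>\<^sub>a Id C x) \<cdot> (f \<oplus>\<^sub>a Id C x)"
  by (simp_all add: interchange)

text \<open>Arrows on disjoint summands may be applied in either order. Factoring a sum in one way
  and then in the other slides two swaps past each other.\<close>

lemma plus_split: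
  "f \<in> Arr C \<Longrightarrow> g \<in> Arr C \<Longrightarrow> f \<oplus>\<^sub>a g = (f \<oplus>\<^sub>a Id C (Cod C g)) \<cdot> (Id C (Dom C f) \<oplus>\<^sub>a g)"
  and plus_split':
  "f \<in> Arr C \<Longrightarrow> g \<in> Arr C \<Longrightarrow> f \<oplus>\<^sub>a g = (Id C (Cod C f) \<oplus>\<^sub>a g) \<cdot> (f \<oplus>\<^sub>a Id C (Dom C g))"
  by (simp_all add: interchange)

lemma iso_plus [simp]: "is_iso C f \<Longrightarrow> is_iso C g \<Longrightarrow> is_iso C (f \<oplus>\<^sub>a g)"
  and inv_plus:
    "is_iso C f \<Longrightarrow> is_iso C g \<Longrightarrow> inv_arr C (f \<oplus>\<^sub>a g) = inv_arr C f \<oplus>\<^sub>a inv_arr C g"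
  by - (rule is_isoI[where g = "inv_arr C f \<oplus>\<^sub>a inv_arr C g"]; simp add: iso_arr interchange)+

lemma sym_arr [simp]: "x \<in> Obj C \<Longrightarrow> y \<in> Obj C \<Longrightarrow> sym C x y \<in> Arr C"
  and dom_sym [simp]: "x \<in> Obj C \<Longrightarrow> y \<in> Obj C \<Longrightarrow> Dom C (sym C x y) = x \<oplus>\<^sub>o y"
  and cod_sym [simp]: "x \<in> Obj C \<Longrightarrow> y \<in> Obj C \<Longrightarrow> Cod C (sym C x y) = y \<oplus>\<^sub>o x"
  and sym_sym [simp]: "x \<in> Obj C \<Longrightarrow> y \<in> Obj C \<Longrightarrow> sym C y x \<cdot> sym C x y = Id C (x \<oplus>\<^sub>o y)"
  and sym_nat: "f \<in> Arr C \<Longrightarrow> g \<in> Arr C \<Longrightarrow>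
    sym C (Cod C f) (Cod C g) \<cdot> (f \<oplus>\<^sub>a g) = (g \<oplus>\<^sub>a f) \<cdot> sym C (Dom C f) (Dom C g)"
  and sym_plus_right: "x \<in> Obj C \<Longrightarrow> y \<in> Obj C \<Longrightarrow> z \<in> Obj C \<Longrightarrow>
    sym C x (y \<oplus>\<^sub>o z) = (Id C y \<oplus>\<^sub>a sym C x z) \<cdot> (sym C x y \<oplus>\<^sub>a Id C z)"
  using is_permutative by (simp_all add: is_permutative_def hom_def)

lemma iso_sym [simp]: "x \<in> Obj C \<Longrightarrow> y \<in> Obj C \<Longrightarrow> is_iso C (sym C x y)"
  and inv_sym [simp]: "x \<in> Obj C \<Longrightarrow> y \<in> Obj C \<Longrightarrow> inv_arr C (sym C x y) = sym C y x"
  by - (rule is_isoI[where g = "sym C y x"]; simp)+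

text \<open>Only one hexagon is an axiom. Inverting it gives the other one, because the inverse of a
  symmetry is the symmetry with its arguments exchanged.\<close>

lemma sym_plus_left:
  assumes "x \<in> Obj C" "y \<in> Obj C" "z \<in> Obj C"
  shows "sym C (x \<oplus>\<^sub>o y) z = (sym C x z \<oplus>\<^sub>a Id C y) \<cdot> (Id C x \<oplus>\<^sub>a sym C y z)"
proof -
  have "sym C (x \<oplus>\<^sub>o y) z = inv_arr C (sym C z (x \<oplus>\<^sub>o y))"
    using assms by simp
  also have "\<dots> = (sym C x z \<oplus>\<^sub>a Id C y) \<cdot> (Id C x \<oplus>\<^sub>a sym C y z)"
    using assms by (simp add: sym_plus_right inv_of_comp inv_plus del: inv_sym) simp
  finally show ?thesis .
qed

lemma sym_zero [simp]:
  assumes x: "x \<in> Obj C"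
  shows "sym C x (zero C) = Id C x" "sym C (zero C) x = Id C x"
proof -
  \<comment> \<open>The hexagon at \<open>y = z = 0\<close> makes this symmetry idempotent, and an
    invertible idempotent is an identity.\<close>
  have "sym C x (zero C) = sym C x (zero C) \<cdot> sym C x (zero C)"
    using sym_plus_right[OF x zero_obj zero_obj] x by simp
  then have "sym C x (zero C) \<cdot> sym C x (zero C) = sym C x (zero C) \<cdot> Id C x"
    using x by simp
  then show r: "sym C x (zero C) = Id C x"
    using x by (intro iso_cancel_left[of "sym C x (zero C)" "sym C x (zero C)" "Id C x"]) simp_all
  have "sym C (zero C) x = inv_arr C (sym C x (zero C))"
    using x by simp
  then show "sym C (zero C) x = Id C x"
    using x r by simp
qed

lemmas whisker = whisker_left whisker_right

section \<open>Coherence of the middle swap\<close>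

lemma midswap_arr [simp]:
  assumes "w \<in> Obj C" "x \<in> Obj C" "y \<in> Obj C" "z \<in> Obj C"
  shows "midswap C w x y z \<in> Arr C"
    and "Dom C (midswap C w x y z) = w \<oplus>\<^sub>o (x \<oplus>\<^sub>o (y \<oplus>\<^sub>o z))"
    and "Cod C (midswap C w x y z) = w \<oplus>\<^sub>o (y \<oplus>\<^sub>o (x \<oplus>\<^sub>o z))"
    and "is_iso C (midswap C w x y z)"
    and "inv_arr C (midswap C w x y z) = midswap C w y x z"
  using assms by (simp_all add: midswap_def inv_plus)

lemma midswap_midswap:
  assumes "w \<in> Obj C" "x \<in> Obj C" "y \<in> Obj C" "z \<in> Obj C"
  shows "midswap C w x y z \<cdot> midswap C w y x z = Id C (w \<oplus>\<^sub>o (y \<oplus>\<^sub>o (x \<oplus>\<^sub>o z)))"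
  using assms by (simp add: midswap_def interchange)

lemma midswap_zero [simp]:
  assumes "w \<in> Obj C" "x \<in> Obj C" "z \<in> Obj C"
  shows "midswap C w x (zero C) z = Id C (w \<oplus>\<^sub>o (x \<oplus>\<^sub>o z))"
    and "midswap C w (zero C) x z = Id C (w \<oplus>\<^sub>o (x \<oplus>\<^sub>o z))"
  using assms by (simp_all add: midswap_def)

lemma midswap_nat:
  assumes "f \<in> Arr C" "g \<in> Arr C" "h \<in> Arr C" "k \<in> Arr C"
  shows "midswap C (Cod C f) (Cod C g) (Cod C h) (Cod C k) \<cdot> (f \<oplus>\<^sub>a (g \<oplus>\<^sub>a (h \<oplus>\<^sub>a k)))
    = (f \<oplus>\<^sub>a (h \<oplus>\<^sub>a (g \<oplus>\<^sub>a k))) \<cdot> midswap C (Dom C f) (Dom C g) (Dom C h) (Dom C k)"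
proof -
  have "(sym C (Cod C g) (Cod C h) \<oplus>\<^sub>a Id C (Cod C k)) \<cdot> ((g \<oplus>\<^sub>a h) \<oplus>\<^sub>a k) =
    ((h \<oplus>\<^sub>a g) \<oplus>\<^sub>a k) \<cdot> (sym C (Dom C g) (Dom C h) \<oplus>\<^sub>a Id C (Dom C k))"
    using assms by (simp add: interchange sym_nat del: plusA_assoc)
  then show ?thesis
    using assms by (simp add: midswap_def interchange)
qed

text \<open>Both sides shuffle \<open>a+b+c+d+e+f\<close> into \<open>a+c+e+b+d+f\<close>. The
  hexagons split them into elementary swaps, which differ only in the order of the swaps of
  \<open>b\<close> with \<open>c\<close> and of \<open>d\<close> with \<open>e\<close>; these act on
  disjoint summands. This is the coherence behind associativity of the constraint of
  \<open>F + G\<close>.\<close>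

lemma midswap_assoc:
  assumes [simp]: "a \<in> Obj C" "b \<in> Obj C" "c \<in> Obj C" "d \<in> Obj C" "e \<in> Obj C" "f \<in> Obj C"
  shows "midswap C (a \<oplus>\<^sub>o c) (b \<oplus>\<^sub>o d) e f \<cdot> (midswap C a b c d \<oplus>\<^sub>a Id C (e \<oplus>\<^sub>o f)) =
    midswap C a b (c \<oplus>\<^sub>o e) (d \<oplus>\<^sub>o f) \<cdot> (Id C (a \<oplus>\<^sub>o b) \<oplus>\<^sub>a midswap C c d e f)"
proof -
  have "(Id C (a \<oplus>\<^sub>o (c \<oplus>\<^sub>o b)) \<oplus>\<^sub>a (sym C d e \<oplus>\<^sub>a Id C f)) \<cdot> (Id C a \<oplus>\<^sub>a (sym C b c \<oplus>\<^sub>a Id C (d \<oplus>\<^sub>o (e \<oplus>\<^sub>o f))))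
    = (Id C a \<oplus>\<^sub>a sym C b c) \<oplus>\<^sub>a (sym C d e \<oplus>\<^sub>a Id C f)"
    by (subst plus_split'[of "Id C a \<oplus>\<^sub>a sym C b c"]) simp_all
  also have "\<dots> = (Id C a \<oplus>\<^sub>a (sym C b c \<oplus>\<^sub>a Id C (e \<oplus>\<^sub>o (d \<oplus>\<^sub>o f)))) \<cdot> (Id C (a \<oplus>\<^sub>o (b \<oplus>\<^sub>o c)) \<oplus>\<^sub>a (sym C d e \<oplus>\<^sub>a Id C f))"
    by (subst plus_split[of "Id C a \<oplus>\<^sub>a sym C b c"]) simp_all
  finally show ?thesis
    by (simp add: midswap_def sym_plus_left[of b d] sym_plus_right[of _ c] whisker)
qed

text \<open>The symmetry of the two sums expands into four elementary swaps. The one of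
  \<open>a\<close> with \<open>d\<close> is undone by the middle swap on the right, and the others
  form the left side. The symmetry axiom of a pointwise sum reduces to this.\<close>

lemma midswap_sym:
  assumes [simp]: "a \<in> Obj C" "b \<in> Obj C" "c \<in> Obj C" "d \<in> Obj C"
  shows "(sym C a c \<oplus>\<^sub>a sym C b d) \<cdot> midswap C a b c d = midswap C c d a b \<cdot> sym C (a \<oplus>\<^sub>o b) (c \<oplus>\<^sub>o d)"
proof -
  have e: "(sym C a c \<oplus>\<^sub>a Id C (d \<oplus>\<^sub>o b)) \<cdot> (Id C (a \<oplus>\<^sub>o c) \<oplus>\<^sub>a sym C b d) =
    (Id C (c \<oplus>\<^sub>o a) \<oplus>\<^sub>a sym C b d) \<cdot> (sym C a c \<oplus>\<^sub>a Id C (b \<oplus>\<^sub>o d))"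
    by (simp add: interchange)
  have "midswap C c d a b \<cdot> sym C (a \<oplus>\<^sub>o b) (c \<oplus>\<^sub>o d) =
    (Id C c \<oplus>\<^sub>a (sym C d a \<oplus>\<^sub>a Id C b)) \<cdot> ((Id C c \<oplus>\<^sub>a (sym C a d \<oplus>\<^sub>a Id C b)) \<cdot>
    ((Id C (c \<oplus>\<^sub>o a) \<oplus>\<^sub>a sym C b d) \<cdot> ((sym C a c \<oplus>\<^sub>a Id C (b \<oplus>\<^sub>o d)) \<cdot> midswap C a b c d)))"
    by (simp add: midswap_def sym_plus_left[of a b] sym_plus_right[of _ c d] whisker comp_reassoc[OF e])
  also have "\<dots> = (Id C (c \<oplus>\<^sub>o a) \<oplus>\<^sub>a sym C b d) \<cdot> ((sym C a c \<oplus>\<^sub>a Id C (b \<oplus>\<^sub>o d)) \<cdot> midswap C a b c d)"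
    by (subst interchange2) (simp_all add: interchange)
  also have "\<dots> = (sym C a c \<oplus>\<^sub>a sym C b d) \<cdot> midswap C a b c d"
    by (simp add: interchange2)
  finally show ?thesis ..
qed

text \<open>Expresses that the pointwise symmetry is compatible with constraints. It follows from
  \<open>midswap_sym\<close> at \<open>a, c, b, d\<close> after composing with an invertible middle
  swap, which is cancelled at the end.\<close>

lemma midswap_sym':
  assumes [simp]: "a \<in> Obj C" "b \<in> Obj C" "c \<in> Obj C" "d \<in> Obj C"
  shows "sym C (a \<oplus>\<^sub>o c) (b \<oplus>\<^sub>o d) \<cdot> midswap C a b c d = midswap C b a d c \<cdot> (sym C a b \<oplus>\<^sub>a sym C c d)"
proof -
  have "midswap C b d a c \<cdot> (sym C (a \<oplus>\<^sub>o c) (b \<oplus>\<^sub>o d) \<cdot> midswap C a b c d)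
    = (midswap C b d a c \<cdot> sym C (a \<oplus>\<^sub>o c) (b \<oplus>\<^sub>o d)) \<cdot> midswap C a b c d"
    by simp
  also have "\<dots> = (sym C a b \<oplus>\<^sub>a sym C c d) \<cdot> (midswap C a c b d \<cdot> midswap C a b c d)"
    unfolding midswap_sym[of a c b d, symmetric, simplified] by simp
  also have "\<dots> = (midswap C b d a c \<cdot> midswap C b a d c) \<cdot> (sym C a b \<oplus>\<^sub>a sym C c d)"
    by (simp add: midswap_midswap del: comp_assoc)
  finally have "midswap C b d a c \<cdot> (sym C (a \<oplus>\<^sub>o c) (b \<oplus>\<^sub>o d) \<cdot> midswap C a b c d) =
    midswap C b d a c \<cdot> (midswap C b a d c \<cdot> (sym C a b \<oplus>\<^sub>a sym C c d))"
    by simp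
  then show ?thesis
    by (rule iso_cancel_left[rotated -1]) simp_all
qed

text \<open>Both sides sort \<open>a+b+c+a'+b'+c'\<close> into \<open>a+a'+b+b'+c+c'\<close>. This
  makes the constraints of \<open>(F + G) + H\<close> and \<open>F + (G + H)\<close> equal, hence
  the pointwise sum strictly associative.\<close>

lemma midswap_plus:
  assumes [simp]: "a \<in> Obj C" "b \<in> Obj C" "c \<in> Obj C" "a' \<in> Obj C" "b' \<in> Obj C" "c' \<in> Obj C"
  shows "(midswap C a b a' b' \<oplus>\<^sub>a Id C (c \<oplus>\<^sub>o c')) \<cdot> midswap C (a \<oplus>\<^sub>o b) c (a' \<oplus>\<^sub>o b') c' =
    (Id C (a \<oplus>\<^sub>o a') \<oplus>\<^sub>a midswap C b c b' c') \<cdot> midswap C a (b \<oplus>\<^sub>o c) a' (b' \<oplus>\<^sub>o c')"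
proof -
  have "(Id C a \<oplus>\<^sub>a (sym C b a' \<oplus>\<^sub>a Id C (b' \<oplus>\<^sub>o (c \<oplus>\<^sub>o c')))) \<cdot> (Id C (a \<oplus>\<^sub>o (b \<oplus>\<^sub>o a')) \<oplus>\<^sub>a (sym C c b' \<oplus>\<^sub>a Id C c'))
    = (Id C a \<oplus>\<^sub>a sym C b a') \<oplus>\<^sub>a (sym C c b' \<oplus>\<^sub>a Id C c')"
    by (subst plus_split[of "Id C a \<oplus>\<^sub>a sym C b a'"]) simp_all
  also have "\<dots> = (Id C (a \<oplus>\<^sub>o (a' \<oplus>\<^sub>o b)) \<oplus>\<^sub>a (sym C c b' \<oplus>\<^sub>a Id C c')) \<cdot> (Id C a \<oplus>\<^sub>a (sym C b a' \<oplus>\<^sub>a Id C (c \<oplus>\<^sub>o (b' \<oplus>\<^sub>o c'))))"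
    by (subst plus_split'[of "Id C a \<oplus>\<^sub>a sym C b a'"]) simp_all
  also note e = calculation
  show ?thesis
    by (simp add: midswap_def sym_plus_left[of b c] sym_plus_right[of c a'] whisker comp_reassoc[OF e] e)
qed

section \<open>Finite sums of objects and of arrows\<close>

lemma osum_obj [simp]: "(\<And>p. p \<in> set ps \<Longrightarrow> h p \<in> Obj C) \<Longrightarrow> osum C h ps \<in> Obj C"
  by (induction ps) (simp_all add: osum_def)

lemma osum_append:
  "(\<And>p. p \<in> set ps \<union> set qs \<Longrightarrow> h p \<in> Obj C) \<Longrightarrow> osum C h (ps @ qs) = osum C h ps \<oplus>\<^sub>o osum C h qs"
proof (induction ps)
  case Nil
  then show ?case using osum_obj[of qs h] by (simp add: osum_def)
next
  case (Cons p ps)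
  then show ?case using osum_obj[of qs h] osum_obj[of ps h] by (simp add: osum_def)
qed

lemma asum_arr:
  assumes "\<And>p. p \<in> set ps \<Longrightarrow> h p \<in> Arr C"
  shows "asum C h ps \<in> Arr C" "Dom C (asum C h ps) = osum C (\<lambda>p. Dom C (h p)) ps"
    "Cod C (asum C h ps) = osum C (\<lambda>p. Cod C (h p)) ps"
  using assms by (induction ps) (auto simp: asum_def osum_def)

lemma asum_append:
  "(\<And>p. p \<in> set ps \<union> set qs \<Longrightarrow> h p \<in> Arr C) \<Longrightarrow> asum C h (ps @ qs) = asum C h ps \<oplus>\<^sub>a asum C h qs"
proof (induction ps)
  case Nil
  then show ?case using asum_arr[of qs h] by (simp add: asum_def)
next
  case (Cons p ps)
  then show ?case using asum_arr[of qs h] asum_arr[of ps h] by (simp add: asum_def)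
qed

end

lemma osum_simps [simp]: "osum C h [] = zero C" "osum C h (p # ps) = h p \<oplus>\<^sub>o\<^bsub>C\<^esub> osum C h ps"
  by (simp_all add: osum_def)

lemma asum_simps [simp]: "asum C h [] = Id C (zero C)" "asum C h (p # ps) = h p \<oplus>\<^sub>a\<^bsub>C\<^esub> asum C h ps"
  by (simp_all add: asum_def)

lemma osum_cong: "(\<And>p. p \<in> set ps \<Longrightarrow> h p = k p) \<Longrightarrow> osum C h ps = osum C k ps"
  by (induction ps) simp_all

lemma asum_cong: "(\<And>p. p \<in> set ps \<Longrightarrow> h p = k p) \<Longrightarrow> asum C h ps = asum C k ps"
  by (induction ps) simp_all

section \<open>Symmetric monoidal functors and monoidal transformations\<close>

lemma permcatI: "is_permutative C \<Longrightarrow> permcat C"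
  by (rule permcat.intro)

locale smfunctor = A: permcat A + B: permcat B
  for A :: "('o, 'm, 'z) pcat_scheme" and B :: "('p, 'n, 'y) pcat_scheme" +
  fixes F :: "('o, 'm, 'p, 'n) smf"
  assumes is_smf: "is_smf A B F"
begin

lemma is_functor: "is_functor A B F"
  using is_smf by (simp add: is_smf_def)

lemma fobj_ext: "fobj F \<in> extensional (Obj A)"
  and farr_ext: "farr F \<in> extensional (Arr A)"
  and fmult_ext: "fmult F \<in> extensional (Obj A)" "x \<in> Obj A \<Longrightarrow> fmult F x \<in> extensional (Obj A)"
  using is_smf by (simp_all add: is_smf_def is_functor_def)

lemma fobj_obj [simp]: "x \<in> Obj A \<Longrightarrow> fobj F x \<in> Obj B"
  and farr_arr [simp]: "f \<in> Arr A \<Longrightarrow> farr F f \<in> Arr B"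
  and dom_farr [simp]: "f \<in> Arr A \<Longrightarrow> Dom B (farr F f) = fobj F (Dom A f)"
  and cod_farr [simp]: "f \<in> Arr A \<Longrightarrow> Cod B (farr F f) = fobj F (Cod A f)"
  and farr_id [simp]: "x \<in> Obj A \<Longrightarrow> farr F (Id A x) = Id B (fobj F x)"
  and farr_comp: "f \<in> Arr A \<Longrightarrow> g \<in> Arr A \<Longrightarrow> Cod A f = Dom A g \<Longrightarrow>
    farr F (g \<cdot>\<^bsub>A\<^esub> f) = farr F g \<cdot>\<^bsub>B\<^esub> farr F f"
  using is_functor by (simp_all add: is_functor_def hom_def)

lemma fmult_arr [simp]: "x \<in> Obj A \<Longrightarrow> y \<in> Obj A \<Longrightarrow> fmult F x y \<in> Arr B"
  and dom_fmult [simp]: "x \<in> Obj A \<Longrightarrow> y \<in> Obj A \<Longrightarrow> Dom B (fmult F x y) = fobj F x \<oplus>\<^sub>o\<^bsub>B\<^esub> fobj F y"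
  and cod_fmult [simp]: "x \<in> Obj A \<Longrightarrow> y \<in> Obj A \<Longrightarrow> Cod B (fmult F x y) = fobj F (x \<oplus>\<^sub>o\<^bsub>A\<^esub> y)"
  and iso_fmult [simp]: "x \<in> Obj A \<Longrightarrow> y \<in> Obj A \<Longrightarrow> is_iso B (fmult F x y)"
  and funit_arr [simp]: "funit F \<in> Arr B"
  and dom_funit [simp]: "Dom B (funit F) = zero B"
  and cod_funit [simp]: "Cod B (funit F) = fobj F (zero A)"
  and iso_funit [simp]: "is_iso B (funit F)"
  using is_smf by (simp_all add: is_smf_def hom_def)

lemma fmult_nat: "f \<in> Arr A \<Longrightarrow> g \<in> Arr A \<Longrightarrow>
    fmult F (Cod A f) (Cod A g) \<cdot>\<^bsub>B\<^esub> (farr F f \<oplus>\<^sub>a\<^bsub>B\<^esub> farr F g) =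
    farr F (f \<oplus>\<^sub>a\<^bsub>A\<^esub> g) \<cdot>\<^bsub>B\<^esub> fmult F (Dom A f) (Dom A g)"
  and fmult_assoc: "x \<in> Obj A \<Longrightarrow> y \<in> Obj A \<Longrightarrow> z \<in> Obj A \<Longrightarrow>
      fmult F (x \<oplus>\<^sub>o\<^bsub>A\<^esub> y) z \<cdot>\<^bsub>B\<^esub> (fmult F x y \<oplus>\<^sub>a\<^bsub>B\<^esub> Id B (fobj F z)) =
      fmult F x (y \<oplus>\<^sub>o\<^bsub>A\<^esub> z) \<cdot>\<^bsub>B\<^esub> (Id B (fobj F x) \<oplus>\<^sub>a\<^bsub>B\<^esub> fmult F y z)"
  and fmult_unit: "x \<in> Obj A \<Longrightarrow>
      fmult F x (zero A) \<cdot>\<^bsub>B\<^esub> (Id B (fobj F x) \<oplus>\<^sub>a\<^bsub>B\<^esub> funit F) = Id B (fobj F x)"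
    "x \<in> Obj A \<Longrightarrow>
      fmult F (zero A) x \<cdot>\<^bsub>B\<^esub> (funit F \<oplus>\<^sub>a\<^bsub>B\<^esub> Id B (fobj F x)) = Id B (fobj F x)"
  and fmult_sym: "x \<in> Obj A \<Longrightarrow> y \<in> Obj A \<Longrightarrow>
      farr F (sym A x y) \<cdot>\<^bsub>B\<^esub> fmult F x y = fmult F y x \<cdot>\<^bsub>B\<^esub> sym B (fobj F x) (fobj F y)"
  using is_smf by (simp_all add: is_smf_def)

lemma iso_farr [simp]: "is_iso A f \<Longrightarrow> is_iso B (farr F f)"
  and farr_inv: "is_iso A f \<Longrightarrow> farr F (inv_arr A f) = inv_arr B (farr F f)"
proof -
  assume f: "is_iso A f"
  have 1: "farr F (inv_arr A f) \<cdot>\<^bsub>B\<^esub> farr F f = Id B (fobj F (Dom A f))"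
    and 2: "farr F f \<cdot>\<^bsub>B\<^esub> farr F (inv_arr A f) = Id B (fobj F (Cod A f))"
    using f by (simp_all add: A.iso_arr flip: farr_comp)
  note i = B.is_isoI[of "farr F f" "farr F (inv_arr A f)"]
  show "is_iso B (farr F f)" "farr F (inv_arr A f) = inv_arr B (farr F f)"
    using i f 1 2 by (simp_all add: A.iso_arr)
qed

end

lemma smfunctorI: "is_smf A B F \<Longrightarrow> smfunctor A B F"
  by (simp add: smfunctor_def smfunctor_axioms_def is_smf_def permcat_def)

lemma is_smfI:
  assumes "permcat A" "permcat B"
    and "fobj F \<in> extensional (Obj A)" "farr F \<in> extensional (Arr A)"
    and "\<And>x. x \<in> Obj A \<Longrightarrow> fobj F x \<in> Obj B"
    and "\<And>f. f \<in> Arr A \<Longrightarrow> farr F f \<in> Arr B \<and> Dom B (farr F f) = fobj F (Dom A f) \<and> Cod B (farr F f) = fobj F (Cod A f)"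
    and "\<And>x. x \<in> Obj A \<Longrightarrow> farr F (Id A x) = Id B (fobj F x)"
    and "\<And>f g. f \<in> Arr A \<Longrightarrow> g \<in> Arr A \<Longrightarrow> Cod A f = Dom A g \<Longrightarrow>
      farr F (g \<cdot>\<^bsub>A\<^esub> f) = farr F g \<cdot>\<^bsub>B\<^esub> farr F f"
    and "fmult F \<in> extensional (Obj A)" "\<And>x. x \<in> Obj A \<Longrightarrow> fmult F x \<in> extensional (Obj A)"
    and "\<And>x y. x \<in> Obj A \<Longrightarrow> y \<in> Obj A \<Longrightarrow> is_iso B (fmult F x y) \<and>
      Dom B (fmult F x y) = fobj F x \<oplus>\<^sub>o\<^bsub>B\<^esub> fobj F y \<and> Cod B (fmult F x y) = fobj F (x \<oplus>\<^sub>o\<^bsub>A\<^esub> y)"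
    and "is_iso B (funit F) \<and> Dom B (funit F) = zero B \<and> Cod B (funit F) = fobj F (zero A)"
    and "\<And>f g. f \<in> Arr A \<Longrightarrow> g \<in> Arr A \<Longrightarrow>
      fmult F (Cod A f) (Cod A g) \<cdot>\<^bsub>B\<^esub> (farr F f \<oplus>\<^sub>a\<^bsub>B\<^esub> farr F g) =
      farr F (f \<oplus>\<^sub>a\<^bsub>A\<^esub> g) \<cdot>\<^bsub>B\<^esub> fmult F (Dom A f) (Dom A g)"
    and "\<And>x y z. x \<in> Obj A \<Longrightarrow> y \<in> Obj A \<Longrightarrow> z \<in> Obj A \<Longrightarrow>
      fmult F (x \<oplus>\<^sub>o\<^bsub>A\<^esub> y) z \<cdot>\<^bsub>B\<^esub> (fmult F x y \<oplus>\<^sub>a\<^bsub>B\<^esub> Id B (fobj F z)) =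
      fmult F x (y \<oplus>\<^sub>o\<^bsub>A\<^esub> z) \<cdot>\<^bsub>B\<^esub> (Id B (fobj F x) \<oplus>\<^sub>a\<^bsub>B\<^esub> fmult F y z)"
    and "\<And>x. x \<in> Obj A \<Longrightarrow>
      fmult F x (zero A) \<cdot>\<^bsub>B\<^esub> (Id B (fobj F x) \<oplus>\<^sub>a\<^bsub>B\<^esub> funit F) = Id B (fobj F x)"
    and "\<And>x. x \<in> Obj A \<Longrightarrow>
      fmult F (zero A) x \<cdot>\<^bsub>B\<^esub> (funit F \<oplus>\<^sub>a\<^bsub>B\<^esub> Id B (fobj F x)) = Id B (fobj F x)"
    and "\<And>x y. x \<in> Obj A \<Longrightarrow> y \<in> Obj A \<Longrightarrow>
      farr F (sym A x y) \<cdot>\<^bsub>B\<^esub> fmult F x y = fmult F y x \<cdot>\<^bsub>B\<^esub> sym B (fobj F x) (fobj F y)"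
  shows "is_smf A B F"
proof -
  interpret A: permcat A by fact
  interpret B: permcat B by fact
  show ?thesis
    using assms A.is_cat B.is_cat A.is_permutative B.is_permutative
    by (auto simp: is_smf_def is_functor_def hom_def B.iso_arr)
qed

text \<open>Extensionality outside the carriers turns agreement on the carriers into literal
  equality, which is what the categories of functors compare.\<close>

lemma smf_eqI:
  assumes "is_smf A B F" "is_smf A B G"
    and "\<And>x. x \<in> Obj A \<Longrightarrow> fobj F x = fobj G x"
    and "\<And>f. f \<in> Arr A \<Longrightarrow> farr F f = farr G f"
    and "\<And>x y. x \<in> Obj A \<Longrightarrow> y \<in> Obj A \<Longrightarrow> fmult F x y = fmult G x y"
    and "funit F = funit G"
  shows "F = G"
proof -
  interpret F: smfunctor A B F by (rule smfunctorI) fact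
  interpret G: smfunctor A B G by (rule smfunctorI) fact
  show ?thesis
  proof (rule smf.equality)
    show "fobj F = fobj G"
      using F.fobj_ext G.fobj_ext assms by (auto intro: extensionalityI)
    show "farr F = farr G"
      using F.farr_ext G.farr_ext assms by (auto intro: extensionalityI)
    show "fmult F = fmult G"
      by (rule extensionalityI[OF F.fmult_ext(1) G.fmult_ext(1)],
          rule extensionalityI[OF F.fmult_ext(2) G.fmult_ext(2)]) (use assms in auto)
  qed (use assms in auto)
qed

locale mtransf = F: smfunctor A B "msrc \<phi>" + G: smfunctor A B "mtgt \<phi>"
  for A :: "('o, 'm, 'z) pcat_scheme" and B :: "('p, 'n, 'y) pcat_scheme" and \<phi> +
  assumes is_mtrans: "is_mtrans A B \<phi>"
begin

lemma mcomp_ext: "mcomp \<phi> \<in> extensional (Obj A)"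
  and mcomp_arr [simp]: "x \<in> Obj A \<Longrightarrow> mcomp \<phi> x \<in> Arr B"
  and dom_mcomp [simp]: "x \<in> Obj A \<Longrightarrow> Dom B (mcomp \<phi> x) = fobj (msrc \<phi>) x"
  and cod_mcomp [simp]: "x \<in> Obj A \<Longrightarrow> Cod B (mcomp \<phi> x) = fobj (mtgt \<phi>) x"
  and mcomp_nat: "f \<in> Arr A \<Longrightarrow>
    mcomp \<phi> (Cod A f) \<cdot>\<^bsub>B\<^esub> farr (msrc \<phi>) f = farr (mtgt \<phi>) f \<cdot>\<^bsub>B\<^esub> mcomp \<phi> (Dom A f)"
  and mcomp_plus: "x \<in> Obj A \<Longrightarrow> y \<in> Obj A \<Longrightarrow>
      mcomp \<phi> (x \<oplus>\<^sub>o\<^bsub>A\<^esub> y) \<cdot>\<^bsub>B\<^esub> fmult (msrc \<phi>) x y =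
      fmult (mtgt \<phi>) x y \<cdot>\<^bsub>B\<^esub> (mcomp \<phi> x \<oplus>\<^sub>a\<^bsub>B\<^esub> mcomp \<phi> y)"
  and mcomp_zero: "mcomp \<phi> (zero A) \<cdot>\<^bsub>B\<^esub> funit (msrc \<phi>) = funit (mtgt \<phi>)"
  using is_mtrans by (simp_all add: is_mtrans_def nat_trans_def hom_def)

end

lemma mtransfI: "is_mtrans A B \<phi> \<Longrightarrow> mtransf A B \<phi>"
  by (simp add: mtransf_def mtransf_axioms_def smfunctorI is_mtrans_def)

lemma is_mtrans_smf: "is_mtrans A B \<phi> \<Longrightarrow> is_smf A B (msrc \<phi>)" "is_mtrans A B \<phi> \<Longrightarrow> is_smf A B (mtgt \<phi>)"
  by (simp_all add: is_mtrans_def)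

lemma is_mtransI:
  assumes "is_smf A B (msrc \<phi>)" "is_smf A B (mtgt \<phi>)" "mcomp \<phi> \<in> extensional (Obj A)"
    and "\<And>x. x \<in> Obj A \<Longrightarrow> mcomp \<phi> x \<in> Arr B \<and>
      Dom B (mcomp \<phi> x) = fobj (msrc \<phi>) x \<and> Cod B (mcomp \<phi> x) = fobj (mtgt \<phi>) x"
    and "\<And>f. f \<in> Arr A \<Longrightarrow>
      mcomp \<phi> (Cod A f) \<cdot>\<^bsub>B\<^esub> farr (msrc \<phi>) f = farr (mtgt \<phi>) f \<cdot>\<^bsub>B\<^esub> mcomp \<phi> (Dom A f)"
    and "\<And>x y. x \<in> Obj A \<Longrightarrow> y \<in> Obj A \<Longrightarrow>
      mcomp \<phi> (x \<oplus>\<^sub>o\<^bsub>A\<^esub> y) \<cdot>\<^bsub>B\<^esub> fmult (msrc \<phi>) x y =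
      fmult (mtgt \<phi>) x y \<cdot>\<^bsub>B\<^esub> (mcomp \<phi> x \<oplus>\<^sub>a\<^bsub>B\<^esub> mcomp \<phi> y)"
    and "mcomp \<phi> (zero A) \<cdot>\<^bsub>B\<^esub> funit (msrc \<phi>) = funit (mtgt \<phi>)"
  shows "is_mtrans A B \<phi>"
  using assms smfunctor.is_functor[OF smfunctorI[OF assms(1)]] smfunctor.is_functor[OF smfunctorI[OF assms(2)]]
  by (simp add: is_mtrans_def nat_trans_def hom_def)

lemma mtrans_eqI:
  fixes \<phi> \<psi> :: "('o, 'm, 'p, 'n) mtrans"
  assumes "msrc \<phi> = msrc \<psi>" "mtgt \<phi> = mtgt \<psi>"
    and "mcomp \<phi> \<in> extensional X" "mcomp \<psi> \<in> extensional X"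
    and "\<And>x. x \<in> X \<Longrightarrow> mcomp \<phi> x = mcomp \<psi> x"
  shows "\<phi> = \<psi>"
  by (rule mtrans.equality) (use assms in \<open>auto intro: extensionalityI\<close>)

lemma mtrans_sel [simp]:
  "msrc (mtrans_id A B F) = F" "mtgt (mtrans_id A B F) = F"
  "mcomp (mtrans_id A B F) = (\<lambda>x\<in>Obj A. Id B (fobj F x))"
  "msrc (mtrans_vcomp A B \<psi> \<phi>) = msrc \<phi>" "mtgt (mtrans_vcomp A B \<psi> \<phi>) = mtgt \<psi>"
  "mcomp (mtrans_vcomp A B \<psi> \<phi>) = (\<lambda>x\<in>Obj A. mcomp \<psi> x \<cdot>\<^bsub>B\<^esub> mcomp \<phi> x)"
  "msrc (pw_sum_mtrans A B \<phi> \<psi>) = pw_sum A B (msrc \<phi>) (msrc \<psi>)"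
  "mtgt (pw_sum_mtrans A B \<phi> \<psi>) = pw_sum A B (mtgt \<phi>) (mtgt \<psi>)"
  "mcomp (pw_sum_mtrans A B \<phi> \<psi>) = (\<lambda>x\<in>Obj A. mcomp \<phi> x \<oplus>\<^sub>a\<^bsub>B\<^esub> mcomp \<psi> x)"
  "msrc (pw_sym A B F G) = pw_sum A B F G" "mtgt (pw_sym A B F G) = pw_sum A B G F"
  "mcomp (pw_sym A B F G) = (\<lambda>x\<in>Obj A. sym B (fobj F x) (fobj G x))"
  by (simp_all add: mtrans_id_def mtrans_vcomp_def pw_sum_mtrans_def pw_sym_def)

section \<open>The pointwise permutative structure\<close>

lemma PermCat_sel [simp]:
  "Obj (PermCat A B) = {F. is_smf A B F}" "Arr (PermCat A B) = {\<phi>. is_mtrans A B \<phi>}"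
  "Dom (PermCat A B) = msrc" "Cod (PermCat A B) = mtgt"
  "Id (PermCat A B) = mtrans_id A B" "Comp (PermCat A B) = mtrans_vcomp A B"
  "plusO (PermCat A B) = pw_sum A B" "plusA (PermCat A B) = pw_sum_mtrans A B"
  "zero (PermCat A B) = zero_smf A B" "sym (PermCat A B) = pw_sym A B"
  by (simp_all add: PermCat_def)

lemma pw_sum_sel [simp]:
  "fobj (pw_sum A B F G) = (\<lambda>x\<in>Obj A. fobj F x \<oplus>\<^sub>o\<^bsub>B\<^esub> fobj G x)"
  "farr (pw_sum A B F G) = (\<lambda>f\<in>Arr A. farr F f \<oplus>\<^sub>a\<^bsub>B\<^esub> farr G f)"
  "fmult (pw_sum A B F G) = (\<lambda>x\<in>Obj A. \<lambda>y\<in>Obj A.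
       (fmult F x y \<oplus>\<^sub>a\<^bsub>B\<^esub> fmult G x y) \<cdot>\<^bsub>B\<^esub> midswap B (fobj F x) (fobj G x) (fobj F y) (fobj G y))"
  "funit (pw_sum A B F G) = funit F \<oplus>\<^sub>a\<^bsub>B\<^esub> funit G"
  by (simp_all add: pw_sum_def)

lemma zero_smf_sel [simp]:
  "fobj (zero_smf A B) = (\<lambda>x\<in>Obj A. zero B)"
  "farr (zero_smf A B) = (\<lambda>f\<in>Arr A. Id B (zero B))"
  "fmult (zero_smf A B) = (\<lambda>x\<in>Obj A. \<lambda>y\<in>Obj A. Id B (zero B))"
  "funit (zero_smf A B) = Id B (zero B)"
  by (simp_all add: zero_smf_def)

lemma mtrans_id_is_mtrans [simp]:
  assumes "is_smf A B F"
  shows "is_mtrans A B (mtrans_id A B F)"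
proof -
  interpret smfunctor A B F by (rule smfunctorI) fact
  show ?thesis
    by (rule is_mtransI) (use assms in simp_all)
qed

lemma mtrans_vcomp_is_mtrans:
  assumes "is_mtrans A B \<phi>" "is_mtrans A B \<psi>" "mtgt \<phi> = msrc \<psi>"
  shows "is_mtrans A B (mtrans_vcomp A B \<psi> \<phi>)"
proof -
  interpret f: mtransf A B \<phi> by (rule mtransfI) fact
  interpret g: mtransf A B \<psi> by (rule mtransfI) fact
  let ?v = "mtrans_vcomp A B \<psi> \<phi>"
  \<comment> \<open>The facts about \<open>\<phi>\<close> are restated with
    \<open>msrc \<psi>\<close> in place of \<open>mtgt \<phi>\<close>, so that they meet those about
    \<open>\<psi>\<close>.\<close>
  note f.dom_mcomp [simp del] f.cod_mcomp[simp del]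
  note f.cod_mcomp[unfolded assms(3), simp] f.dom_mcomp[simp]
  note f.mcomp_nat[unfolded assms(3), simp] f.mcomp_plus[unfolded assms(3), simp]  f.mcomp_zero[unfolded assms(3), simp]
  show ?thesis
  proof (rule is_mtransI)
    fix h assume h: "h \<in> Arr A"
    show "mcomp ?v (Cod A h) \<cdot>\<^bsub>B\<^esub> farr (msrc ?v) h = farr (mtgt ?v) h \<cdot>\<^bsub>B\<^esub> mcomp ?v (Dom A h)"
      using h f.F.B.comp_reassoc[OF g.mcomp_nat[OF h], of "mcomp \<phi> (Dom A h)"]
      by simp
  next
    fix x y assume x: "x \<in> Obj A" and y: "y \<in> Obj A"
    show "mcomp ?v (x \<oplus>\<^sub>o\<^bsub>A\<^esub> y) \<cdot>\<^bsub>B\<^esub> fmult (msrc ?v) x y = fmult (mtgt ?v) x y \<cdot>\<^bsub>B\<^esub> (mcomp ?v x \<oplus>\<^sub>a\<^bsub>B\<^esub> mcomp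
      ?v y)"
      using x y f.F.B.comp_reassoc[OF g.mcomp_plus[OF x y], of "mcomp \<phi> x \<oplus>\<^sub>a\<^bsub>B\<^esub> mcomp \<phi> y"]
      by (simp add: f.F.B.interchange)
  qed (use f.F.is_smf g.G.is_smf g.mcomp_zero in simp_all)
qed

text \<open>Each axiom is the sum of the axioms for \<open>F\<close> and \<open>G\<close> up to
  middle swaps. Naturality moves the swaps to the right of all constraints; what remains between the
  swaps alone is \<open>midswap_assoc\<close> or \<open>midswap_sym\<close>.\<close>

lemma pw_sum_is_smf:
  assumes "is_smf A B F" "is_smf A B G"
  shows "is_smf A B (pw_sum A B F G)"
proof -
  interpret F: smfunctor A B F by (rule smfunctorI) fact
  interpret G: smfunctor A B G by (rule smfunctorI) fact
  let ?S = "pw_sum A B F G"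
  show ?thesis
  proof (rule is_smfI)
    fix f g assume f: "f \<in> Arr A" "g \<in> Arr A"
    have "((fmult F (Cod A f) (Cod A g) \<cdot>\<^bsub>B\<^esub> (farr F f \<oplus>\<^sub>a\<^bsub>B\<^esub> farr F g)) \<oplus>\<^sub>a\<^bsub>B\<^esub>
         (fmult G (Cod A f) (Cod A g) \<cdot>\<^bsub>B\<^esub> (farr G f \<oplus>\<^sub>a\<^bsub>B\<^esub> farr G g))) \<cdot>\<^bsub>B\<^esub>
        midswap B (fobj F (Dom A f)) (fobj G (Dom A f)) (fobj F (Dom A g)) (fobj G (Dom A g)) =
      ((farr F (f \<oplus>\<^sub>a\<^bsub>A\<^esub> g) \<cdot>\<^bsub>B\<^esub> fmult F (Dom A f) (Dom A g)) \<oplus>\<^sub>a\<^bsub>B\<^esub>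
       (farr G (f \<oplus>\<^sub>a\<^bsub>A\<^esub> g) \<cdot>\<^bsub>B\<^esub> fmult G (Dom A f) (Dom A g))) \<cdot>\<^bsub>B\<^esub>
        midswap B (fobj F (Dom A f)) (fobj G (Dom A f)) (fobj F (Dom A g)) (fobj G (Dom A g))"
      using f by (simp add: F.fmult_nat G.fmult_nat)
    then show "fmult ?S (Cod A f) (Cod A g) \<cdot>\<^bsub>B\<^esub> (farr ?S f \<oplus>\<^sub>a\<^bsub>B\<^esub> farr ?S g) = farr ?S (f \<oplus>\<^sub>a\<^bsub>A\<^esub> g) \<cdot>\<^bsub>B\<^esub>
      fmult ?S (Dom A f) (Dom A g)"
      using f F.B.midswap_nat[of "farr F f" "farr G f" "farr F g" "farr G g"]
      by (simp flip: F.B.interchange)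
  next
    fix x y z assume o: "x \<in> Obj A" "y \<in> Obj A" "z \<in> Obj A"
    let ?m = "midswap B"
    have 1: "?m (fobj F (x \<oplus>\<^sub>o\<^bsub>A\<^esub> y)) (fobj G (x \<oplus>\<^sub>o\<^bsub>A\<^esub> y)) (fobj F z) (fobj G z) \<cdot>\<^bsub>B\<^esub>
        (fmult F x y \<oplus>\<^sub>a\<^bsub>B\<^esub> (fmult G x y \<oplus>\<^sub>a\<^bsub>B\<^esub> Id B (fobj F z \<oplus>\<^sub>o\<^bsub>B\<^esub> fobj G z))) =
       (fmult F x y \<oplus>\<^sub>a\<^bsub>B\<^esub> (Id B (fobj F z) \<oplus>\<^sub>a\<^bsub>B\<^esub> (fmult G x y \<oplus>\<^sub>a\<^bsub>B\<^esub> Id B (fobj G z)))) \<cdot>\<^bsub>B\<^esub>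
        ?m (fobj F x \<oplus>\<^sub>o\<^bsub>B\<^esub> fobj F y) (fobj G x \<oplus>\<^sub>o\<^bsub>B\<^esub> fobj G y) (fobj F z) (fobj G z)"
      using o F.B.midswap_nat[of "fmult F x y" "fmult G x y" "Id B (fobj F z)" "Id B (fobj G z)"] by simp
    have 2: "?m (fobj F x) (fobj G x) (fobj F (y \<oplus>\<^sub>o\<^bsub>A\<^esub> z)) (fobj G (y \<oplus>\<^sub>o\<^bsub>A\<^esub> z)) \<cdot>\<^bsub>B\<^esub>
        (Id B (fobj F x \<oplus>\<^sub>o\<^bsub>B\<^esub> fobj G x) \<oplus>\<^sub>a\<^bsub>B\<^esub> (fmult F y z \<oplus>\<^sub>a\<^bsub>B\<^esub> fmult G y z)) =
       (Id B (fobj F x) \<oplus>\<^sub>a\<^bsub>B\<^esub> (fmult F y z \<oplus>\<^sub>a\<^bsub>B\<^esub> (Id B (fobj G x) \<oplus>\<^sub>a\<^bsub>B\<^esub> fmult G y z))) \<cdot>\<^bsub>B\<^esub>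
        ?m (fobj F x) (fobj G x) (fobj F y \<oplus>\<^sub>o\<^bsub>B\<^esub> fobj F z) (fobj G y \<oplus>\<^sub>o\<^bsub>B\<^esub> fobj G z)"
      using o F.B.midswap_nat[of "Id B (fobj F x)" "Id B (fobj G x)" "fmult F y z" "fmult G y z"] by simp
    let ?M = "?m (fobj F x) (fobj G x) (fobj F y \<oplus>\<^sub>o\<^bsub>B\<^esub> fobj F z) (fobj G y \<oplus>\<^sub>o\<^bsub>B\<^esub> fobj G z) \<cdot>\<^bsub>B\<^esub>
      (Id B (fobj F x \<oplus>\<^sub>o\<^bsub>B\<^esub> fobj G x) \<oplus>\<^sub>a\<^bsub>B\<^esub> ?m (fobj F y) (fobj G y) (fobj F z) (fobj G z))"
    have "fmult ?S (x \<oplus>\<^sub>o\<^bsub>A\<^esub> y) z \<cdot>\<^bsub>B\<^esub> (fmult ?S x y \<oplus>\<^sub>a\<^bsub>B\<^esub> Id B (fobj ?S z)) = ((fmult F (x \<oplus>\<^sub>o\<^bsub>A\<^esub> y) z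
      \<cdot>\<^bsub>B\<^esub> (fmult F x y \<oplus>\<^sub>a\<^bsub>B\<^esub> Id B (fobj F z))) \<oplus>\<^sub>a\<^bsub>B\<^esub> (fmult G (x \<oplus>\<^sub>o\<^bsub>A\<^esub> y) z \<cdot>\<^bsub>B\<^esub> (fmult G x y \<oplus>\<^sub>a\<^bsub>B\<^esub> Id
      B (fobj G z)))) \<cdot>\<^bsub>B\<^esub> ?M"
      using o
      by (simp add: F.B.whisker_right F.B.comp_reassoc[OF 1] flip: F.B.interchange F.B.midswap_assoc)
    also have "\<dots> = ((fmult F x (y \<oplus>\<^sub>o\<^bsub>A\<^esub> z) \<cdot>\<^bsub>B\<^esub> (Id B (fobj F x) \<oplus>\<^sub>a\<^bsub>B\<^esub> fmult F y z)) \<oplus>\<^sub>a\<^bsub>B\<^esub>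
       (fmult G x (y \<oplus>\<^sub>o\<^bsub>A\<^esub> z) \<cdot>\<^bsub>B\<^esub> (Id B (fobj G x) \<oplus>\<^sub>a\<^bsub>B\<^esub> fmult G y z))) \<cdot>\<^bsub>B\<^esub> ?M"
      using o by (simp only: F.fmult_assoc G.fmult_assoc)
    also have "\<dots> = fmult ?S x (y \<oplus>\<^sub>o\<^bsub>A\<^esub> z) \<cdot>\<^bsub>B\<^esub> (Id B (fobj ?S x) \<oplus>\<^sub>a\<^bsub>B\<^esub> fmult ?S y z)"
      using o
      by (simp add: F.B.whisker_left F.B.comp_reassoc[OF 2] flip: F.B.interchange)
    finally show "fmult ?S (x \<oplus>\<^sub>o\<^bsub>A\<^esub> y) z \<cdot>\<^bsub>B\<^esub> (fmult ?S x y \<oplus>\<^sub>a\<^bsub>B\<^esub> Id B (fobj ?S z)) = fmult ?S x (y \<oplus>\<^sub>o\<^bsub>A\<^esub>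
      z) \<cdot>\<^bsub>B\<^esub> (Id B (fobj ?S x) \<oplus>\<^sub>a\<^bsub>B\<^esub> fmult ?S y z)" .
  next
    fix x assume x: "x \<in> Obj A"
    have 1: "midswap B (fobj F x) (fobj G x) (fobj F (zero A)) (fobj G (zero A)) \<cdot>\<^bsub>B\<^esub>
        (Id B (fobj F x \<oplus>\<^sub>o\<^bsub>B\<^esub> fobj G x) \<oplus>\<^sub>a\<^bsub>B\<^esub> (funit F \<oplus>\<^sub>a\<^bsub>B\<^esub> funit G)) =
       (Id B (fobj F x) \<oplus>\<^sub>a\<^bsub>B\<^esub> (funit F \<oplus>\<^sub>a\<^bsub>B\<^esub> (Id B (fobj G x) \<oplus>\<^sub>a\<^bsub>B\<^esub> funit G)))"
      using x F.B.midswap_nat[of "Id B (fobj F x)" "Id B (fobj G x)" "funit F" "funit G"] by simp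
    show "fmult ?S x (zero A) \<cdot>\<^bsub>B\<^esub> (Id B (fobj ?S x) \<oplus>\<^sub>a\<^bsub>B\<^esub> funit ?S) = Id B (fobj ?S x)"
      using x 1 F.B.interchange[of "Id B (fobj F x) \<oplus>\<^sub>a\<^bsub>B\<^esub> funit F" "fmult F x (zero A)"
          "Id B (fobj G x) \<oplus>\<^sub>a\<^bsub>B\<^esub> funit G" "fmult G x (zero A)"]
      by (simp add: F.fmult_unit G.fmult_unit)
    have 2: "midswap B (fobj F (zero A)) (fobj G (zero A)) (fobj F x) (fobj G x) \<cdot>\<^bsub>B\<^esub>
        (funit F \<oplus>\<^sub>a\<^bsub>B\<^esub> (funit G \<oplus>\<^sub>a\<^bsub>B\<^esub> Id B (fobj F x \<oplus>\<^sub>o\<^bsub>B\<^esub> fobj G x))) =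
       (funit F \<oplus>\<^sub>a\<^bsub>B\<^esub> (Id B (fobj F x) \<oplus>\<^sub>a\<^bsub>B\<^esub> (funit G \<oplus>\<^sub>a\<^bsub>B\<^esub> Id B (fobj G x))))"
      using x F.B.midswap_nat[of "funit F" "funit G" "Id B (fobj F x)" "Id B (fobj G x)"] by simp
    show "fmult ?S (zero A) x \<cdot>\<^bsub>B\<^esub> (funit ?S \<oplus>\<^sub>a\<^bsub>B\<^esub> Id B (fobj ?S x)) = Id B (fobj ?S x)"
      using x 2 F.B.interchange[of "funit F \<oplus>\<^sub>a\<^bsub>B\<^esub> Id B (fobj F x)" "fmult F (zero A) x"
          "funit G \<oplus>\<^sub>a\<^bsub>B\<^esub> Id B (fobj G x)" "fmult G (zero A) x"]
      by (simp add: F.fmult_unit G.fmult_unit)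
  next
    fix x y assume o: "x \<in> Obj A" "y \<in> Obj A"
    have 1: "(farr F (sym A x y) \<oplus>\<^sub>a\<^bsub>B\<^esub> farr G (sym A x y)) \<cdot>\<^bsub>B\<^esub> (fmult F x y \<oplus>\<^sub>a\<^bsub>B\<^esub> fmult G x y) =
      (fmult F y x \<oplus>\<^sub>a\<^bsub>B\<^esub> fmult G y x) \<cdot>\<^bsub>B\<^esub> (sym B (fobj F x) (fobj F y) \<oplus>\<^sub>a\<^bsub>B\<^esub> sym B (fobj G x) (fobj G y))"
      using o by (simp add: F.B.interchange F.fmult_sym G.fmult_sym)
    show "farr ?S (sym A x y) \<cdot>\<^bsub>B\<^esub> fmult ?S x y = fmult ?S y x \<cdot>\<^bsub>B\<^esub> sym B (fobj ?S x) (fobj ?S y)"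
      using o by (simp add: F.B.comp_reassoc[OF 1] F.B.midswap_sym)
  qed (simp_all add: F.A.permcat_axioms F.B.permcat_axioms F.farr_comp G.farr_comp F.B.interchange)
qed

lemma zero_smf_is_smf:
  assumes "permcat A" "permcat B"
  shows "is_smf A B (zero_smf A B)"
proof -
  interpret A: permcat A by fact
  interpret B: permcat B by fact
  show ?thesis
    by (rule is_smfI) (use assms in simp_all)
qed

lemma pw_sum_mtrans_is_mtrans:
  assumes "is_mtrans A B \<phi>" "is_mtrans A B \<psi>"
  shows "is_mtrans A B (pw_sum_mtrans A B \<phi> \<psi>)"
proof -
  interpret f: mtransf A B \<phi> by (rule mtransfI) fact
  interpret g: mtransf A B \<psi> by (rule mtransfI) fact
  let ?s = "pw_sum_mtrans A B \<phi> \<psi>"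
  show ?thesis
  proof (rule is_mtransI)
    fix x y assume o: "x \<in> Obj A" "y \<in> Obj A"
    have 1: "(mcomp \<phi> (x \<oplus>\<^sub>o\<^bsub>A\<^esub> y) \<oplus>\<^sub>a\<^bsub>B\<^esub> mcomp \<psi> (x \<oplus>\<^sub>o\<^bsub>A\<^esub> y)) \<cdot>\<^bsub>B\<^esub> (fmult (msrc \<phi>) x y \<oplus>\<^sub>a\<^bsub>B\<^esub> fmult (msrc \<psi>) x y) =
      (fmult (mtgt \<phi>) x y \<oplus>\<^sub>a\<^bsub>B\<^esub> fmult (mtgt \<psi>) x y) \<cdot>\<^bsub>B\<^esub>
      ((mcomp \<phi> x \<oplus>\<^sub>a\<^bsub>B\<^esub> mcomp \<phi> y) \<oplus>\<^sub>a\<^bsub>B\<^esub> (mcomp \<psi> x \<oplus>\<^sub>a\<^bsub>B\<^esub> mcomp \<psi> y))"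
      using o by (simp add: f.F.B.interchange f.mcomp_plus g.mcomp_plus del: f.F.B.plusA_assoc)
    show "mcomp ?s (x \<oplus>\<^sub>o\<^bsub>A\<^esub> y) \<cdot>\<^bsub>B\<^esub> fmult (msrc ?s) x y = fmult (mtgt ?s) x y \<cdot>\<^bsub>B\<^esub> (mcomp ?s x \<oplus>\<^sub>a\<^bsub>B\<^esub> mcomp
      ?s y)"
      using o f.F.B.midswap_nat[of "mcomp \<phi> x" "mcomp \<psi> x" "mcomp \<phi> y" "mcomp \<psi> y"]
      by (simp add: f.F.B.comp_reassoc[OF 1])
  qed (simp_all add: pw_sum_is_smf f.F.is_smf f.G.is_smf g.F.is_smf g.G.is_smf f.F.B.interchange
      f.mcomp_nat g.mcomp_nat f.mcomp_zero g.mcomp_zero)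
qed

lemma pw_sym_is_mtrans:
  assumes "is_smf A B F" "is_smf A B G"
  shows "is_mtrans A B (pw_sym A B F G)"
proof -
  interpret F: smfunctor A B F by (rule smfunctorI) fact
  interpret G: smfunctor A B G by (rule smfunctorI) fact
  let ?s = "pw_sym A B F G"
  show ?thesis
  proof (rule is_mtransI)
    fix f assume f: "f \<in> Arr A"
    show "mcomp ?s (Cod A f) \<cdot>\<^bsub>B\<^esub> farr (msrc ?s) f = farr (mtgt ?s) f \<cdot>\<^bsub>B\<^esub> mcomp ?s (Dom A f)"
      using f F.B.sym_nat[of "farr F f" "farr G f"] by simp
  next
    fix x y assume o: "x \<in> Obj A" "y \<in> Obj A"
    have 1: "sym B (fobj F (x \<oplus>\<^sub>o\<^bsub>A\<^esub> y)) (fobj G (x \<oplus>\<^sub>o\<^bsub>A\<^esub> y)) \<cdot>\<^bsub>B\<^esub> (fmult F x y \<oplus>\<^sub>a\<^bsub>B\<^esub> fmult G x y) =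
      (fmult G x y \<oplus>\<^sub>a\<^bsub>B\<^esub> fmult F x y) \<cdot>\<^bsub>B\<^esub> sym B (fobj F x \<oplus>\<^sub>o\<^bsub>B\<^esub> fobj F y) (fobj G x \<oplus>\<^sub>o\<^bsub>B\<^esub> fobj G y)"
      using o F.B.sym_nat[of "fmult F x y" "fmult G x y"] by simp
    show "mcomp ?s (x \<oplus>\<^sub>o\<^bsub>A\<^esub> y) \<cdot>\<^bsub>B\<^esub> fmult (msrc ?s) x y = fmult (mtgt ?s) x y \<cdot>\<^bsub>B\<^esub> (mcomp ?s x \<oplus>\<^sub>a\<^bsub>B\<^esub> mcomp
      ?s y)"
      using o by (simp add: F.B.comp_reassoc[OF 1] F.B.midswap_sym')
  next
    show "mcomp ?s (zero A) \<cdot>\<^bsub>B\<^esub> funit (msrc ?s) = funit (mtgt ?s)"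
      using F.B.sym_nat[of "funit F" "funit G"] by simp
  qed (use assms in \<open>simp_all add: pw_sum_is_smf\<close>)
qed

lemma pw_sum_assoc:
  assumes "is_smf A B F" "is_smf A B G" "is_smf A B H"
  shows "pw_sum A B (pw_sum A B F G) H = pw_sum A B F (pw_sum A B G H)"
proof -
  interpret F: smfunctor A B F by (rule smfunctorI) fact
  interpret G: smfunctor A B G by (rule smfunctorI) fact
  interpret H: smfunctor A B H by (rule smfunctorI) fact
  show ?thesis
  proof (rule smf_eqI[where A = A and B = B])
    fix x y assume o: "x \<in> Obj A" "y \<in> Obj A"
    let ?l = "fmult F x y \<oplus>\<^sub>a\<^bsub>B\<^esub> (fmult G x y \<oplus>\<^sub>a\<^bsub>B\<^esub> fmult H x y)"
    let ?m = "midswap B"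
    have "(((fmult F x y \<oplus>\<^sub>a\<^bsub>B\<^esub> fmult G x y) \<cdot>\<^bsub>B\<^esub> ?m (fobj F x) (fobj G x) (fobj F y) (fobj G y)) \<oplus>\<^sub>a\<^bsub>B\<^esub> fmult H x y) =
      ?l \<cdot>\<^bsub>B\<^esub> (?m (fobj F x) (fobj G x) (fobj F y) (fobj G y) \<oplus>\<^sub>a\<^bsub>B\<^esub> Id B (fobj H x \<oplus>\<^sub>o\<^bsub>B\<^esub> fobj H y))"
      using o F.B.interchange[of "?m (fobj F x) (fobj G x) (fobj F y) (fobj G y)" "fmult F x y \<oplus>\<^sub>a\<^bsub>B\<^esub> fmult G x y"
          "Id B (fobj H x \<oplus>\<^sub>o\<^bsub>B\<^esub> fobj H y)" "fmult H x y"] by simp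
    moreover have "fmult F x y \<oplus>\<^sub>a\<^bsub>B\<^esub> ((fmult G x y \<oplus>\<^sub>a\<^bsub>B\<^esub> fmult H x y) \<cdot>\<^bsub>B\<^esub> ?m (fobj G x) (fobj H x) (fobj G y) (fobj H y)) =
      ?l \<cdot>\<^bsub>B\<^esub> (Id B (fobj F x \<oplus>\<^sub>o\<^bsub>B\<^esub> fobj F y) \<oplus>\<^sub>a\<^bsub>B\<^esub> ?m (fobj G x) (fobj H x) (fobj G y) (fobj H y))"
      using o by (simp add: F.B.interchange)
    ultimately show "fmult (pw_sum A B (pw_sum A B F G) H) x y = fmult (pw_sum A B F (pw_sum A B G H)) x y"
      using o F.B.midswap_plus[of "fobj F x" "fobj G x" "fobj H x" "fobj F y" "fobj G y" "fobj H y"] by simp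
  qed (use assms in \<open>simp_all add: pw_sum_is_smf\<close>)
qed

lemma pw_sum_zero:
  assumes "is_smf A B F"
  shows "pw_sum A B (zero_smf A B) F = F" "pw_sum A B F (zero_smf A B) = F"
proof -
  interpret F: smfunctor A B F by (rule smfunctorI) fact
  have z: "is_smf A B (zero_smf A B)"
    by (intro zero_smf_is_smf) unfold_locales
  show "pw_sum A B (zero_smf A B) F = F" "pw_sum A B F (zero_smf A B) = F"
    by - (rule smf_eqI[where A = A and B = B]; use assms z in \<open>simp add: pw_sum_is_smf\<close>)+
qed

text \<open>All operations are pointwise, so every axiom reduces to one of \<open>B\<close> at each
  object of \<open>A\<close>. Associativity and unity on objects are literal equalities of functors
  together with their constraints, which is the content of \<open>pw_sum_assoc\<close> and
  \<open>pw_sum_zero\<close>.\<close>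

theorem PermCat_is_permutative:
  assumes "is_permutative A" "is_permutative B"
  shows "is_permutative (PermCat A B)"
proof -
  interpret A: permcat A by (rule permcatI) fact
  interpret B: permcat B by (rule permcatI) fact
  have sm: "x \<in> Obj A \<Longrightarrow> fobj F x \<in> Obj B" if "is_smf A B F" for F :: "('a, 'b, 'd, 'e) smf" and x
    using smfunctor.fobj_obj[OF smfunctorI[OF that]] .
  have mt: "mcomp \<phi> \<in> extensional (Obj A)"
    "x \<in> Obj A \<Longrightarrow> mcomp \<phi> x \<in> Arr B" "x \<in> Obj A \<Longrightarrow> Dom B (mcomp \<phi> x) = fobj (msrc \<phi>) x"
    "x \<in> Obj A \<Longrightarrow> Cod B (mcomp \<phi> x) = fobj (mtgt \<phi>) x"
    if "is_mtrans A B \<phi>" for \<phi> :: "('a, 'b, 'd, 'e) mtrans" and x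
    using mtransf.mcomp_ext[OF mtransfI[OF that]] mtransf.mcomp_arr[OF mtransfI[OF that]]
      mtransf.dom_mcomp[OF mtransfI[OF that]] mtransf.cod_mcomp[OF mtransfI[OF that]] by simp_all
  have nat: "sym B (fobj (mtgt \<phi>) x) (fobj (mtgt \<psi>) x) \<cdot>\<^bsub>B\<^esub> (mcomp \<phi> x \<oplus>\<^sub>a\<^bsub>B\<^esub> mcomp \<psi> x) =
      (mcomp \<psi> x \<oplus>\<^sub>a\<^bsub>B\<^esub> mcomp \<phi> x) \<cdot>\<^bsub>B\<^esub> sym B (fobj (msrc \<phi>) x) (fobj (msrc \<psi>) x)"
    if "is_mtrans A B \<phi>" "is_mtrans A B \<psi>" "x \<in> Obj A" for \<phi> \<psi> :: "('a, 'b, 'd, 'e) mtrans" and x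
    using that B.sym_nat[of "mcomp \<phi> x" "mcomp \<psi> x"] by (simp add: mt)
  have cat: "is_cat (PermCat A B)"
    unfolding is_cat_def
    by (auto simp: hom_def mtrans_vcomp_is_mtrans is_mtrans_smf sm mt intro!: mtrans_eqI[of _ _ "Obj A"])
  have mon: "is_strict_monoidal (PermCat A B)"
    unfolding is_strict_monoidal_def
    by (auto simp: cat hom_def zero_smf_is_smf A.permcat_axioms B.permcat_axioms pw_sum_is_smf sm mt is_mtrans_smf
        pw_sum_mtrans_is_mtrans B.interchange pw_sum_assoc pw_sum_zero intro!: mtrans_eqI[of _ _ "Obj A"])
  show ?thesis
    unfolding is_permutative_def
    by (auto simp: mon hom_def pw_sym_is_mtrans pw_sum_is_smf pw_sum_assoc sm mt is_mtrans_smf B.sym_plus_right nat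
      intro!: mtrans_eqI[of _ _ "Obj A"])
qed

section \<open>The tensor product is a permutative category\<close>

lemma tobj_simps [simp]:
  "[] \<in> tobj A B" "p # xs \<in> tobj A B \<longleftrightarrow> p \<in> Obj A \<times> Obj B \<and> xs \<in> tobj A B"
  "xs @ ys \<in> tobj A B \<longleftrightarrow> xs \<in> tobj A B \<and> ys \<in> tobj A B"
  by (auto simp: tobj_def)

lemma tobj_mem: "xs \<in> tobj A B \<Longrightarrow> p \<in> set xs \<Longrightarrow> p \<in> Obj A \<times> Obj B"
  by (auto simp: tobj_def)

lemma tensor_sel [simp]:
  "Obj (tensor A B) = tobj A B" "plusO (tensor A B) = (@)" "zero (tensor A B) = []"
  by (simp_all add: tensor_def)

lemma tensor_id_sym:
  "Id (tensor A B) xs = tcls A B (TId xs)" "sym (tensor A B) xs ys = tcls A B (tbeta xs ys)"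
  by (simp_all add: tensor_def)

locale tensor_cat = A: permcat A + B: permcat B
  for A :: "('a, 'f, 'z) pcat_scheme" and B :: "('b, 'g, 'y) pcat_scheme"
begin

lemma beta1_typing [simp]:
  "tdom A B (beta1 p ys) = p # ys" "tcod A B (beta1 p ys) = ys @ [p]"
  "p \<in> Obj A \<times> Obj B \<Longrightarrow> ys \<in> tobj A B \<Longrightarrow> twf A B (beta1 p ys)"
  by (induction ys) auto

lemma tbeta_typing [simp]:
  "tdom A B (tbeta xs ys) = xs @ ys" "tcod A B (tbeta xs ys) = ys @ xs"
  "xs \<in> tobj A B \<Longrightarrow> ys \<in> tobj A B \<Longrightarrow> twf A B (tbeta xs ys)"
  by (induction xs) auto

lemma cell_obj: "cell_wf A B c \<Longrightarrow> cell_dom A B c \<in> tobj A B \<and> cell_cod A B c \<in> tobj A B"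
  by (cases c) auto

lemma twf_obj: "twf A B t \<Longrightarrow> tdom A B t \<in> tobj A B \<and> tcod A B t \<in> tobj A B"
  by (induction t) (use cell_obj in auto)

lemma tdom_obj [simp]: "twf A B t \<Longrightarrow> tdom A B t \<in> tobj A B"
  and tcod_obj [simp]: "twf A B t \<Longrightarrow> tcod A B t \<in> tobj A B"
  using twf_obj by auto

text \<open>Every clause relates well-formed terms with common source and target. Hence
  \<open>Dom\<close> and \<open>Cod\<close> of the tensor product, although computed on a chosen
  representative, are those of any representative.\<close>

lemma teq_typing:
  "teq A B t u \<Longrightarrow> twf A B t \<and> twf A B u \<and> tdom A B t = tdom A B u \<and> tcod A B t = tcod A B u"
  by (induction rule: teq.induct) (simp_all add: cell_obj)

lemma tcls_eq: "teq A B t u \<Longrightarrow> tcls A B t = tcls A B u"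
  unfolding tcls_def by (blast intro: teq.symm teq.trans)

lemma teq_rep: "twf A B t \<Longrightarrow> teq A B t (rep (tcls A B t))"
  unfolding rep_def tcls_def mem_Collect_eq by (rule someI, rule teq.refl)

lemma tcls_arr [simp]: "twf A B t \<Longrightarrow> tcls A B t \<in> Arr (tensor A B)"
  by (auto simp: tensor_def)

lemma tensor_arrE:
  assumes "X \<in> Arr (tensor A B)"
  obtains t where "twf A B t" "X = tcls A B t"
  using assms by (auto simp: tensor_def)

lemma tcls_rep: "X \<in> Arr (tensor A B) \<Longrightarrow> twf A B (rep X) \<and> X = tcls A B (rep X)"
  by (metis tensor_arrE teq_rep teq_typing tcls_eq)

lemma dom_tcls [simp]: "twf A B t \<Longrightarrow> Dom (tensor A B) (tcls A B t) = tdom A B t"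
  and cod_tcls [simp]: "twf A B t \<Longrightarrow> Cod (tensor A B) (tcls A B t) = tcod A B t"
  using teq_typing[OF teq_rep] by (simp_all add: tensor_def)

lemma comp_tcls:
  assumes "twf A B t" "twf A B u" "tcod A B u = tdom A B t"
  shows "tcls A B t \<cdot>\<^bsub>tensor A B\<^esub> tcls A B u = tcls A B (t \<odot> u)"
  using teq.cong_comp[OF teq_rep[OF assms(1)] teq_rep[OF assms(2)] assms(3)]
  by (simp add: tensor_def tcls_eq)

lemma plus_tcls:
  assumes "twf A B t" "twf A B u"
  shows "tcls A B t \<oplus>\<^sub>a\<^bsub>tensor A B\<^esub> tcls A B u = tcls A B (t \<uplus> u)"
  using teq.cong_plus[OF teq_rep[OF assms(1)] teq_rep[OF assms(2)]]
  by (simp add: tensor_def tcls_eq)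

text \<open>Lets the axioms be tested on classes of terms, where each of them is a clause of
  \<open>teq\<close>.\<close>

lemma ball_tensor_arr: "(\<forall>X\<in>Arr (tensor A B). P X) \<longleftrightarrow> (\<forall>t. twf A B t \<longrightarrow> P (tcls A B t))"
  by (auto elim: tensor_arrE)

lemma tensor_is_permutative: "is_permutative (tensor A B)"
proof -
  have cat: "is_cat (tensor A B)"
    unfolding is_cat_def ball_tensor_arr hom_def
    by (auto simp: comp_tcls tensor_id_sym
      intro!: tcls_eq teq.id_left teq.id_right teq.comp_assoc)
  have mon: "is_strict_monoidal (tensor A B)"
    unfolding is_strict_monoidal_def ball_tensor_arr hom_def
    by (auto simp: cat comp_tcls plus_tcls tensor_id_sym
      intro!: tcls_eq teq.plus_id teq.interchange teq.plus_assoc teq.plus_zero_left teq.plus_zero_right)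
  show ?thesis
    unfolding is_permutative_def ball_tensor_arr hom_def
    by (auto simp: mon comp_tcls plus_tcls tensor_id_sym
      intro!: tcls_eq teq.beta_nat teq.beta_inv teq.beta_hex)
qed

text \<open>Folds the classes of \<open>TId\<close> and \<open>tbeta\<close> back into
  \<open>Id\<close> and \<open>sym\<close>, so that the general lemmas on permutative categories
  apply to them.\<close>

lemmas tcls_id_sym [simp] = tensor_id_sym[of A B, symmetric]

sublocale P: permcat "tensor A B"
  by (rule permcatI tensor_is_permutative)+

text \<open>Since \<open>tensor_sel\<close> rewrites the unit to \<open>[]\<close>, the unit laws
  are restated in this form to remain applicable.\<close>

lemmas zero_tensor [simp] = P.zero_plusA[unfolded tensor_sel] P.sym_zero[unfolded tensor_sel]

lemma iso_cell [simp]: "cell_wf A B c \<Longrightarrow> is_iso (tensor A B) (tcls A B (Iso c))"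
  and inv_cell: "cell_wf A B c \<Longrightarrow> inv_arr (tensor A B) (tcls A B (Iso c)) = tcls A B (Inv c)"
proof -
  assume c: "cell_wf A B c"
  have 1: "tcls A B (Inv c) \<cdot>\<^bsub>tensor A B\<^esub> tcls A B (Iso c) = tcls A B (TId (cell_dom A B c))"
    using c tcls_eq[OF teq.inv_left] by (simp add: comp_tcls)
  have 2: "tcls A B (Iso c) \<cdot>\<^bsub>tensor A B\<^esub> tcls A B (Inv c) = tcls A B (TId (cell_cod A B c))"
    using c tcls_eq[OF teq.inv_right] by (simp add: comp_tcls)
  note i = P.is_isoI[of "tcls A B (Iso c)" "tcls A B (Inv c)"]
  show "is_iso (tensor A B) (tcls A B (Iso c))" "inv_arr (tensor A B) (tcls A B (Iso c)) = tcls A B (Inv c)"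
    using i c 1 2 by simp_all
qed

text \<open>\<open>tbeta [p] [q]\<close> is the generator \<open>Beta p q\<close> padded with
  identities on \<open>[]\<close> and composed with identities.\<close>

lemma beta_cell:
  assumes [simp]: "p \<in> Obj A \<times> Obj B" "q \<in> Obj A \<times> Obj B"
  shows "tcls A B (Iso (Beta p q)) = sym (tensor A B) [p] [q]"
proof -
  have "sym (tensor A B) [p] [q] = tcls A B (tbeta [p] [q])"
    by (rule tensor_id_sym)
  also have "\<dots> = tcls A B (Iso (Beta p q))"
    by (simp flip: comp_tcls plus_tcls del: tcls_id_sym(2))
  finally show ?thesis ..
qed

end

lemma tensor_catI: "is_permutative A \<Longrightarrow> is_permutative B \<Longrightarrow> tensor_cat A B"
  by (simp add: tensor_cat_def permcatI)

section \<open>Strict functors and strictification\<close>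

locale strict_smfunctor = smfunctor A B F
  for A :: "('o, 'm, 'z) pcat_scheme" and B :: "('p, 'n, 'y) pcat_scheme" and F +
  assumes is_strict_smf: "is_strict_smf A B F"
begin

text \<open>An identity has equal source and target; applied to \<open>F_2\<close> this yields
  strict preservation of sums of objects.\<close>

lemma fobj_plus [simp]: "x \<in> Obj A \<Longrightarrow> y \<in> Obj A \<Longrightarrow> fobj F (x \<oplus>\<^sub>o\<^bsub>A\<^esub> y) = fobj F x \<oplus>\<^sub>o\<^bsub>B\<^esub> fobj F y"
  and fmult_id [simp]: "x \<in> Obj A \<Longrightarrow> y \<in> Obj A \<Longrightarrow> fmult F x y = Id B (fobj F x \<oplus>\<^sub>o\<^bsub>B\<^esub> fobj F y)"
proof -
  assume o: "x \<in> Obj A" "y \<in> Obj A"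
  then have i: "fmult F x y = Id B (fobj F (x \<oplus>\<^sub>o\<^bsub>A\<^esub> y))"
    using is_strict_smf by (simp add: is_strict_smf_def)
  show "fobj F (x \<oplus>\<^sub>o\<^bsub>A\<^esub> y) = fobj F x \<oplus>\<^sub>o\<^bsub>B\<^esub> fobj F y"
    using o dom_fmult[OF o] by (simp add: i)
  then show "fmult F x y = Id B (fobj F x \<oplus>\<^sub>o\<^bsub>B\<^esub> fobj F y)"
    using i by simp
qed

lemma fobj_zero [simp]: "fobj F (zero A) = zero B"
  and funit_id [simp]: "funit F = Id B (zero B)"
proof -
  have i: "funit F = Id B (fobj F (zero A))"
    using is_strict_smf by (simp add: is_strict_smf_def)
  then have "Dom B (funit F) = fobj F (zero A)"
    by simp
  then show "fobj F (zero A) = zero B" by simp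
  with i show "funit F = Id B (zero B)" by simp
qed

lemma farr_plus: "f \<in> Arr A \<Longrightarrow> g \<in> Arr A \<Longrightarrow> farr F (f \<oplus>\<^sub>a\<^bsub>A\<^esub> g) = farr F f \<oplus>\<^sub>a\<^bsub>B\<^esub> farr F g"
  using fmult_nat[of f g] by simp

lemma farr_sym: "x \<in> Obj A \<Longrightarrow> y \<in> Obj A \<Longrightarrow> farr F (sym A x y) = sym B (fobj F x) (fobj F y)"
  using fmult_sym[of x y] by simp

end

lemma strict_smfunctorI: "is_strict_smf A B F \<Longrightarrow> strict_smfunctor A B F"
  by (simp add: strict_smfunctor_def strict_smfunctor_axioms_def smfunctorI is_strict_smf_def)

lemma strict_smf_smf: "is_strict_smf A B F \<Longrightarrow> is_smf A B F"
  by (simp add: is_strict_smf_def)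

lemma is_strict_smfI:
  assumes "is_smf A B F"
    "\<And>x y. x \<in> Obj A \<Longrightarrow> y \<in> Obj A \<Longrightarrow> fmult F x y = Id B (fobj F (x \<oplus>\<^sub>o\<^bsub>A\<^esub> y))"
    "funit F = Id B (fobj F (zero A))"
  shows "is_strict_smf A B F"
  using assms by (simp add: is_strict_smf_def)

section \<open>Strict functors on the tensor product are determined by the generators\<close>

definition gens ::
  "('a, 'f, 'z) pcat_scheme \<Rightarrow> ('b, 'g, 'y) pcat_scheme \<Rightarrow>
    (('a \<times> 'b) list, ('a, 'f, 'b, 'g) trm set, 'c, 'h) smf \<Rightarrow> ('a, 'f, 'b, 'g, 'c, 'h) images" where
  "gens A B K =
    \<lparr>im_obj = \<lambda>p. fobj K [p], im_gen = \<lambda>f g. farr K (tcls A B (Gen f g)),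
     im_deltaL = \<lambda>a b b'. farr K (tcls A B (Iso (DeltaL a b b'))),
     im_deltaR = \<lambda>b a a'. farr K (tcls A B (Iso (DeltaR b a a'))),
     im_zetaL = \<lambda>a. farr K (tcls A B (Iso (ZetaL a))),
     im_zetaR = \<lambda>b. farr K (tcls A B (Iso (ZetaR b)))\<rparr>"

text \<open>Agreement on the carriers only: unlike functors, these records may take any values
  elsewhere, so equality of records would be too strong.\<close>

definition images_eq ::
  "('a, 'f, 'z) pcat_scheme \<Rightarrow> ('b, 'g, 'y) pcat_scheme \<Rightarrow>
    ('a, 'f, 'b, 'g, 'c, 'h) images \<Rightarrow> ('a, 'f, 'b, 'g, 'c, 'h) images \<Rightarrow> bool" where
  "images_eq A B I I' \<longleftrightarrow>
    (\<forall>a\<in>Obj A. \<forall>b\<in>Obj B. im_obj I (a, b) = im_obj I' (a, b)) \<and>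
    (\<forall>f\<in>Arr A. \<forall>g\<in>Arr B. im_gen I f g = im_gen I' f g) \<and>
    (\<forall>a\<in>Obj A. \<forall>b\<in>Obj B. \<forall>b'\<in>Obj B. im_deltaL I a b b' = im_deltaL I' a b b') \<and>
    (\<forall>b\<in>Obj B. \<forall>a\<in>Obj A. \<forall>a'\<in>Obj A. im_deltaR I b a a' = im_deltaR I' b a a') \<and>
    (\<forall>a\<in>Obj A. im_zetaL I a = im_zetaL I' a) \<and>
    (\<forall>b\<in>Obj B. im_zetaR I b = im_zetaR I' b)"

lemma strict_extension_sel [simp]:
  "fobj (strict_extension A B C I) = (\<lambda>xs\<in>tobj A B. osum C (im_obj I) xs)"
  "fmult (strict_extension A B C I) = (\<lambda>xs\<in>tobj A B. \<lambda>ys\<in>tobj A B. Id C (osum C (im_obj I) (xs @ ys)))"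
  "funit (strict_extension A B C I) = Id C (zero C)"
  by (simp_all add: strict_extension_def)

lemma trans_sel [simp]:
  "msrc (strictify_mtrans A B C \<alpha>) = strictify A B C (msrc \<alpha>)"
  "mtgt (strictify_mtrans A B C \<alpha>) = strictify A B C (mtgt \<alpha>)"
  "mcomp (strictify_mtrans A B C \<alpha>) = (\<lambda>xs\<in>tobj A B. asum C (\<lambda>p. mcomp \<alpha> [p]) xs)"
  "msrc (bil_sum_mtrans A B C \<phi> \<psi>) = bil_sum A B C (msrc \<phi>) (msrc \<psi>)"
  "mtgt (bil_sum_mtrans A B C \<phi> \<psi>) = bil_sum A B C (mtgt \<phi>) (mtgt \<psi>)"
  "mcomp (bil_sum_mtrans A B C \<phi> \<psi>) = (\<lambda>xs\<in>tobj A B. asum C (\<lambda>p. mcomp \<phi> [p] \<oplus>\<^sub>a\<^bsub>C\<^esub> mcomp \<psi> [p]) xs)"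
  "msrc (bil_sym A B C F G) = bil_sum A B C F G" "mtgt (bil_sym A B C F G) = bil_sum A B C G F"
  "mcomp (bil_sym A B C F G) = (\<lambda>xs\<in>tobj A B. asum C (\<lambda>p. sym C (fobj F [p]) (fobj G [p])) xs)"
  by (simp_all add: strictify_mtrans_def bil_sum_mtrans_def bil_sym_def)

context tensor_cat
begin

lemma trm_val_cong:
  assumes "images_eq A B I I'" "twf A B t"
  shows "trm_val C I t = trm_val C I' t"
proof -
  have o: "im_obj I p = im_obj I' p" if "p \<in> Obj A \<times> Obj B" for p
    using assms that by (auto simp: images_eq_def)
  have c: "cell_val C I c = cell_val C I' c" if "cell_wf A B c" for c
    using assms that by (cases c) (auto simp: images_eq_def)
  show ?thesis
    using assms(2)
  proof (induction t)
    case (Gen f g)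
    then show ?case using assms by (simp add: images_eq_def)
  next
    case (TId xs)
    then have "osum C (im_obj I) xs = osum C (im_obj I') xs"
      by (intro osum_cong o) (auto simp: tobj_def)
    then show ?case by simp
  qed (simp_all add: c)
qed

lemma strict_extension_cong:
  assumes "images_eq A B I I'"
  shows "strict_extension A B C I = strict_extension A B C I'"
proof -
  have "osum C (im_obj I) xs = osum C (im_obj I') xs" if "xs \<in> tobj A B" for xs
    using assms that by (intro osum_cong) (auto simp: images_eq_def tobj_def)
  then show ?thesis
    using trm_val_cong[OF assms] tcls_rep
    by (auto simp: strict_extension_def intro!: restrict_ext)
qed

end

locale tensor_strict = tensor_cat A B + K: strict_smfunctor "tensor A B" C K
  for A :: "('a, 'f, 'z) pcat_scheme" and B :: "('b, 'g, 'y) pcat_scheme"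
    and C :: "('c, 'h, 'x) pcat_scheme" and K
begin

lemmas K_append [simp] = K.fobj_plus[unfolded tensor_sel]
lemmas K_Nil [simp] = K.fobj_zero[unfolded tensor_sel]

lemma K_Cons:
  "p \<in> Obj A \<times> Obj B \<Longrightarrow> xs \<in> tobj A B \<Longrightarrow> fobj K (p # xs) = fobj K [p] \<oplus>\<^sub>o\<^bsub>C\<^esub> fobj K xs"
  using K_append[of "[p]" xs] by auto

lemma K_Cons2 [simp]:
  "p \<in> Obj A \<times> Obj B \<Longrightarrow> q # xs \<in> tobj A B \<Longrightarrow>
    fobj K (p # q # xs) = fobj K [p] \<oplus>\<^sub>o\<^bsub>C\<^esub> fobj K (q # xs)"
  by (rule K_Cons)

lemma K_obj: "xs \<in> tobj A B \<Longrightarrow> fobj K xs \<in> Obj C"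
  using K.fobj_obj by simp

lemma K_osum: "xs \<in> tobj A B \<Longrightarrow> fobj K xs = osum C (\<lambda>p. fobj K [p]) xs"
proof (induction xs)
  case (Cons p xs)
  then show ?case using K_append[of "[p]" xs] by auto
qed simp

text \<open>Every term constructor is respected by a strict functor: sums and \<beta> by strictness,
  inverses because functors preserve them. Evaluating a term at the images of the generators
  therefore amounts to applying \<open>K\<close>.\<close>

lemma trm_val_gens: "twf A B t \<Longrightarrow> trm_val C (gens A B K) t = farr K (tcls A B t)"
proof (induction t)
  case (Iso c)
  then show ?case
    using K.farr_sym by (cases c) (auto simp: gens_def beta_cell)
next
  case (Inv c)
  then have "cell_val C (gens A B K) c = farr K (tcls A B (Iso c))"
    using K.farr_sym by (cases c) (auto simp: gens_def beta_cell)
  then show ?case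
    using Inv K.farr_inv[OF iso_cell[of c]] by (simp add: inv_cell)
next
  case (TId xs)
  then show ?case
    using K_osum[of xs] by (simp add: gens_def)
next
  case (TComp t u)
  then show ?case by (simp add: K.farr_comp flip: comp_tcls)
next
  case (TPlus t u)
  then show ?case by (simp add: K.farr_plus flip: plus_tcls)
qed (simp add: gens_def)

text \<open>The uniqueness half of the universal property. No relation has to be checked, because
  \<open>K\<close> is given on classes and evaluation agrees with it on every
  representative.\<close>

lemma strict_extension_gens: "strict_extension A B C (gens A B K) = K"
proof (rule smf.equality)
  have o: "osum C (im_obj (gens A B K)) xs = fobj K xs" if "xs \<in> tobj A B" for xs
    using K_osum[OF that] by (simp add: gens_def)
  show "fobj (strict_extension A B C (gens A B K)) = fobj K"
    using K.fobj_ext o by (auto intro: extensionalityI)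
  show "farr (strict_extension A B C (gens A B K)) = farr K"
    by (rule extensionalityI[where A = "Arr (tensor A B)"])
      (use K.farr_ext trm_val_gens tcls_rep in \<open>auto simp: strict_extension_def\<close>)
  show "fmult (strict_extension A B C (gens A B K)) = fmult K"
    by (rule extensionalityI[where A = "tobj A B"], simp, use K.fmult_ext(1) in simp,
        rule extensionalityI[where A = "tobj A B"]) (use K.fmult_ext(2) o in simp_all)
qed simp_all

lemma strict_extension_eq: "images_eq A B I (gens A B K) \<Longrightarrow> strict_extension A B C I = K"
  using strict_extension_cong[of I "gens A B K" C] strict_extension_gens by simp

end

lemma tensor_strictI:
  assumes "tensor_cat A B" "is_strict_smf (tensor A B) C K"
  shows "tensor_strict A B C K"
  using assms by (simp add: tensor_strict_def strict_smfunctorI)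

lemma strict_smf_eqI:
  assumes "tensor_cat A B" "is_strict_smf (tensor A B) C K" "is_strict_smf (tensor A B) C L"
    "images_eq A B (gens A B K) (gens A B L)"
  shows "K = L"
  using assms tensor_strict.strict_extension_eq[OF tensor_strictI, of A B C L "gens A B K"]
    tensor_strict.strict_extension_gens[OF tensor_strictI, of A B C K] by simp

text \<open>The iterated monoidal constraint \<open>\<Sum> F(a\<^sub>i.b\<^sub>i) \<rightarrow> F(\<Sum> a\<^sub>i.b\<^sub>i)\<close>.\<close>

primrec fmults :: "('c, 'h, 'x) pcat_scheme \<Rightarrow> ('i list, 'n, 'c, 'h) smf \<Rightarrow> 'i list \<Rightarrow> 'h" where
  "fmults C F [] = funit F"
| "fmults C F (p # xs) = fmult F [p] xs \<cdot>\<^bsub>C\<^esub> (Id C (fobj F [p]) \<oplus>\<^sub>a\<^bsub>C\<^esub> fmults C F xs)"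

text \<open>Conjugation by the iterated constraints. As this is a functor on equivalence classes by
  construction, comparing it with \<open>F\<^sup>s\<close> on generators replaces a check of the relations for \<open>F\<^sup>s\<close>.\<close>

definition strict_conj ::
  "('a, 'f, 'z) pcat_scheme \<Rightarrow> ('b, 'g, 'y) pcat_scheme \<Rightarrow> ('c, 'h, 'x) pcat_scheme \<Rightarrow>
    (('a \<times> 'b) list, ('a, 'f, 'b, 'g) trm set, 'c, 'h) smf \<Rightarrow>
    (('a \<times> 'b) list, ('a, 'f, 'b, 'g) trm set, 'c, 'h) smf" where
  "strict_conj A B C F =
    \<lparr>fobj = \<lambda>xs\<in>tobj A B. osum C (\<lambda>p. fobj F [p]) xs,
     farr = \<lambda>X\<in>Arr (tensor A B). inv_arr C (fmults C F (Cod (tensor A B) X)) \<cdot>\<^bsub>C\<^esub>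
       (farr F X \<cdot>\<^bsub>C\<^esub> fmults C F (Dom (tensor A B) X)),
     fmult = \<lambda>xs\<in>tobj A B. \<lambda>ys\<in>tobj A B. Id C (osum C (\<lambda>p. fobj F [p]) (xs @ ys)),
     funit = Id C (zero C)\<rparr>"

definition strictify_counit ::
  "('a, 'f, 'z) pcat_scheme \<Rightarrow> ('b, 'g, 'y) pcat_scheme \<Rightarrow> ('c, 'h, 'x) pcat_scheme \<Rightarrow>
    (('a \<times> 'b) list, ('a, 'f, 'b, 'g) trm set, 'c, 'h) smf \<Rightarrow>
    (('a \<times> 'b) list, ('a, 'f, 'b, 'g) trm set, 'c, 'h) mtrans" where
  "strictify_counit A B C F =
    \<lparr>msrc = strictify A B C F, mtgt = F, mcomp = \<lambda>xs\<in>tobj A B. fmults C F xs\<rparr>"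

lemma strictify_counit_sel [simp]:
  "msrc (strictify_counit A B C F) = strictify A B C F" "mtgt (strictify_counit A B C F) = F"
  "mcomp (strictify_counit A B C F) = (\<lambda>xs\<in>tobj A B. fmults C F xs)"
  by (simp_all add: strictify_counit_def)

section \<open>Strictification as conjugation by iterated constraints\<close>

locale tensor_smfunctor = tensor_cat A B + F: smfunctor "tensor A B" C F
  for A :: "('a, 'f, 'z) pcat_scheme" and B :: "('b, 'g, 'y) pcat_scheme"
    and C :: "('c, 'h, 'x) pcat_scheme" and F
begin

lemmas F_unit = F.fmult_unit[unfolded tensor_sel]
lemmas F_assoc = F.fmult_assoc[unfolded tensor_sel]
lemmas F_nat = F.fmult_nat[unfolded tensor_sel]

lemma F_osum [simp]: "xs \<in> tobj A B \<Longrightarrow> osum C (\<lambda>p. fobj F [p]) xs \<in> Obj C"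
  by (rule F.B.osum_obj) (auto simp: tobj_def)

lemma F_osum_append:
  "xs \<in> tobj A B \<Longrightarrow> ys \<in> tobj A B \<Longrightarrow>
    osum C (\<lambda>p. fobj F [p]) (xs @ ys) = osum C (\<lambda>p. fobj F [p]) xs \<oplus>\<^sub>o\<^bsub>C\<^esub> osum C (\<lambda>p. fobj F [p]) ys"
  by (rule F.B.osum_append) (auto simp: tobj_def)

lemma fmults_typing:
  "xs \<in> tobj A B \<Longrightarrow> is_iso C (fmults C F xs) \<and> fmults C F xs \<in> Arr C \<and>
    Dom C (fmults C F xs) = osum C (\<lambda>p. fobj F [p]) xs \<and> Cod C (fmults C F xs) = fobj F xs"
  by (induction xs) simp_all

lemma fmults_arr [simp]:
  "xs \<in> tobj A B \<Longrightarrow> is_iso C (fmults C F xs)" "xs \<in> tobj A B \<Longrightarrow> fmults C F xs \<in> Arr C"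
  "xs \<in> tobj A B \<Longrightarrow> Dom C (fmults C F xs) = osum C (\<lambda>p. fobj F [p]) xs"
  "xs \<in> tobj A B \<Longrightarrow> Cod C (fmults C F xs) = fobj F xs"
  using fmults_typing by blast+

text \<open>The recursion ends in \<open>F_0\<close>, and the right unit law cancels it. Thus
  conjugation changes nothing on \<open>a.b\<close> and \<open>f.g\<close>, as the definition of
  \<open>F^s\<close> demands.\<close>

lemma fmults_single: "p \<in> Obj A \<times> Obj B \<Longrightarrow> fmults C F [p] = Id C (fobj F [p])"
  using F_unit by simp

text \<open>This is monoidality of the counit, and it makes conjugation by the iterated constraints
  additive. Associativity of \<open>F_2\<close> carries the induction.\<close>

lemma fmults_append:
  "xs \<in> tobj A B \<Longrightarrow> ys \<in> tobj A B \<Longrightarrow>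
    fmults C F (xs @ ys) = fmult F xs ys \<cdot>\<^bsub>C\<^esub> (fmults C F xs \<oplus>\<^sub>a\<^bsub>C\<^esub> fmults C F ys)"
proof (induction xs)
  case Nil
  have "fmult F [] ys \<cdot>\<^bsub>C\<^esub> ((funit F \<oplus>\<^sub>a\<^bsub>C\<^esub> Id C (fobj F ys)) \<cdot>\<^bsub>C\<^esub> (Id C (zero C) \<oplus>\<^sub>a\<^bsub>C\<^esub> fmults C F ys)) = fmults C F ys"
    using Nil F_unit(2)[of ys] F.B.comp_reassoc[OF F_unit(2)[of ys], of "fmults C F ys"] by simp
  \<comment> \<open>The rule for zero summands is withheld: it would erase the identity on
    \<open>0\<close> that lets interchange recombine the two factors.\<close>
  then show ?case
    using Nil by (simp add: F.B.interchange del: F.B.zero_plusA)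
next
  case (Cons p xs)
  let ?i = "Id C (fobj F [p])"
  have p: "p \<in> Obj A \<times> Obj B" and x: "xs \<in> tobj A B" "ys \<in> tobj A B" "[p] \<in> tobj A B"
    using Cons.prems by auto
  have "fmults C F ((p # xs) @ ys) =
    fmult F [p] (xs @ ys) \<cdot>\<^bsub>C\<^esub> (?i \<oplus>\<^sub>a\<^bsub>C\<^esub> (fmult F xs ys \<cdot>\<^bsub>C\<^esub> (fmults C F xs \<oplus>\<^sub>a\<^bsub>C\<^esub> fmults C F ys)))"
    using Cons by simp
  also have "\<dots> = (fmult F [p] (xs @ ys) \<cdot>\<^bsub>C\<^esub> (?i \<oplus>\<^sub>a\<^bsub>C\<^esub> fmult F xs ys)) \<cdot>\<^bsub>C\<^esub>
      (?i \<oplus>\<^sub>a\<^bsub>C\<^esub> (fmults C F xs \<oplus>\<^sub>a\<^bsub>C\<^esub> fmults C F ys))"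
    using p x by (simp add: F.B.interchange)
  also have "\<dots> = (fmult F ([p] @ xs) ys \<cdot>\<^bsub>C\<^esub> (fmult F [p] xs \<oplus>\<^sub>a\<^bsub>C\<^esub> Id C (fobj F ys))) \<cdot>\<^bsub>C\<^esub>
      (?i \<oplus>\<^sub>a\<^bsub>C\<^esub> (fmults C F xs \<oplus>\<^sub>a\<^bsub>C\<^esub> fmults C F ys))"
    using p x by (subst F_assoc) simp_all
  also have "\<dots> = fmult F (p # xs) ys \<cdot>\<^bsub>C\<^esub> ((fmult F [p] xs \<oplus>\<^sub>a\<^bsub>C\<^esub> Id C (fobj F ys)) \<cdot>\<^bsub>C\<^esub>
      ((?i \<oplus>\<^sub>a\<^bsub>C\<^esub> fmults C F xs) \<oplus>\<^sub>a\<^bsub>C\<^esub> fmults C F ys))"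
    using p x by simp
  also have "\<dots> = fmult F (p # xs) ys \<cdot>\<^bsub>C\<^esub> (fmults C F (p # xs) \<oplus>\<^sub>a\<^bsub>C\<^esub> fmults C F ys)"
    using p x by (subst F.B.interchange) simp_all
  finally show ?case .
qed

lemma strict_conj_sel [simp]:
  "fobj (strict_conj A B C F) = (\<lambda>xs\<in>tobj A B. osum C (\<lambda>p. fobj F [p]) xs)"
  "X \<in> Arr (tensor A B) \<Longrightarrow> farr (strict_conj A B C F) X =
    inv_arr C (fmults C F (Cod (tensor A B) X)) \<cdot>\<^bsub>C\<^esub> (farr F X \<cdot>\<^bsub>C\<^esub> fmults C F (Dom (tensor A B) X))"
  "fmult (strict_conj A B C F) = (\<lambda>xs\<in>tobj A B. \<lambda>ys\<in>tobj A B. Id C (osum C (\<lambda>p. fobj F [p]) (xs @ ys)))"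
  "funit (strict_conj A B C F) = Id C (zero C)"
  by (simp_all add: strict_conj_def)

lemmas obj_tensor [simp] = P.dom_obj[unfolded tensor_sel] P.cod_obj[unfolded tensor_sel]
  P.dom_plus[unfolded tensor_sel] P.cod_plus[unfolded tensor_sel]

lemma strict_conj_is_smf: "is_smf (tensor A B) C (strict_conj A B C F)"
proof -
  let ?S = "strict_conj A B C F"
  show ?thesis
  proof (rule is_smfI)
    fix X Y assume a: "X \<in> Arr (tensor A B)" "Y \<in> Arr (tensor A B)"
    let ?m = "fmults C F" and ?d = "Dom (tensor A B)" and ?c = "Cod (tensor A B)"
    \<comment> \<open>Naturality slides \<open>F_2\<close> past the sum of the two arrows, so that
      after \<open>fmults_append\<close> it cancels against its inverse in the conjugate.\<close>
    have "farr F (X \<oplus>\<^sub>a\<^bsub>tensor A B\<^esub> Y) \<cdot>\<^bsub>C\<^esub> (fmult F (?d X) (?d Y) \<cdot>\<^bsub>C\<^esub> (?m (?d X) \<oplus>\<^sub>a\<^bsub>C\<^esub> ?m (?d Y))) =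
      fmult F (?c X) (?c Y) \<cdot>\<^bsub>C\<^esub> ((farr F X \<oplus>\<^sub>a\<^bsub>C\<^esub> farr F Y) \<cdot>\<^bsub>C\<^esub> (?m (?d X) \<oplus>\<^sub>a\<^bsub>C\<^esub> ?m (?d Y)))"
      using a F.B.comp_reassoc[OF F_nat[OF a, symmetric]] by simp
    then have "farr ?S (X \<oplus>\<^sub>a\<^bsub>tensor A B\<^esub> Y) = farr ?S X \<oplus>\<^sub>a\<^bsub>C\<^esub> farr ?S Y"
      using a by (simp add: fmults_append F.B.inv_of_comp F.B.inv_plus F.B.interchange F.B.iso_arr)
    then show "fmult ?S (?c X) (?c Y) \<cdot>\<^bsub>C\<^esub> (farr ?S X \<oplus>\<^sub>a\<^bsub>C\<^esub> farr ?S Y) = farr ?S (X \<oplus>\<^sub>a\<^bsub>tensor A B\<^esub> Y) \<cdot>\<^bsub>C\<^esub>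
      fmult ?S (?d X) (?d Y)"
      using a by (simp add: F_osum_append)
  next
    fix xs ys assume "xs \<in> Obj (tensor A B)" "ys \<in> Obj (tensor A B)"
    then have o: "xs \<in> tobj A B" "ys \<in> tobj A B" by simp_all
    let ?m = "fmults C F"
    have "farr F (sym (tensor A B) xs ys) \<cdot>\<^bsub>C\<^esub> (fmult F xs ys \<cdot>\<^bsub>C\<^esub> (?m xs \<oplus>\<^sub>a\<^bsub>C\<^esub> ?m ys)) =
      fmult F ys xs \<cdot>\<^bsub>C\<^esub> (sym C (fobj F xs) (fobj F ys) \<cdot>\<^bsub>C\<^esub> (?m xs \<oplus>\<^sub>a\<^bsub>C\<^esub> ?m ys))"
      using o F.B.comp_reassoc[OF F.fmult_sym[of xs ys]] by simp
    also have "sym C (fobj F xs) (fobj F ys) \<cdot>\<^bsub>C\<^esub> (?m xs \<oplus>\<^sub>a\<^bsub>C\<^esub> ?m ys) =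
      (?m ys \<oplus>\<^sub>a\<^bsub>C\<^esub> ?m xs) \<cdot>\<^bsub>C\<^esub> sym C (osum C (\<lambda>p. fobj F [p]) xs) (osum C (\<lambda>p. fobj F [p]) ys)"
      using o F.B.sym_nat[of "?m xs" "?m ys"] by simp
    finally have "farr ?S (sym (tensor A B) xs ys) = sym C (osum C (\<lambda>p. fobj F [p]) xs) (osum C (\<lambda>p. fobj F
      [p]) ys)"
      using o by (simp add: fmults_append F.B.inv_of_comp F.B.inv_plus F.B.interchange F.B.iso_arr
          F.B.interchange2)
    then show "farr ?S (sym (tensor A B) xs ys) \<cdot>\<^bsub>C\<^esub> fmult ?S xs ys = fmult ?S ys xs \<cdot>\<^bsub>C\<^esub> sym C (fobj ?S xs)
      (fobj ?S ys)"
      using o by (simp add: F_osum_append)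
  qed (simp_all add: P.permcat_axioms F.B.permcat_axioms F_osum_append F.farr_comp F.B.iso_arr,
      simp_all add: strict_conj_def)
qed

lemma strict_conj_strict: "is_strict_smf (tensor A B) C (strict_conj A B C F)"
  by (rule is_strict_smfI[OF strict_conj_is_smf]) simp_all

text \<open>The conjugate is strict, hence the extension of its own values on generators. The
  iterated constraint is \<open>F_0\<close> on no summand, an identity on one and \<open>F_2\<close>
  on two, so these values are the ones prescribed for \<open>F^s\<close>, which thereby inherits
  well-definedness on classes.\<close>

lemma strictify_eq: "strictify A B C F = strict_conj A B C F"
proof -
  interpret K: tensor_strict A B C "strict_conj A B C F"
    by (rule tensor_strictI) (simp_all add: tensor_cat_axioms strict_conj_strict)
  show ?thesis
    unfolding strictify_def
    \<comment> \<open>Two passes: one-term constraints must collapse by \<open>fmults_single\<close>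
      before the recursion may unfold the two-term ones, which the unit law then reduces to
      \<open>F_2\<close>.\<close>
    by (rule K.strict_extension_eq) (simp add: images_eq_def gens_def fmults_single del: fmults.simps(2),
      simp add: F_unit)
qed

lemma strictify_strict: "is_strict_smf (tensor A B) C (strictify A B C F)"
  by (simp add: strictify_eq strict_conj_strict)

lemma strictify_is_smf: "is_smf (tensor A B) C (strictify A B C F)"
  by (simp add: strictify_eq strict_conj_is_smf)

lemma fobj_strictify [simp]: "fobj (strictify A B C F) = (\<lambda>xs\<in>tobj A B. osum C (\<lambda>p. fobj F [p]) xs)"
  by (simp add: strictify_eq)

text \<open>Naturality holds by the very form of a conjugate, and compatibility with sums is
  \<open>fmults_append\<close>.\<close>

lemma strictify_counit_is_mtrans: "is_mtrans (tensor A B) C (strictify_counit A B C F)"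
proof -
  let ?e = "strictify_counit A B C F"
  show ?thesis
  proof (rule is_mtransI)
    fix X assume "X \<in> Arr (tensor A B)"
    then show "mcomp ?e (Cod (tensor A B) X) \<cdot>\<^bsub>C\<^esub> farr (msrc ?e) X = farr (mtgt ?e) X \<cdot>\<^bsub>C\<^esub> mcomp ?e (Dom
      (tensor A B) X)"
      by (simp add: strictify_eq)
  qed (simp_all add: strict_conj_is_smf F.is_smf strictify_eq fmults_append F_osum_append)
qed

end

lemma tensor_smfunctorI: "tensor_cat A B \<Longrightarrow> is_smf (tensor A B) C F \<Longrightarrow> tensor_smfunctor A B C F"
  by (simp add: tensor_smfunctor_def smfunctorI)

section \<open>Transport of permutative structure along a strictification\<close>

text \<open>\<open>X\<close> is a full subcategory of \<open>Y\<close> and \<open>(so, sa)\<close> is an idempotent functor onto it, isomorphic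
  to the identity through \<open>\<epsilon>\<close>. Every element of \<open>X\<close> is its own strictification, so each identity
  in \<open>X\<close> is the image under \<open>(so, sa)\<close> of the corresponding identity in \<open>Y\<close>.\<close>

locale strictifier = Y: permcat Y
  for Y :: "('o, 'm, 'z) pcat_scheme" +
  fixes X :: "('o, 'm, 'y) pcat_scheme" and so :: "'o \<Rightarrow> 'o" and sa :: "'m \<Rightarrow> 'm" and \<epsilon> :: "'o \<Rightarrow> 'm"
  assumes ObjX: "x \<in> Obj X \<Longrightarrow> x \<in> Obj Y"
    and ArrX: "Arr X = {f \<in> Arr Y. Dom Y f \<in> Obj X \<and> Cod Y f \<in> Obj X}"
    and catX [simp]: "Dom X = Dom Y" "Cod X = Cod Y" "Id X = Id Y" "Comp X = Comp Y"
    and so_obj [simp]: "x \<in> Obj Y \<Longrightarrow> so x \<in> Obj X"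
    and sa_arr [simp]: "f \<in> Arr Y \<Longrightarrow> sa f \<in> Arr Y"
      "f \<in> Arr Y \<Longrightarrow> Dom Y (sa f) = so (Dom Y f)" "f \<in> Arr Y \<Longrightarrow> Cod Y (sa f) = so (Cod Y f)"
    and sa_id [simp]: "x \<in> Obj Y \<Longrightarrow> sa (Id Y x) = Id Y (so x)"
    and sa_comp: "f \<in> Arr Y \<Longrightarrow> g \<in> Arr Y \<Longrightarrow> Cod Y f = Dom Y g \<Longrightarrow> sa (g \<cdot>\<^bsub>Y\<^esub> f) = sa g \<cdot>\<^bsub>Y\<^esub> sa f"
    and so_strict [simp]: "x \<in> Obj X \<Longrightarrow> so x = x"
    and sa_strict [simp]: "f \<in> Arr X \<Longrightarrow> sa f = f"
    and so_plus: "x \<in> Obj Y \<Longrightarrow> y \<in> Obj Y \<Longrightarrow> so (x \<oplus>\<^sub>o\<^bsub>Y\<^esub> y) = so x \<oplus>\<^sub>o\<^bsub>X\<^esub> so y"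
    and sa_plus: "f \<in> Arr Y \<Longrightarrow> g \<in> Arr Y \<Longrightarrow> sa (f \<oplus>\<^sub>a\<^bsub>Y\<^esub> g) = sa f \<oplus>\<^sub>a\<^bsub>X\<^esub> sa g"
    and sa_sym: "x \<in> Obj Y \<Longrightarrow> y \<in> Obj Y \<Longrightarrow> sa (sym Y x y) = sym X (so x) (so y)"
    and zeroX [simp]: "zero X = zero Y" "zero Y \<in> Obj X"
    and eps_iso [simp]: "x \<in> Obj Y \<Longrightarrow> is_iso Y (\<epsilon> x)"
    and eps_typing [simp]: "x \<in> Obj Y \<Longrightarrow> Dom Y (\<epsilon> x) = so x" "x \<in> Obj Y \<Longrightarrow> Cod Y (\<epsilon> x) = x"
    and eps_nat: "f \<in> Arr Y \<Longrightarrow> \<epsilon> (Cod Y f) \<cdot>\<^bsub>Y\<^esub> sa f = f \<cdot>\<^bsub>Y\<^esub> \<epsilon> (Dom Y f)"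
    and eps_strict [simp]: "x \<in> Obj X \<Longrightarrow> \<epsilon> x = Id Y x"
    and sa_eps: "x \<in> Obj Y \<Longrightarrow> sa (\<epsilon> x) = Id Y (so x)"
begin

lemma objX [simp]: "x \<in> Obj X \<Longrightarrow> x \<in> Obj Y"
  by (rule ObjX)

lemma arrX: "f \<in> Arr X \<longleftrightarrow> f \<in> Arr Y \<and> Dom Y f \<in> Obj X \<and> Cod Y f \<in> Obj X"
  by (auto simp: ArrX)

lemma sa_strict' [simp]: "f \<in> Arr Y \<Longrightarrow> Dom Y f \<in> Obj X \<Longrightarrow> Cod Y f \<in> Obj X \<Longrightarrow> sa f = f"
  by (simp add: arrX)

text \<open>Sums in \<open>X\<close> are always rewritten to strictified sums in \<open>Y\<close>,
  and the rules below absorb nested strictifications. An axiom for \<open>X\<close> thereby turns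
  into the strictification of the same axiom for \<open>Y\<close>.\<close>

lemma plusOX [simp]: "x \<in> Obj X \<Longrightarrow> y \<in> Obj X \<Longrightarrow> x \<oplus>\<^sub>o\<^bsub>X\<^esub> y = so (x \<oplus>\<^sub>o\<^bsub>Y\<^esub> y)"
  by (simp add: so_plus)

lemma plusAX [simp]:
  "f \<in> Arr Y \<Longrightarrow> Dom Y f \<in> Obj X \<Longrightarrow> Cod Y f \<in> Obj X \<Longrightarrow>
   g \<in> Arr Y \<Longrightarrow> Dom Y g \<in> Obj X \<Longrightarrow> Cod Y g \<in> Obj X \<Longrightarrow> f \<oplus>\<^sub>a\<^bsub>X\<^esub> g = sa (f \<oplus>\<^sub>a\<^bsub>Y\<^esub> g)"
  by (simp add: sa_plus)

lemma symX [simp]: "x \<in> Obj X \<Longrightarrow> y \<in> Obj X \<Longrightarrow> sym X x y = sa (sym Y x y)"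
  by (simp add: sa_sym)

lemma so_so_plus [simp]:
  "x \<in> Obj Y \<Longrightarrow> y \<in> Obj Y \<Longrightarrow> so (so x \<oplus>\<^sub>o\<^bsub>Y\<^esub> y) = so (x \<oplus>\<^sub>o\<^bsub>Y\<^esub> y)"
  "x \<in> Obj Y \<Longrightarrow> y \<in> Obj Y \<Longrightarrow> so (x \<oplus>\<^sub>o\<^bsub>Y\<^esub> so y) = so (x \<oplus>\<^sub>o\<^bsub>Y\<^esub> y)"
  by (simp_all add: so_plus del: plusOX)

lemma sa_sa_plus [simp]:
  "f \<in> Arr Y \<Longrightarrow> g \<in> Arr Y \<Longrightarrow> sa (sa f \<oplus>\<^sub>a\<^bsub>Y\<^esub> g) = sa (f \<oplus>\<^sub>a\<^bsub>Y\<^esub> g)"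
  "f \<in> Arr Y \<Longrightarrow> g \<in> Arr Y \<Longrightarrow> sa (f \<oplus>\<^sub>a\<^bsub>Y\<^esub> sa g) = sa (f \<oplus>\<^sub>a\<^bsub>Y\<^esub> g)"
  by (simp_all add: sa_plus del: plusAX)

lemma sa_sym_so [simp]:
  "x \<in> Obj Y \<Longrightarrow> y \<in> Obj Y \<Longrightarrow> sa (sym Y (so x) y) = sa (sym Y x y)"
  "x \<in> Obj Y \<Longrightarrow> y \<in> Obj Y \<Longrightarrow> sa (sym Y x (so y)) = sa (sym Y x y)"
  by (simp_all add: sa_sym del: symX)

lemma sa_comp_sa:
  "f \<in> Arr Y \<Longrightarrow> g \<in> Arr Y \<Longrightarrow> Cod Y f = Dom Y g \<Longrightarrow> sa g \<cdot>\<^bsub>Y\<^esub> sa f = sa (g \<cdot>\<^bsub>Y\<^esub> f)"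
  by (simp add: sa_comp)

lemma X_permutative: "is_permutative X"
proof -
  have cat: "is_cat X"
    by (auto simp: is_cat_def arrX hom_def)
  have mon: "is_strict_monoidal X"
    unfolding is_strict_monoidal_def
    by (auto simp: cat arrX hom_def sa_comp_sa Y.interchange)
  show ?thesis
    unfolding is_permutative_def
    by (auto simp: mon arrX hom_def sa_comp_sa Y.sym_nat simp flip: Y.sym_plus_right)
qed

sublocale X: permcat X
  by (rule permcatI X_permutative)+

section \<open>Inclusion and strictification as monoidal functors\<close>

definition J :: "('o, 'm, 'o, 'm) func" where
  "J = \<lparr>fobj = \<lambda>x\<in>Obj X. x, farr = \<lambda>f\<in>Arr X. f\<rparr>"

definition S :: "('o, 'm, 'o, 'm) func" where
  "S = \<lparr>fobj = \<lambda>x\<in>Obj Y. so x, farr = \<lambda>f\<in>Arr Y. sa f\<rparr>"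

lemma J_functor: "is_functor X Y J"
  by (auto simp: J_def is_functor_def X.is_cat Y.is_cat hom_def arrX)

lemma S_functor: "is_functor Y X S"
  by (auto simp: S_def is_functor_def X.is_cat Y.is_cat hom_def arrX sa_comp)

lemma J_fully_faithful: "fully_faithful X Y J"
proof -
  have "bij_betw (farr J) (hom X x y) (hom Y (fobj J x) (fobj J y))" if "x \<in> Obj X" "y \<in> Obj X" for x y
    using that by (auto simp: J_def bij_betw_def inj_on_def hom_def arrX image_def)
  then show ?thesis
    by (simp add: fully_faithful_def J_functor)
qed

text \<open>The unit is an identity because strictification fixes \<open>X\<close>. One triangle
  identity then says that the counit is trivial on \<open>X\<close>, the other that strictification
  sends the counit to identities.\<close>

lemma J_S_adjoint_equivalence: "adjoint_equivalence X Y J S (Id Y) \<epsilon>"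
proof -
  have i: "is_iso X (Id Y x)" if "x \<in> Obj X" for x
    using that X.iso_id[of x] by simp
  show ?thesis
    using J_functor S_functor
    by (auto simp: adjoint_equivalence_def nat_iso_def nat_trans_def is_functor_def func_id_def func_comp_def
        J_def S_def hom_def arrX i eps_nat Y.iso_arr sa_eps sa_comp)
qed

text \<open>Strictification turns the sum of \<open>Y\<close> into that of \<open>X\<close> on the
  nose, so identities serve as constraints.\<close>

lemma S_strict_smf:
  "\<exists>S'. is_strict_smf Y X S' \<and> func.truncate S' = S"
proof -
  let ?S = "\<lparr>fobj = \<lambda>x\<in>Obj Y. so x, farr = \<lambda>f\<in>Arr Y. sa f,
    fmult = \<lambda>x\<in>Obj Y. \<lambda>y\<in>Obj Y. Id Y (so (x \<oplus>\<^sub>o\<^bsub>Y\<^esub> y)), funit = Id Y (zero Y)\<rparr>"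
  have i: "is_iso X (Id Y x)" if "x \<in> Obj X" for x
    using that X.iso_id[of x] by simp
  have "is_smf Y X ?S"
    by (rule is_smfI) (simp_all add: Y.permcat_axioms X.permcat_axioms i arrX sa_comp)
  then have "is_strict_smf Y X ?S"
    by (rule is_strict_smfI) simp_all
  then show ?thesis
    by (intro exI[of _ ?S]) (simp add: S_def func.defs)
qed

abbreviation e where "e x \<equiv> inv_arr Y (\<epsilon> x)"

lemma e_nat:
  assumes f: "f \<in> Arr Y"
  shows "e (Cod Y f) \<cdot>\<^bsub>Y\<^esub> f = sa f \<cdot>\<^bsub>Y\<^esub> e (Dom Y f)"
proof (rule Y.iso_cancel_right[of "\<epsilon> (Dom Y f)"])
  show "(e (Cod Y f) \<cdot>\<^bsub>Y\<^esub> f) \<cdot>\<^bsub>Y\<^esub> \<epsilon> (Dom Y f) = (sa f \<cdot>\<^bsub>Y\<^esub> e (Dom Y f)) \<cdot>\<^bsub>Y\<^esub> \<epsilon> (Dom Y f)"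
    using f by (simp add: Y.iso_arr flip: eps_nat)
qed (use f in simp_all)

lemma sa_e:
  assumes x: "x \<in> Obj Y"
  shows "sa (e x) = Id Y (so x)"
proof -
  have "sa (e x) = sa (e x) \<cdot>\<^bsub>Y\<^esub> sa (\<epsilon> x)"
    using x by (simp add: sa_eps)
  also have "\<dots> = Id Y (so x)"
    using x by (simp add: sa_comp_sa Y.iso_arr)
  finally show ?thesis .
qed

text \<open>A summand may be strictified before the sum is, and the inverse counit strictifies to an
  identity. This disposes of the whiskered constraints in the associativity of the
  inclusion.\<close>

lemma sa_e_plus:
  assumes "x \<in> Obj Y" "y \<in> Obj Y"
  shows "sa (e x \<oplus>\<^sub>a\<^bsub>Y\<^esub> Id Y y) = Id Y (so (x \<oplus>\<^sub>o\<^bsub>Y\<^esub> y))"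
    and "sa (Id Y y \<oplus>\<^sub>a\<^bsub>Y\<^esub> e x) = Id Y (so (y \<oplus>\<^sub>o\<^bsub>Y\<^esub> x))"
  using sa_sa_plus(1)[of "e x" "Id Y y"] sa_sa_plus(2)[of "Id Y y" "e x"] assms
  by (simp_all add: sa_e del: sa_sa_plus)

lemma J_smf: "\<exists>J'. is_smf X Y J' \<and> func.truncate J' = J"
proof -
  \<comment> \<open>The constraint leads from the sum in \<open>Y\<close> to the sum in
    \<open>X\<close>, which is the strictification of the former; this is opposite to the
    counit.\<close>
  let ?J = "\<lparr>fobj = \<lambda>x\<in>Obj X. x, farr = \<lambda>f\<in>Arr X. f,
    fmult = \<lambda>x\<in>Obj X. \<lambda>y\<in>Obj X. e (x \<oplus>\<^sub>o\<^bsub>Y\<^esub> y), funit = Id Y (zero Y)\<rparr>"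
  have "is_smf X Y ?J"
  proof (rule is_smfI)
    fix f g assume "f \<in> Arr X" "g \<in> Arr X"
    then show "fmult ?J (Cod X f) (Cod X g) \<cdot>\<^bsub>Y\<^esub> (farr ?J f \<oplus>\<^sub>a\<^bsub>Y\<^esub> farr ?J g) =
       farr ?J (f \<oplus>\<^sub>a\<^bsub>X\<^esub> g) \<cdot>\<^bsub>Y\<^esub> fmult ?J (Dom X f) (Dom X g)"
      using e_nat[of "f \<oplus>\<^sub>a\<^bsub>Y\<^esub> g"] by (simp add: arrX)
  next
    \<comment> \<open>Both composites equal the inverse counit at \<open>x + y + z\<close>: this is
      its naturality at an arrow that \<open>sa_e_plus\<close> strictifies to an identity.\<close>
    fix x y z assume "x \<in> Obj X" "y \<in> Obj X" "z \<in> Obj X"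
    then show "fmult ?J (x \<oplus>\<^sub>o\<^bsub>X\<^esub> y) z \<cdot>\<^bsub>Y\<^esub> (fmult ?J x y \<oplus>\<^sub>a\<^bsub>Y\<^esub> Id Y (fobj ?J z)) =
       fmult ?J x (y \<oplus>\<^sub>o\<^bsub>X\<^esub> z) \<cdot>\<^bsub>Y\<^esub> (Id Y (fobj ?J x) \<oplus>\<^sub>a\<^bsub>Y\<^esub> fmult ?J y z)"
      using e_nat[of "e (x \<oplus>\<^sub>o\<^bsub>Y\<^esub> y) \<oplus>\<^sub>a\<^bsub>Y\<^esub> Id Y z"] e_nat[of "Id Y x \<oplus>\<^sub>a\<^bsub>Y\<^esub> e (y \<oplus>\<^sub>o\<^bsub>Y\<^esub> z)"]
      by (simp add: sa_e_plus)
  next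
    fix x y assume "x \<in> Obj X" "y \<in> Obj X"
    then show "farr ?J (sym X x y) \<cdot>\<^bsub>Y\<^esub> fmult ?J x y = fmult ?J y x \<cdot>\<^bsub>Y\<^esub> sym Y (fobj ?J x) (fobj ?J y)"
      using e_nat[of "sym Y x y"] by (simp add: arrX)
  qed (simp_all add: Y.permcat_axioms X.permcat_axioms arrX)
  then show ?thesis
    by (intro exI[of _ ?J]) (simp add: J_def func.defs)
qed

end

section \<open>The permutative category of strict functors\<close>

lemma PermCat_s_sel [simp]:
  "Obj (PermCat_s A B C) = {F. is_strict_smf (tensor A B) C F}"
  "Arr (PermCat_s A B C) = {\<phi>. is_mtrans (tensor A B) C \<phi> \<and>
    is_strict_smf (tensor A B) C (msrc \<phi>) \<and> is_strict_smf (tensor A B) C (mtgt \<phi>)}"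
  "Dom (PermCat_s A B C) = msrc" "Cod (PermCat_s A B C) = mtgt"
  "Id (PermCat_s A B C) = mtrans_id (tensor A B) C" "Comp (PermCat_s A B C) = mtrans_vcomp (tensor A B) C"
  "plusO (PermCat_s A B C) = bil_sum A B C" "plusA (PermCat_s A B C) = bil_sum_mtrans A B C"
  "zero (PermCat_s A B C) = zero_smf (tensor A B) C" "sym (PermCat_s A B C) = bil_sym A B C"
  by (simp_all add: PermCat_s_def)

context tensor_smfunctor
begin

text \<open>With \<open>F^s\<close> known to be well defined, its prescribed values can be read on
  classes rather than on representing terms.\<close>

lemma farr_strictify:
  "f \<in> Arr A \<Longrightarrow> g \<in> Arr B \<Longrightarrow> farr (strictify A B C F) (tcls A B (Gen f g)) = farr F (tcls A B (Gen f g))"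
  "a \<in> Obj A \<Longrightarrow> b \<in> Obj B \<Longrightarrow> b' \<in> Obj B \<Longrightarrow> farr (strictify A B C F) (tcls A B (Iso (DeltaL a b b'))) =
    farr F (tcls A B (Iso (DeltaL a b b'))) \<cdot>\<^bsub>C\<^esub> fmult F [(a, b)] [(a, b')]"
  "b \<in> Obj B \<Longrightarrow> a \<in> Obj A \<Longrightarrow> a' \<in> Obj A \<Longrightarrow> farr (strictify A B C F) (tcls A B (Iso (DeltaR b a a'))) =
    farr F (tcls A B (Iso (DeltaR b a a'))) \<cdot>\<^bsub>C\<^esub> fmult F [(a, b)] [(a', b)]"
  "a \<in> Obj A \<Longrightarrow> farr (strictify A B C F) (tcls A B (Iso (ZetaL a))) =
    farr F (tcls A B (Iso (ZetaL a))) \<cdot>\<^bsub>C\<^esub> funit F"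
  "b \<in> Obj B \<Longrightarrow> farr (strictify A B C F) (tcls A B (Iso (ZetaR b))) =
    farr F (tcls A B (Iso (ZetaR b))) \<cdot>\<^bsub>C\<^esub> funit F"
  unfolding strictify_eq
  by (simp_all add: fmults_single del: fmults.simps(2)) (simp_all add: F_unit)

lemma strictify_of_strict:
  assumes "is_strict_smf (tensor A B) C F"
  shows "strictify A B C F = F"
proof -
  interpret K: tensor_strict A B C F
    by (rule tensor_strictI) (simp_all add: tensor_cat_axioms assms)
  show ?thesis
    unfolding strictify_def
    by (rule K.strict_extension_eq) (simp add: images_eq_def gens_def)
qed

end

text \<open>Both sides extend images of generators, and these agree: the middle swap in
  \<open>(F + G)_2\<close> is the one written into the definition of \<open>\<boxplus>\<close>. In
  particular \<open>F \<boxplus> G\<close> for strict \<open>F\<close> and \<open>G\<close> is a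
  strictification and so respects the relations.\<close>

lemma (in tensor_cat) strictify_pw_sum:
  assumes "is_smf (tensor A B) C F" "is_smf (tensor A B) C G"
  shows "strictify A B C (pw_sum (tensor A B) C F G) = bil_sum A B C (strictify A B C F) (strictify A B C G)"
proof -
  interpret F: tensor_smfunctor A B C F
    by (rule tensor_smfunctorI) (simp_all add: tensor_cat_axioms assms)
  interpret G: tensor_smfunctor A B C G
    by (rule tensor_smfunctorI) (simp_all add: tensor_cat_axioms assms)
  show ?thesis
    unfolding bil_sum_def
    by (subst strictify_def, rule strict_extension_cong)
      (simp add: images_eq_def F.farr_strictify G.farr_strictify F.F.B.interchange F.F.B.interchange2)
qed

section \<open>Strictification of monoidal transformations\<close>

locale tensor_mtransf = tensor_cat A B + f: mtransf "tensor A B" C \<alpha>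
  for A :: "('a, 'f, 'z) pcat_scheme" and B :: "('b, 'g, 'y) pcat_scheme"
    and C :: "('c, 'h, 'x) pcat_scheme" and \<alpha>

sublocale tensor_mtransf \<subseteq> F: tensor_smfunctor A B C "msrc \<alpha>"
  by (rule tensor_smfunctorI) (simp_all add: tensor_cat_axioms f.F.is_smf)
sublocale tensor_mtransf \<subseteq> G: tensor_smfunctor A B C "mtgt \<alpha>"
  by (rule tensor_smfunctorI) (simp_all add: tensor_cat_axioms f.G.is_smf)

context tensor_mtransf
begin

lemma asum_typing [simp]:
  assumes "xs \<in> tobj A B"
  shows "asum C (\<lambda>p. mcomp \<alpha> [p]) xs \<in> Arr C"
    "Dom C (asum C (\<lambda>p. mcomp \<alpha> [p]) xs) = osum C (\<lambda>p. fobj (msrc \<alpha>) [p]) xs"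
    "Cod C (asum C (\<lambda>p. mcomp \<alpha> [p]) xs) = osum C (\<lambda>p. fobj (mtgt \<alpha>) [p]) xs"
  using assms by (induction xs) auto

text \<open>The sum of the one-term components is \<open>\<alpha>\<close> conjugated by the iterated
  constraints; monoidality of \<open>\<alpha>\<close> drives the induction. Read at each object it
  is also naturality of the counit in \<open>\<alpha>\<close>.\<close>

lemma asum_mcomp:
  "xs \<in> tobj A B \<Longrightarrow>
    fmults C (mtgt \<alpha>) xs \<cdot>\<^bsub>C\<^esub> asum C (\<lambda>p. mcomp \<alpha> [p]) xs = mcomp \<alpha> xs \<cdot>\<^bsub>C\<^esub> fmults C (msrc \<alpha>) xs"
proof (induction xs)
  case Nil
  then show ?case using f.mcomp_zero by simp
next
  case (Cons p xs)
  have o: "p \<in> Obj A \<times> Obj B" "xs \<in> tobj A B" "[p] \<in> tobj A B"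
    using Cons.prems by auto
  have "fmults C (mtgt \<alpha>) (p # xs) \<cdot>\<^bsub>C\<^esub> asum C (\<lambda>p. mcomp \<alpha> [p]) (p # xs) =
    fmult (mtgt \<alpha>) [p] xs \<cdot>\<^bsub>C\<^esub> (mcomp \<alpha> [p] \<oplus>\<^sub>a\<^bsub>C\<^esub> (mcomp \<alpha> xs \<cdot>\<^bsub>C\<^esub> fmults C (msrc \<alpha>) xs))"
    using o Cons.IH by (simp add: f.F.B.interchange)
  also have "\<dots> = (fmult (mtgt \<alpha>) [p] xs \<cdot>\<^bsub>C\<^esub> (mcomp \<alpha> [p] \<oplus>\<^sub>a\<^bsub>C\<^esub> mcomp \<alpha> xs)) \<cdot>\<^bsub>C\<^esub>
      (Id C (fobj (msrc \<alpha>) [p]) \<oplus>\<^sub>a\<^bsub>C\<^esub> fmults C (msrc \<alpha>) xs)"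
    using o by (simp add: f.F.B.interchange)
  also have "\<dots> = mcomp \<alpha> (p # xs) \<cdot>\<^bsub>C\<^esub> fmults C (msrc \<alpha>) (p # xs)"
    using o f.mcomp_plus[of "[p]" xs, symmetric] by simp
  finally show ?case .
qed

lemma asum_mcomp':
  "xs \<in> tobj A B \<Longrightarrow> asum C (\<lambda>p. mcomp \<alpha> [p]) xs =
    inv_arr C (fmults C (mtgt \<alpha>) xs) \<cdot>\<^bsub>C\<^esub> (mcomp \<alpha> xs \<cdot>\<^bsub>C\<^esub> fmults C (msrc \<alpha>) xs)"
  by (simp flip: asum_mcomp)

lemma asum_append:
  "xs \<in> tobj A B \<Longrightarrow> ys \<in> tobj A B \<Longrightarrow> asum C (\<lambda>p. mcomp \<alpha> [p]) (xs @ ys) =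
    asum C (\<lambda>p. mcomp \<alpha> [p]) xs \<oplus>\<^sub>a\<^bsub>C\<^esub> asum C (\<lambda>p. mcomp \<alpha> [p]) ys"
  by (rule f.F.B.asum_append) (auto simp: tobj_def)

lemma strictify_mtrans_is_mtrans: "is_mtrans (tensor A B) C (strictify_mtrans A B C \<alpha>)"
proof -
  let ?s = "strictify_mtrans A B C \<alpha>"
  show ?thesis
  proof (rule is_mtransI)
    fix X assume X: "X \<in> Arr (tensor A B)"
    let ?m = "fmults C (mtgt \<alpha>)" and ?n = "fmults C (msrc \<alpha>)"
      and ?d = "Dom (tensor A B) X" and ?c = "Cod (tensor A B) X"
    have "mcomp \<alpha> ?c \<cdot>\<^bsub>C\<^esub> (farr (msrc \<alpha>) X \<cdot>\<^bsub>C\<^esub> ?n ?d) = farr (mtgt \<alpha>) X \<cdot>\<^bsub>C\<^esub> (mcomp \<alpha> ?d \<cdot>\<^bsub>C\<^esub> ?n ?d)"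
      using X f.F.B.comp_reassoc[OF f.mcomp_nat[OF X], of "?n ?d"] by simp
    then show "mcomp ?s ?c \<cdot>\<^bsub>C\<^esub> farr (msrc ?s) X = farr (mtgt ?s) X \<cdot>\<^bsub>C\<^esub> mcomp ?s ?d"
      using X by (simp add: F.strictify_eq G.strictify_eq asum_mcomp')
  next
    fix xs ys assume "xs \<in> Obj (tensor A B)" "ys \<in> Obj (tensor A B)"
    then show "mcomp ?s (xs \<oplus>\<^sub>o\<^bsub>tensor A B\<^esub> ys) \<cdot>\<^bsub>C\<^esub> fmult (msrc ?s) xs ys = fmult (mtgt ?s) xs ys \<cdot>\<^bsub>C\<^esub>
      (mcomp ?s xs \<oplus>\<^sub>a\<^bsub>C\<^esub> mcomp ?s ys)"
      by (simp add: F.strictify_eq G.strictify_eq asum_append F.F_osum_append G.F_osum_append)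
  qed (simp_all add: F.strict_conj_is_smf G.strict_conj_is_smf F.strictify_eq G.strictify_eq)
qed

text \<open>Between strict functors a monoidal transformation is additive and an identity at
  \<open>0\<close>, so its one-term components determine it.\<close>

lemma strictify_mtrans_of_strict:
  assumes "is_strict_smf (tensor A B) C (msrc \<alpha>)" "is_strict_smf (tensor A B) C (mtgt \<alpha>)"
  shows "strictify_mtrans A B C \<alpha> = \<alpha>"
proof -
  interpret K: tensor_strict A B C "msrc \<alpha>"
    by (rule tensor_strictI) (simp_all add: tensor_cat_axioms assms)
  interpret L: tensor_strict A B C "mtgt \<alpha>"
    by (rule tensor_strictI) (simp_all add: tensor_cat_axioms assms)
  have "mcomp \<alpha> xs = asum C (\<lambda>p. mcomp \<alpha> [p]) xs" if "xs \<in> tobj A B" for xs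
    using that
  proof (induction xs)
    case Nil
    then show ?case using f.mcomp_zero by simp
  next
    case (Cons p xs)
    from Cons.prems have "mcomp \<alpha> (p # xs) = mcomp \<alpha> [p] \<oplus>\<^sub>a\<^bsub>C\<^esub> mcomp \<alpha> xs"
      using f.mcomp_plus[of "[p]" xs] K.K_Cons[of p xs] L.K_Cons[of p xs] by auto
    then show ?case using Cons by simp
  qed
  then show ?thesis
    using f.mcomp_ext
    by (intro mtrans_eqI[where X = "tobj A B"])
      (simp_all add: F.strictify_of_strict G.strictify_of_strict assms)
qed

lemma strictify_counit_nat:
  "mtrans_vcomp (tensor A B) C (strictify_counit A B C (mtgt \<alpha>)) (strictify_mtrans A B C \<alpha>) =
   mtrans_vcomp (tensor A B) C \<alpha> (strictify_counit A B C (msrc \<alpha>))"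
  by (rule mtrans_eqI[where X = "tobj A B"]) (simp_all add: asum_mcomp)

end

lemma tensor_mtransfI: "tensor_cat A B \<Longrightarrow> is_mtrans (tensor A B) C \<alpha> \<Longrightarrow> tensor_mtransf A B C \<alpha>"
  by (simp add: tensor_mtransf_def mtransfI)

lemma (in tensor_cat) strictify_mtrans_vcomp:
  assumes "is_mtrans (tensor A B) C \<phi>" "is_mtrans (tensor A B) C \<psi>" "mtgt \<phi> = msrc \<psi>"
  shows "strictify_mtrans A B C (mtrans_vcomp (tensor A B) C \<psi> \<phi>) =
    mtrans_vcomp (tensor A B) C (strictify_mtrans A B C \<psi>) (strictify_mtrans A B C \<phi>)"
proof -
  interpret f: tensor_mtransf A B C \<phi>
    by (rule tensor_mtransfI) (simp_all add: tensor_cat_axioms assms)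
  interpret g: tensor_mtransf A B C \<psi>
    by (rule tensor_mtransfI) (simp_all add: tensor_cat_axioms assms)
  have "asum C (\<lambda>p. mcomp (mtrans_vcomp (tensor A B) C \<psi> \<phi>) [p]) xs =
      asum C (\<lambda>p. mcomp \<psi> [p]) xs \<cdot>\<^bsub>C\<^esub> asum C (\<lambda>p. mcomp \<phi> [p]) xs" if "xs \<in> tobj A B" for xs
    using that
  proof (induction xs)
    case (Cons p xs)
    then have "mcomp \<psi> [p] \<in> Arr C" "mcomp \<phi> [p] \<in> Arr C" "Cod C (mcomp \<phi> [p]) = Dom C (mcomp \<psi> [p])"
      "Cod C (asum C (\<lambda>p. mcomp \<phi> [p]) xs) = Dom C (asum C (\<lambda>p. mcomp \<psi> [p]) xs)"
      using assms(3) by auto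
    then show ?case using Cons by (simp add: f.f.F.B.interchange)
  qed simp
  then show ?thesis
    by (intro mtrans_eqI[where X = "tobj A B"]) simp_all
qed

lemma (in tensor_cat) strictify_mtrans_id:
  assumes "is_smf (tensor A B) C F"
  shows "strictify_mtrans A B C (mtrans_id (tensor A B) C F) = mtrans_id (tensor A B) C (strictify A B C F)"
proof -
  interpret F: tensor_smfunctor A B C F
    by (rule tensor_smfunctorI) (simp_all add: tensor_cat_axioms assms)
  have "asum C (\<lambda>p. mcomp (mtrans_id (tensor A B) C F) [p]) xs = Id C (osum C (\<lambda>p. fobj F [p]) xs)"
    if "xs \<in> tobj A B" for xs
    using that by (induction xs) auto
  then show ?thesis
    by (intro mtrans_eqI[where X = "tobj A B"]) simp_all
qed

lemma strictifier_PermCat: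
  assumes "is_permutative A" "is_permutative B" "is_permutative C"
  shows "strictifier (PermCat (tensor A B) C) (PermCat_s A B C) (strictify A B C) (strictify_mtrans A B C)
    (strictify_counit A B C)"
proof -
  interpret T: tensor_cat A B by (rule tensor_catI) fact+
  interpret C: permcat C by (rule permcatI) fact
  interpret Y: permcat "PermCat (tensor A B) C"
    by (rule permcatI PermCat_is_permutative T.tensor_is_permutative assms)+
  note sf = tensor_smfunctorI[OF T.tensor_cat_axioms, of C]
  note mt = tensor_mtransfI[OF T.tensor_cat_axioms, of C]
  have zero: "is_strict_smf (tensor A B) C (zero_smf (tensor A B) C)"
    by (rule is_strict_smfI[OF zero_smf_is_smf[OF T.P.permcat_axioms C.permcat_axioms]]) simp_all
  show ?thesis
  proof unfold_locales
    fix \<phi> \<psi> assume "\<phi> \<in> Arr (PermCat (tensor A B) C)" "\<psi> \<in> Arr (PermCat (tensor A B) C)"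
    then interpret f: tensor_mtransf A B C \<phi> + g: tensor_mtransf A B C \<psi>
      by (simp_all add: mt)
    show "strictify_mtrans A B C (\<phi> \<oplus>\<^sub>a\<^bsub>PermCat (tensor A B) C\<^esub> \<psi>) =
      strictify_mtrans A B C \<phi> \<oplus>\<^sub>a\<^bsub>PermCat_s A B C\<^esub> strictify_mtrans A B C \<psi>"
      by (rule mtrans_eqI[where X = "tobj A B"])
        (auto simp: T.strictify_pw_sum f.f.F.is_smf f.f.G.is_smf g.f.F.is_smf g.f.G.is_smf tobj_def intro!: asum_cong)
  next
    fix F G assume "F \<in> Obj (PermCat (tensor A B) C)" "G \<in> Obj (PermCat (tensor A B) C)"
    then interpret F: tensor_smfunctor A B C F + G: tensor_smfunctor A B C G
      by (simp_all add: sf)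
    show "strictify_mtrans A B C (sym (PermCat (tensor A B) C) F G) =
      sym (PermCat_s A B C) (strictify A B C F) (strictify A B C G)"
      by (rule mtrans_eqI[where X = "tobj A B"])
        (auto simp: T.strictify_pw_sum F.F.is_smf G.F.is_smf tobj_def intro!: asum_cong)
  next
    fix F assume "F \<in> Obj (PermCat (tensor A B) C)"
    then interpret F: tensor_smfunctor A B C F
      by (simp add: sf)
    show "is_iso (PermCat (tensor A B) C) (strictify_counit A B C F)"
    proof (rule Y.is_isoI(1))
      \<comment> \<open>Componentwise inverses of the iterated constraints; they are monoidal
        because the constraints are.\<close>
      let ?i = "\<lparr>msrc = F, mtgt = strictify A B C F, mcomp = \<lambda>xs\<in>tobj A B. inv_arr C (fmults C F xs)\<rparr>"
      interpret e: mtransf "tensor A B" C "strictify_counit A B C F"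
        by (rule mtransfI F.strictify_counit_is_mtrans)+
      show "strictify_counit A B C F \<in> Arr (PermCat (tensor A B) C)"
        by (simp add: F.strictify_counit_is_mtrans)
      have "is_mtrans (tensor A B) C ?i"
      proof (rule is_mtransI)
        fix X assume X: "X \<in> Arr (tensor A B)"
        then show "mcomp ?i (Cod (tensor A B) X) \<cdot>\<^bsub>C\<^esub> farr (msrc ?i) X =
           farr (mtgt ?i) X \<cdot>\<^bsub>C\<^esub> mcomp ?i (Dom (tensor A B) X)"
          by (simp add: F.strictify_eq)
      qed (simp_all add: F.strict_conj_is_smf F.F.is_smf F.strictify_eq F.fmults_append F.F_osum_append
          C.inv_of_comp C.inv_plus C.iso_arr)
      then show "?i \<in> Arr (PermCat (tensor A B) C)" by simp
    qed (auto intro!: mtrans_eqI[where X = "tobj A B"])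
    \<comment> \<open>Strictifying the counit only sees the iterated constraints on single summands,
      which are identities.\<close>
    show "strictify_mtrans A B C (strictify_counit A B C F) = Id (PermCat (tensor A B) C) (strictify A B C F)"
    proof (rule mtrans_eqI[where X = "tobj A B"])
      fix xs assume "xs \<in> tobj A B"
      then show "mcomp (strictify_mtrans A B C (strictify_counit A B C F)) xs =
        mcomp (Id (PermCat (tensor A B) C) (strictify A B C F)) xs"
      proof (induction xs)
        case (Cons p xs)
        then show ?case using F.fmults_single[of p] by auto
      qed simp
    qed (use F.strictify_of_strict F.strictify_strict sf T.tensor_cat_axioms in
        \<open>simp_all add: tensor_smfunctor.strictify_of_strict[OF sf[OF F.strictify_is_smf] F.strictify_strict]\<close>)
  next
    fix F assume F: "F \<in> Obj (PermCat_s A B C)"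
    then interpret K: tensor_strict A B C F
      by (intro tensor_strictI) (simp_all add: T.tensor_cat_axioms)
    interpret F: tensor_smfunctor A B C F
      by (rule sf K.K.is_smf)+
    have "fmults C F xs = Id C (fobj F xs)" if "xs \<in> tobj A B" for xs
      using that
    proof (induction xs)
      case (Cons p xs)
      then show ?case using K.K_append[of "[p]" xs] by auto
    qed simp
    then show "strictify_counit A B C F = Id (PermCat (tensor A B) C) F"
      using F by (intro mtrans_eqI[where X = "tobj A B"]) (simp_all add: F.strictify_of_strict)
  next
    fix F assume "F \<in> Obj (PermCat (tensor A B) C)"
    then show "strictify_mtrans A B C (Id (PermCat (tensor A B) C) F) = Id (PermCat (tensor A B) C) (strictify A B C F)"
      by (simp add: T.strictify_mtrans_id)
  next
    fix \<phi> \<psi> assume "\<phi> \<in> Arr (PermCat (tensor A B) C)" "\<psi> \<in> Arr (PermCat (tensor A B) C)"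
      "Cod (PermCat (tensor A B) C) \<phi> = Dom (PermCat (tensor A B) C) \<psi>"
    then show "strictify_mtrans A B C (\<psi> \<cdot>\<^bsub>PermCat (tensor A B) C\<^esub> \<phi>) =
      strictify_mtrans A B C \<psi> \<cdot>\<^bsub>PermCat (tensor A B) C\<^esub> strictify_mtrans A B C \<phi>"
      by (simp add: T.strictify_mtrans_vcomp)
  qed (auto simp: strict_smf_smf is_mtrans_smf zero T.strictify_pw_sum tensor_smfunctor.strictify_strict[OF sf]
      tensor_smfunctor.strictify_of_strict[OF sf] tensor_mtransf.strictify_mtrans_is_mtrans[OF mt]
      tensor_mtransf.strictify_mtrans_of_strict[OF mt] tensor_mtransf.strictify_counit_nat[OF mt])
qed

section \<open>Bilinear maps and strict functors on the tensor product\<close>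

text \<open>The data of a bilinear map \<open>A, B -> C\<close>, encoded by its values on the
  generators of \<open>A \<otimes> B\<close>. The clauses of \<open>teq\<close> about \<beta> alone
  have no counterpart here, as they hold in every permutative \<open>C\<close> once \<beta> is sent
  to \<beta>.\<close>

locale bilinear = tensor_cat A B + C: permcat C
  for A :: "('a, 'f, 'z) pcat_scheme" and B :: "('b, 'g, 'y) pcat_scheme"
    and C :: "('c, 'h, 'x) pcat_scheme" and I :: "('a, 'f, 'b, 'g, 'c, 'h) images" +
  assumes obj [simp]: "a \<in> Obj A \<Longrightarrow> b \<in> Obj B \<Longrightarrow> im_obj I (a, b) \<in> Obj C"
    and gen_typing: "f \<in> Arr A \<Longrightarrow> g \<in> Arr B \<Longrightarrow> im_gen I f g \<in> Arr C \<and>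
      Dom C (im_gen I f g) = im_obj I (Dom A f, Dom B g) \<and> Cod C (im_gen I f g) = im_obj I (Cod A f, Cod B g)"
    and deltaL_typing: "a \<in> Obj A \<Longrightarrow> b \<in> Obj B \<Longrightarrow> b' \<in> Obj B \<Longrightarrow> is_iso C (im_deltaL I a b b') \<and>
      Dom C (im_deltaL I a b b') = im_obj I (a, b) \<oplus>\<^sub>o\<^bsub>C\<^esub> im_obj I (a, b') \<and>
      Cod C (im_deltaL I a b b') = im_obj I (a, b \<oplus>\<^sub>o\<^bsub>B\<^esub> b')"
    and deltaR_typing: "b \<in> Obj B \<Longrightarrow> a \<in> Obj A \<Longrightarrow> a' \<in> Obj A \<Longrightarrow> is_iso C (im_deltaR I b a a') \<and>
      Dom C (im_deltaR I b a a') = im_obj I (a, b) \<oplus>\<^sub>o\<^bsub>C\<^esub> im_obj I (a', b) \<and>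
      Cod C (im_deltaR I b a a') = im_obj I (a \<oplus>\<^sub>o\<^bsub>A\<^esub> a', b)"
    and zetaL_typing: "a \<in> Obj A \<Longrightarrow> is_iso C (im_zetaL I a) \<and>
      Dom C (im_zetaL I a) = zero C \<and> Cod C (im_zetaL I a) = im_obj I (a, zero B)"
    and zetaR_typing: "b \<in> Obj B \<Longrightarrow> is_iso C (im_zetaR I b) \<and>
      Dom C (im_zetaR I b) = zero C \<and> Cod C (im_zetaR I b) = im_obj I (zero A, b)"
    and gen_id [simp]: "a \<in> Obj A \<Longrightarrow> b \<in> Obj B \<Longrightarrow> im_gen I (Id A a) (Id B b) = Id C (im_obj I (a, b))"
    and gen_comp: "f \<in> Arr A \<Longrightarrow> f' \<in> Arr A \<Longrightarrow> Cod A f = Dom A f' \<Longrightarrow>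
      g \<in> Arr B \<Longrightarrow> g' \<in> Arr B \<Longrightarrow> Cod B g = Dom B g' \<Longrightarrow>
      im_gen I (f' \<cdot>\<^bsub>A\<^esub> f) (g' \<cdot>\<^bsub>B\<^esub> g) = im_gen I f' g' \<cdot>\<^bsub>C\<^esub> im_gen I f g"
    and deltaL_nat: "f \<in> Arr A \<Longrightarrow> g \<in> Arr B \<Longrightarrow> g' \<in> Arr B \<Longrightarrow>
      im_deltaL I (Cod A f) (Cod B g) (Cod B g') \<cdot>\<^bsub>C\<^esub> (im_gen I f g \<oplus>\<^sub>a\<^bsub>C\<^esub> im_gen I f g') =
      im_gen I f (g \<oplus>\<^sub>a\<^bsub>B\<^esub> g') \<cdot>\<^bsub>C\<^esub> im_deltaL I (Dom A f) (Dom B g) (Dom B g')"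
    and deltaR_nat: "g \<in> Arr B \<Longrightarrow> f \<in> Arr A \<Longrightarrow> f' \<in> Arr A \<Longrightarrow>
      im_deltaR I (Cod B g) (Cod A f) (Cod A f') \<cdot>\<^bsub>C\<^esub> (im_gen I f g \<oplus>\<^sub>a\<^bsub>C\<^esub> im_gen I f' g) =
      im_gen I (f \<oplus>\<^sub>a\<^bsub>A\<^esub> f') g \<cdot>\<^bsub>C\<^esub> im_deltaR I (Dom B g) (Dom A f) (Dom A f')"
    and zetaL_nat: "f \<in> Arr A \<Longrightarrow>
      im_zetaL I (Cod A f) = im_gen I f (Id B (zero B)) \<cdot>\<^bsub>C\<^esub> im_zetaL I (Dom A f)"
    and zetaR_nat: "g \<in> Arr B \<Longrightarrow>
      im_zetaR I (Cod B g) = im_gen I (Id A (zero A)) g \<cdot>\<^bsub>C\<^esub> im_zetaR I (Dom B g)"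
    and deltaL_assoc: "a \<in> Obj A \<Longrightarrow> b \<in> Obj B \<Longrightarrow> b' \<in> Obj B \<Longrightarrow> b'' \<in> Obj B \<Longrightarrow>
      im_deltaL I a (b \<oplus>\<^sub>o\<^bsub>B\<^esub> b') b'' \<cdot>\<^bsub>C\<^esub> (im_deltaL I a b b' \<oplus>\<^sub>a\<^bsub>C\<^esub> Id C (im_obj I (a, b''))) =
      im_deltaL I a b (b' \<oplus>\<^sub>o\<^bsub>B\<^esub> b'') \<cdot>\<^bsub>C\<^esub> (Id C (im_obj I (a, b)) \<oplus>\<^sub>a\<^bsub>C\<^esub> im_deltaL I a b' b'')"
    and deltaL_unit: "a \<in> Obj A \<Longrightarrow> b \<in> Obj B \<Longrightarrow>
        im_deltaL I a b (zero B) \<cdot>\<^bsub>C\<^esub> (Id C (im_obj I (a, b)) \<oplus>\<^sub>a\<^bsub>C\<^esub> im_zetaL I a) = Id C (im_obj I (a, b))"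
      "a \<in> Obj A \<Longrightarrow> b \<in> Obj B \<Longrightarrow>
        im_deltaL I a (zero B) b \<cdot>\<^bsub>C\<^esub> (im_zetaL I a \<oplus>\<^sub>a\<^bsub>C\<^esub> Id C (im_obj I (a, b))) = Id C (im_obj I (a, b))"
    and deltaL_sym: "a \<in> Obj A \<Longrightarrow> b \<in> Obj B \<Longrightarrow> b' \<in> Obj B \<Longrightarrow>
      im_gen I (Id A a) (sym B b b') \<cdot>\<^bsub>C\<^esub> im_deltaL I a b b' =
      im_deltaL I a b' b \<cdot>\<^bsub>C\<^esub> sym C (im_obj I (a, b)) (im_obj I (a, b'))"
    and deltaR_assoc: "b \<in> Obj B \<Longrightarrow> a \<in> Obj A \<Longrightarrow> a' \<in> Obj A \<Longrightarrow> a'' \<in> Obj A \<Longrightarrow>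
      im_deltaR I b (a \<oplus>\<^sub>o\<^bsub>A\<^esub> a') a'' \<cdot>\<^bsub>C\<^esub> (im_deltaR I b a a' \<oplus>\<^sub>a\<^bsub>C\<^esub> Id C (im_obj I (a'', b))) =
      im_deltaR I b a (a' \<oplus>\<^sub>o\<^bsub>A\<^esub> a'') \<cdot>\<^bsub>C\<^esub> (Id C (im_obj I (a, b)) \<oplus>\<^sub>a\<^bsub>C\<^esub> im_deltaR I b a' a'')"
    and deltaR_unit: "b \<in> Obj B \<Longrightarrow> a \<in> Obj A \<Longrightarrow>
        im_deltaR I b a (zero A) \<cdot>\<^bsub>C\<^esub> (Id C (im_obj I (a, b)) \<oplus>\<^sub>a\<^bsub>C\<^esub> im_zetaR I b) = Id C (im_obj I (a, b))"
      "b \<in> Obj B \<Longrightarrow> a \<in> Obj A \<Longrightarrow>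
        im_deltaR I b (zero A) a \<cdot>\<^bsub>C\<^esub> (im_zetaR I b \<oplus>\<^sub>a\<^bsub>C\<^esub> Id C (im_obj I (a, b))) = Id C (im_obj I (a, b))"
    and deltaR_sym: "b \<in> Obj B \<Longrightarrow> a \<in> Obj A \<Longrightarrow> a' \<in> Obj A \<Longrightarrow>
      im_gen I (sym A a a') (Id B b) \<cdot>\<^bsub>C\<^esub> im_deltaR I b a a' =
      im_deltaR I b a' a \<cdot>\<^bsub>C\<^esub> sym C (im_obj I (a, b)) (im_obj I (a', b))"
    and delta_delta: "a \<in> Obj A \<Longrightarrow> a' \<in> Obj A \<Longrightarrow> b \<in> Obj B \<Longrightarrow> b' \<in> Obj B \<Longrightarrow>
      im_deltaL I (a \<oplus>\<^sub>o\<^bsub>A\<^esub> a') b b' \<cdot>\<^bsub>C\<^esub> (im_deltaR I b a a' \<oplus>\<^sub>a\<^bsub>C\<^esub> im_deltaR I b' a a') =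
      im_deltaR I (b \<oplus>\<^sub>o\<^bsub>B\<^esub> b') a a' \<cdot>\<^bsub>C\<^esub> (im_deltaL I a b b' \<oplus>\<^sub>a\<^bsub>C\<^esub> im_deltaL I a' b b') \<cdot>\<^bsub>C\<^esub>
        midswap C (im_obj I (a, b)) (im_obj I (a', b)) (im_obj I (a, b')) (im_obj I (a', b'))"
    and zeta_zeta: "im_zetaL I (zero A) = im_zetaR I (zero B)"
    and deltaR_zetaL: "a \<in> Obj A \<Longrightarrow> a' \<in> Obj A \<Longrightarrow>
      im_deltaR I (zero B) a a' \<cdot>\<^bsub>C\<^esub> (im_zetaL I a \<oplus>\<^sub>a\<^bsub>C\<^esub> im_zetaL I a') = im_zetaL I (a \<oplus>\<^sub>o\<^bsub>A\<^esub> a')"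
    and deltaL_zetaR: "b \<in> Obj B \<Longrightarrow> b' \<in> Obj B \<Longrightarrow>
      im_deltaL I (zero A) b b' \<cdot>\<^bsub>C\<^esub> (im_zetaR I b \<oplus>\<^sub>a\<^bsub>C\<^esub> im_zetaR I b') = im_zetaR I (b \<oplus>\<^sub>o\<^bsub>B\<^esub> b')"
begin

lemma gen_arr [simp]:
  "f \<in> Arr A \<Longrightarrow> g \<in> Arr B \<Longrightarrow> im_gen I f g \<in> Arr C"
  "f \<in> Arr A \<Longrightarrow> g \<in> Arr B \<Longrightarrow> Dom C (im_gen I f g) = im_obj I (Dom A f, Dom B g)"
  "f \<in> Arr A \<Longrightarrow> g \<in> Arr B \<Longrightarrow> Cod C (im_gen I f g) = im_obj I (Cod A f, Cod B g)"
  using gen_typing by blast+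

lemma deltaL_arr [simp]:
  assumes "a \<in> Obj A" "b \<in> Obj B" "b' \<in> Obj B"
  shows "is_iso C (im_deltaL I a b b')" "im_deltaL I a b b' \<in> Arr C"
    "Dom C (im_deltaL I a b b') = im_obj I (a, b) \<oplus>\<^sub>o\<^bsub>C\<^esub> im_obj I (a, b')"
    "Cod C (im_deltaL I a b b') = im_obj I (a, b \<oplus>\<^sub>o\<^bsub>B\<^esub> b')"
  using deltaL_typing[OF assms] by (simp_all add: C.iso_arr)

lemma deltaR_arr [simp]:
  assumes "b \<in> Obj B" "a \<in> Obj A" "a' \<in> Obj A"
  shows "is_iso C (im_deltaR I b a a')" "im_deltaR I b a a' \<in> Arr C"
    "Dom C (im_deltaR I b a a') = im_obj I (a, b) \<oplus>\<^sub>o\<^bsub>C\<^esub> im_obj I (a', b)"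
    "Cod C (im_deltaR I b a a') = im_obj I (a \<oplus>\<^sub>o\<^bsub>A\<^esub> a', b)"
  using deltaR_typing[OF assms] by (simp_all add: C.iso_arr)

lemma zeta_arr [simp]:
  "a \<in> Obj A \<Longrightarrow> is_iso C (im_zetaL I a)" "a \<in> Obj A \<Longrightarrow> im_zetaL I a \<in> Arr C"
  "a \<in> Obj A \<Longrightarrow> Dom C (im_zetaL I a) = zero C" "a \<in> Obj A \<Longrightarrow> Cod C (im_zetaL I a) = im_obj I (a, zero B)"
  "b \<in> Obj B \<Longrightarrow> is_iso C (im_zetaR I b)" "b \<in> Obj B \<Longrightarrow> im_zetaR I b \<in> Arr C"
  "b \<in> Obj B \<Longrightarrow> Dom C (im_zetaR I b) = zero C" "b \<in> Obj B \<Longrightarrow> Cod C (im_zetaR I b) = im_obj I (zero A, b)"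
  using zetaL_typing zetaR_typing by (auto simp: C.iso_arr)

lemma I_osum [simp]: "xs \<in> tobj A B \<Longrightarrow> osum C (im_obj I) xs \<in> Obj C"
  by (rule C.osum_obj) (auto simp: tobj_def)

lemma I_osum_append [simp]:
  "xs \<in> tobj A B \<Longrightarrow> ys \<in> tobj A B \<Longrightarrow>
    osum C (im_obj I) (xs @ ys) = osum C (im_obj I) xs \<oplus>\<^sub>o\<^bsub>C\<^esub> osum C (im_obj I) ys"
  by (rule C.osum_append) (auto simp: tobj_def)

lemma cell_val_arr [simp]:
  assumes "cell_wf A B c"
  shows "is_iso C (cell_val C I c)" "cell_val C I c \<in> Arr C"
    "Dom C (cell_val C I c) = osum C (im_obj I) (cell_dom A B c)"
    "Cod C (cell_val C I c) = osum C (im_obj I) (cell_cod A B c)"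
  using assms by (cases c; auto)+

lemma trm_val_typing:
  "twf A B t \<Longrightarrow> trm_val C I t \<in> Arr C \<and> Dom C (trm_val C I t) = osum C (im_obj I) (tdom A B t) \<and>
    Cod C (trm_val C I t) = osum C (im_obj I) (tcod A B t)"
  by (induction t) simp_all

lemma trm_val_arr [simp]:
  assumes "twf A B t"
  shows "trm_val C I t \<in> Arr C" "Dom C (trm_val C I t) = osum C (im_obj I) (tdom A B t)"
    "Cod C (trm_val C I t) = osum C (im_obj I) (tcod A B t)"
  using trm_val_typing[OF assms] by blast+

lemma trm_val_beta1:
  "p \<in> Obj A \<times> Obj B \<Longrightarrow> ys \<in> tobj A B \<Longrightarrow>
    trm_val C I (beta1 p ys) = sym C (im_obj I p) (osum C (im_obj I) ys)"
  by (induction ys) (auto simp: C.sym_plus_right)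

text \<open>\<open>tbeta\<close> assembles the symmetry from one-term swaps by the two hexagons, and
  both hexagons hold in \<open>C\<close>.\<close>

lemma trm_val_tbeta:
  "xs \<in> tobj A B \<Longrightarrow> ys \<in> tobj A B \<Longrightarrow>
    trm_val C I (tbeta xs ys) = sym C (osum C (im_obj I) xs) (osum C (im_obj I) ys)"
  by (induction xs) (auto simp: C.sym_plus_left trm_val_beta1)

text \<open>Evaluation is sound for each clause: the monoidal and symmetry clauses by the axioms of
  \<open>C\<close>, the others by the corresponding assumption on \<open>I\<close>.\<close>

lemma teq_trm_val:
  assumes "teq A B t u"
  shows "trm_val C I t = trm_val C I u"
proof -
  \<comment> \<open>Keeps the assumption on \<open>I\<close> accessible inside the induction, where
    the case of the same name shadows it.\<close>
  note rel = delta_delta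
  from \<open>teq A B t u\<close> show ?thesis
  proof (induction rule: teq.induct)
    case (interchange t' t u' u)
    then show ?case by (simp add: C.interchange)
  next
    case (beta_nat t u)
    then show ?case using C.sym_nat[of "trm_val C I t" "trm_val C I u"] by (simp add: trm_val_tbeta)
  next
    case (delta_delta a a' b b')
    then show ?case using rel[of a a' b b'] by (simp add: midswap_def)
  qed (simp_all add: gen_comp deltaL_nat deltaR_nat trm_val_tbeta C.sym_plus_right deltaL_assoc deltaL_unit
      deltaL_sym deltaR_assoc deltaR_unit deltaR_sym zeta_zeta deltaR_zetaL deltaL_zetaR
      flip: zetaL_nat zetaR_nat)
qed

lemma farr_strict_extension:
  "twf A B t \<Longrightarrow> farr (strict_extension A B C I) (tcls A B t) = trm_val C I t"
  using teq_trm_val[OF teq_rep] by (simp add: strict_extension_def)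

text \<open>The existence half of the universal property. Once evaluation is independent of
  representatives, functoriality and additivity are built into the recursion of
  \<open>trm_val\<close>.\<close>

lemma strict_extension_is_smf: "is_smf (tensor A B) C (strict_extension A B C I)"
proof -
  let ?E = "strict_extension A B C I"
  show ?thesis
  proof (rule is_smfI)
    fix X Y assume "X \<in> Arr (tensor A B)" "Y \<in> Arr (tensor A B)" "Cod (tensor A B) X = Dom (tensor A B) Y"
    then show "farr ?E (Y \<cdot>\<^bsub>tensor A B\<^esub> X) = farr ?E Y \<cdot>\<^bsub>C\<^esub> farr ?E X"
      by (auto elim!: tensor_arrE simp: comp_tcls farr_strict_extension)
  next
    fix X Y assume "X \<in> Arr (tensor A B)" "Y \<in> Arr (tensor A B)"
    then show "fmult ?E (Cod (tensor A B) X) (Cod (tensor A B) Y) \<cdot>\<^bsub>C\<^esub> (farr ?E X \<oplus>\<^sub>a\<^bsub>C\<^esub> farr ?E Y) = farr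
      ?E (X \<oplus>\<^sub>a\<^bsub>tensor A B\<^esub> Y) \<cdot>\<^bsub>C\<^esub> fmult ?E (Dom (tensor A B) X) (Dom (tensor A B) Y)"
      by (auto elim!: tensor_arrE simp: plus_tcls farr_strict_extension)
  next
    fix X assume "X \<in> Arr (tensor A B)"
    then show "farr ?E X \<in> Arr C \<and> Dom C (farr ?E X) = fobj ?E (Dom (tensor A B) X) \<and> Cod C (farr ?E X) =
      fobj ?E (Cod (tensor A B) X)"
      by (auto elim!: tensor_arrE simp: farr_strict_extension)
  next
    fix xs ys assume o: "xs \<in> Obj (tensor A B)" "ys \<in> Obj (tensor A B)"
    then have "farr ?E (sym (tensor A B) xs ys) = sym C (osum C (im_obj I) xs) (osum C (im_obj I) ys)"
      by (simp add: tensor_id_sym farr_strict_extension trm_val_tbeta del: tcls_id_sym)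
    then show "farr ?E (sym (tensor A B) xs ys) \<cdot>\<^bsub>C\<^esub> fmult ?E xs ys = fmult ?E ys xs \<cdot>\<^bsub>C\<^esub> sym C (fobj ?E xs)
      (fobj ?E ys)"
      using o by simp
  next
    fix xs assume "xs \<in> Obj (tensor A B)"
    then show "farr ?E (Id (tensor A B) xs) = Id C (fobj ?E xs)"
      by (simp add: tensor_id_sym farr_strict_extension del: tcls_id_sym)
  qed (simp_all add: P.permcat_axioms C.permcat_axioms, simp_all add: strict_extension_def)
qed

lemma strict_extension_strict: "is_strict_smf (tensor A B) C (strict_extension A B C I)"
  by (rule is_strict_smfI[OF strict_extension_is_smf]) simp_all

text \<open>The first of the rewrite rules that collect all generators \<open>f.g\<close> at the
  left end of a composite and merge them into one, with the \<delta> and \<zeta> maps to their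
  right. In this form a relation for a pulled back map separates into one of \<open>I\<close> and an
  axiom of \<open>F\<close> or \<open>G\<close>.\<close>

lemma gen_gen:
  "f \<in> Arr A \<Longrightarrow> f' \<in> Arr A \<Longrightarrow> Cod A f = Dom A f' \<Longrightarrow> g \<in> Arr B \<Longrightarrow> g' \<in> Arr B \<Longrightarrow> Cod B g = Dom B g' \<Longrightarrow>
    im_gen I f' g' \<cdot>\<^bsub>C\<^esub> im_gen I f g = im_gen I (f' \<cdot>\<^bsub>A\<^esub> f) (g' \<cdot>\<^bsub>B\<^esub> g)"
  "f \<in> Arr A \<Longrightarrow> f' \<in> Arr A \<Longrightarrow> Cod A f = Dom A f' \<Longrightarrow> g \<in> Arr B \<Longrightarrow> g' \<in> Arr B \<Longrightarrow> Cod B g = Dom B g' \<Longrightarrow>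
    h \<in> Arr C \<Longrightarrow> Cod C h = im_obj I (Dom A f, Dom B g) \<Longrightarrow>
    im_gen I f' g' \<cdot>\<^bsub>C\<^esub> (im_gen I f g \<cdot>\<^bsub>C\<^esub> h) = im_gen I (f' \<cdot>\<^bsub>A\<^esub> f) (g' \<cdot>\<^bsub>B\<^esub> g) \<cdot>\<^bsub>C\<^esub> h"
  by (simp_all add: gen_comp)

lemma deltaL_gen:
  assumes "f \<in> Arr A" "g \<in> Arr B" "g' \<in> Arr B" "Cod A f = a" "Cod B g = b" "Cod B g' = b'"
  shows "im_deltaL I a b b' \<cdot>\<^bsub>C\<^esub> (im_gen I f g \<oplus>\<^sub>a\<^bsub>C\<^esub> im_gen I f g') =
      im_gen I f (g \<oplus>\<^sub>a\<^bsub>B\<^esub> g') \<cdot>\<^bsub>C\<^esub> im_deltaL I (Dom A f) (Dom B g) (Dom B g')"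
    and "h \<in> Arr C \<Longrightarrow> Cod C h = im_obj I (Dom A f, Dom B g) \<oplus>\<^sub>o\<^bsub>C\<^esub> im_obj I (Dom A f, Dom B g') \<Longrightarrow>
      im_deltaL I a b b' \<cdot>\<^bsub>C\<^esub> ((im_gen I f g \<oplus>\<^sub>a\<^bsub>C\<^esub> im_gen I f g') \<cdot>\<^bsub>C\<^esub> h) =
      im_gen I f (g \<oplus>\<^sub>a\<^bsub>B\<^esub> g') \<cdot>\<^bsub>C\<^esub> (im_deltaL I (Dom A f) (Dom B g) (Dom B g') \<cdot>\<^bsub>C\<^esub> h)"
  using assms deltaL_nat[of f g g'] C.comp_reassoc[OF deltaL_nat[of f g g'], of h] by auto

lemma deltaR_gen:
  assumes "g \<in> Arr B" "f \<in> Arr A" "f' \<in> Arr A" "Cod B g = b" "Cod A f = a" "Cod A f' = a'"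
  shows "im_deltaR I b a a' \<cdot>\<^bsub>C\<^esub> (im_gen I f g \<oplus>\<^sub>a\<^bsub>C\<^esub> im_gen I f' g) =
      im_gen I (f \<oplus>\<^sub>a\<^bsub>A\<^esub> f') g \<cdot>\<^bsub>C\<^esub> im_deltaR I (Dom B g) (Dom A f) (Dom A f')"
    and "h \<in> Arr C \<Longrightarrow> Cod C h = im_obj I (Dom A f, Dom B g) \<oplus>\<^sub>o\<^bsub>C\<^esub> im_obj I (Dom A f', Dom B g) \<Longrightarrow>
      im_deltaR I b a a' \<cdot>\<^bsub>C\<^esub> ((im_gen I f g \<oplus>\<^sub>a\<^bsub>C\<^esub> im_gen I f' g) \<cdot>\<^bsub>C\<^esub> h) =
      im_gen I (f \<oplus>\<^sub>a\<^bsub>A\<^esub> f') g \<cdot>\<^bsub>C\<^esub> (im_deltaR I (Dom B g) (Dom A f) (Dom A f') \<cdot>\<^bsub>C\<^esub> h)"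
  using assms deltaR_nat[of g f f'] C.comp_reassoc[OF deltaR_nat[of g f f'], of h] by auto

text \<open>Identity generators are rewritten to identities of \<open>C\<close>, where
  \<open>deltaL_gen\<close> no longer matches. These variants cover a generator summed with an
  identity.\<close>

lemma deltaL_gen_id:
  assumes "a \<in> Obj A" "b \<in> Obj B" "g \<in> Arr B" "Cod B g = b'"
  shows "h \<in> Arr C \<Longrightarrow> Cod C h = im_obj I (a, Dom B g) \<oplus>\<^sub>o\<^bsub>C\<^esub> im_obj I (a, b) \<Longrightarrow>
      im_deltaL I a b' b \<cdot>\<^bsub>C\<^esub> ((im_gen I (Id A a) g \<oplus>\<^sub>a\<^bsub>C\<^esub> Id C (im_obj I (a, b))) \<cdot>\<^bsub>C\<^esub> h) =
      im_gen I (Id A a) (g \<oplus>\<^sub>a\<^bsub>B\<^esub> Id B b) \<cdot>\<^bsub>C\<^esub> (im_deltaL I a (Dom B g) b \<cdot>\<^bsub>C\<^esub> h)"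
    and "h \<in> Arr C \<Longrightarrow> Cod C h = im_obj I (a, b) \<oplus>\<^sub>o\<^bsub>C\<^esub> im_obj I (a, Dom B g) \<Longrightarrow>
      im_deltaL I a b b' \<cdot>\<^bsub>C\<^esub> ((Id C (im_obj I (a, b)) \<oplus>\<^sub>a\<^bsub>C\<^esub> im_gen I (Id A a) g) \<cdot>\<^bsub>C\<^esub> h) =
      im_gen I (Id A a) (Id B b \<oplus>\<^sub>a\<^bsub>B\<^esub> g) \<cdot>\<^bsub>C\<^esub> (im_deltaL I a b (Dom B g) \<cdot>\<^bsub>C\<^esub> h)"
  using assms deltaL_gen(2)[of "Id A a" g "Id B b" a b' b h] deltaL_gen(2)[of "Id A a" "Id B b" g a b b' h] by auto

lemma deltaR_gen_id:
  assumes "b \<in> Obj B" "a \<in> Obj A" "f \<in> Arr A" "Cod A f = a'"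
  shows "h \<in> Arr C \<Longrightarrow> Cod C h = im_obj I (Dom A f, b) \<oplus>\<^sub>o\<^bsub>C\<^esub> im_obj I (a, b) \<Longrightarrow>
      im_deltaR I b a' a \<cdot>\<^bsub>C\<^esub> ((im_gen I f (Id B b) \<oplus>\<^sub>a\<^bsub>C\<^esub> Id C (im_obj I (a, b))) \<cdot>\<^bsub>C\<^esub> h) =
      im_gen I (f \<oplus>\<^sub>a\<^bsub>A\<^esub> Id A a) (Id B b) \<cdot>\<^bsub>C\<^esub> (im_deltaR I b (Dom A f) a \<cdot>\<^bsub>C\<^esub> h)"
    and "h \<in> Arr C \<Longrightarrow> Cod C h = im_obj I (a, b) \<oplus>\<^sub>o\<^bsub>C\<^esub> im_obj I (Dom A f, b) \<Longrightarrow>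
      im_deltaR I b a a' \<cdot>\<^bsub>C\<^esub> ((Id C (im_obj I (a, b)) \<oplus>\<^sub>a\<^bsub>C\<^esub> im_gen I f (Id B b)) \<cdot>\<^bsub>C\<^esub> h) =
      im_gen I (Id A a \<oplus>\<^sub>a\<^bsub>A\<^esub> f) (Id B b) \<cdot>\<^bsub>C\<^esub> (im_deltaR I b a (Dom A f) \<cdot>\<^bsub>C\<^esub> h)"
  using assms deltaR_gen(2)[of "Id B b" f "Id A a" b a' a h] deltaR_gen(2)[of "Id B b" "Id A a" f b a a' h] by auto

lemmas gen_simps = gen_gen deltaL_gen deltaR_gen deltaL_gen_id deltaR_gen_id C.whisker

end

text \<open>The composite of a bilinear map with \<open>F \<times> G\<close>. Each constraint is
  that of a composite functor, such as \<open>I(Fa, -)\<close> after \<open>G\<close>.\<close>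

definition pullback_images ::
  "('a, 'f, 'z) pcat_scheme \<Rightarrow> ('b, 'g, 'y) pcat_scheme \<Rightarrow> ('c, 'h, 'x) pcat_scheme \<Rightarrow>
    ('a, 'f, 'b, 'g, 'c, 'h) images \<Rightarrow> ('a1, 'f1, 'a, 'f) smf \<Rightarrow> ('b1, 'g1, 'b, 'g) smf \<Rightarrow>
    ('a1, 'f1, 'b1, 'g1, 'c, 'h) images" where
  "pullback_images A B C I F G =
    \<lparr>im_obj = \<lambda>(a, b). im_obj I (fobj F a, fobj G b), im_gen = \<lambda>f g. im_gen I (farr F f) (farr G g),
     im_deltaL = \<lambda>a b b'. im_gen I (Id A (fobj F a)) (fmult G b b') \<cdot>\<^bsub>C\<^esub>
       im_deltaL I (fobj F a) (fobj G b) (fobj G b'),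
     im_deltaR = \<lambda>b a a'. im_gen I (fmult F a a') (Id B (fobj G b)) \<cdot>\<^bsub>C\<^esub>
       im_deltaR I (fobj G b) (fobj F a) (fobj F a'),
     im_zetaL = \<lambda>a. im_gen I (Id A (fobj F a)) (funit G) \<cdot>\<^bsub>C\<^esub> im_zetaL I (fobj F a),
     im_zetaR = \<lambda>b. im_gen I (funit F) (Id B (fobj G b)) \<cdot>\<^bsub>C\<^esub> im_zetaR I (fobj G b)\<rparr>"

lemma pullback_images_sel [simp]:
  "im_obj (pullback_images A B C I F G) (a, b) = im_obj I (fobj F a, fobj G b)"
  "im_gen (pullback_images A B C I F G) f g = im_gen I (farr F f) (farr G g)"
  "im_deltaL (pullback_images A B C I F G) a b b' = im_gen I (Id A (fobj F a)) (fmult G b b') \<cdot>\<^bsub>C\<^esub>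
     im_deltaL I (fobj F a) (fobj G b) (fobj G b')"
  "im_deltaR (pullback_images A B C I F G) b a a' = im_gen I (fmult F a a') (Id B (fobj G b)) \<cdot>\<^bsub>C\<^esub>
     im_deltaR I (fobj G b) (fobj F a) (fobj F a')"
  "im_zetaL (pullback_images A B C I F G) a = im_gen I (Id A (fobj F a)) (funit G) \<cdot>\<^bsub>C\<^esub> im_zetaL I (fobj F a)"
  "im_zetaR (pullback_images A B C I F G) b = im_gen I (funit F) (Id B (fobj G b)) \<cdot>\<^bsub>C\<^esub> im_zetaR I (fobj G b)"
  by (simp_all add: pullback_images_def)

lemma (in bilinear) bilinear_pullback:
  assumes "is_smf A' A F" "is_smf B' B G"
  shows "bilinear A' B' C (pullback_images A B C I F G)"
proof -
  interpret F: smfunctor A' A F by (rule smfunctorI) fact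
  interpret G: smfunctor B' B G by (rule smfunctorI) fact
  let ?I = "pullback_images A B C I F G"
  have iso_gen: "is_iso C (im_gen I f g)" if "is_iso A f" "is_iso B g" for f g
    using that
    by (intro C.is_isoI(1)[of "im_gen I f g" "im_gen I (inv_arr A f) (inv_arr B g)"])
      (simp_all add: gen_gen A.iso_arr B.iso_arr)
  show ?thesis
  proof unfold_locales
    fix f g g' assume a: "f \<in> Arr A'" "g \<in> Arr B'" "g' \<in> Arr B'"
    then show "im_deltaL ?I (Cod A' f) (Cod B' g) (Cod B' g') \<cdot>\<^bsub>C\<^esub> (im_gen ?I f g \<oplus>\<^sub>a\<^bsub>C\<^esub> im_gen ?I f g') =
      im_gen ?I f (g \<oplus>\<^sub>a\<^bsub>B'\<^esub> g') \<cdot>\<^bsub>C\<^esub> im_deltaL ?I (Dom A' f) (Dom B' g) (Dom B' g')"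
      by (simp add: gen_simps G.fmult_nat)
  next
    fix g f f' assume a: "g \<in> Arr B'" "f \<in> Arr A'" "f' \<in> Arr A'"
    then show "im_deltaR ?I (Cod B' g) (Cod A' f) (Cod A' f') \<cdot>\<^bsub>C\<^esub> (im_gen ?I f g \<oplus>\<^sub>a\<^bsub>C\<^esub> im_gen ?I f' g) =
      im_gen ?I (f \<oplus>\<^sub>a\<^bsub>A'\<^esub> f') g \<cdot>\<^bsub>C\<^esub> im_deltaR ?I (Dom B' g) (Dom A' f) (Dom A' f')"
      by (simp add: gen_simps F.fmult_nat)
  next
    fix f assume "f \<in> Arr A'"
    then show "im_zetaL ?I (Cod A' f) = im_gen ?I f (Id B' (zero B')) \<cdot>\<^bsub>C\<^esub> im_zetaL ?I (Dom A' f)"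
      using zetaL_nat[of "farr F f"] by (simp add: gen_simps)
  next
    fix g assume "g \<in> Arr B'"
    then show "im_zetaR ?I (Cod B' g) = im_gen ?I (Id A' (zero A')) g \<cdot>\<^bsub>C\<^esub> im_zetaR ?I (Dom B' g)"
      using zetaR_nat[of "farr G g"] by (simp add: gen_simps)
  next
    fix a b b' b'' assume "a \<in> Obj A'" "b \<in> Obj B'" "b' \<in> Obj B'" "b'' \<in> Obj B'"
    then show "im_deltaL ?I a (b \<oplus>\<^sub>o\<^bsub>B'\<^esub> b') b'' \<cdot>\<^bsub>C\<^esub> (im_deltaL ?I a b b' \<oplus>\<^sub>a\<^bsub>C\<^esub> Id C (im_obj ?I (a, b'')))
      = im_deltaL ?I a b (b' \<oplus>\<^sub>o\<^bsub>B'\<^esub> b'') \<cdot>\<^bsub>C\<^esub> (Id C (im_obj ?I (a, b)) \<oplus>\<^sub>a\<^bsub>C\<^esub> im_deltaL ?I a b' b'')"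
      by (simp add: gen_simps G.fmult_assoc deltaL_assoc)
  next
    fix b a a' a'' assume "b \<in> Obj B'" "a \<in> Obj A'" "a' \<in> Obj A'" "a'' \<in> Obj A'"
    then show "im_deltaR ?I b (a \<oplus>\<^sub>o\<^bsub>A'\<^esub> a') a'' \<cdot>\<^bsub>C\<^esub> (im_deltaR ?I b a a' \<oplus>\<^sub>a\<^bsub>C\<^esub> Id C (im_obj ?I (a'', b)))
      = im_deltaR ?I b a (a' \<oplus>\<^sub>o\<^bsub>A'\<^esub> a'') \<cdot>\<^bsub>C\<^esub> (Id C (im_obj ?I (a, b)) \<oplus>\<^sub>a\<^bsub>C\<^esub> im_deltaR ?I b a' a'')"
      by (simp add: gen_simps F.fmult_assoc deltaR_assoc)
  next
    fix a b b' assume "a \<in> Obj A'" "b \<in> Obj B'" "b' \<in> Obj B'"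
    then show "im_gen ?I (Id A' a) (sym B' b b') \<cdot>\<^bsub>C\<^esub> im_deltaL ?I a b b' = im_deltaL ?I a b' b \<cdot>\<^bsub>C\<^esub> sym C
      (im_obj ?I (a, b)) (im_obj ?I (a, b'))"
      by (simp add: gen_simps G.fmult_sym flip: deltaL_sym)
  next
    fix b a a' assume "b \<in> Obj B'" "a \<in> Obj A'" "a' \<in> Obj A'"
    then show "im_gen ?I (sym A' a a') (Id B' b) \<cdot>\<^bsub>C\<^esub> im_deltaR ?I b a a' = im_deltaR ?I b a' a \<cdot>\<^bsub>C\<^esub> sym C
      (im_obj ?I (a, b)) (im_obj ?I (a', b))"
      by (simp add: gen_simps F.fmult_sym flip: deltaR_sym)
  next
    \<comment> \<open>On both sides the constraints of \<open>F\<close> and \<open>G\<close> merge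
      into the single generator \<open>F_2.G_2\<close>, which leaves the relation for
      \<open>I\<close>.\<close>
    fix a a' b b' assume "a \<in> Obj A'" "a' \<in> Obj A'" "b \<in> Obj B'" "b' \<in> Obj B'"
    then show "im_deltaL ?I (a \<oplus>\<^sub>o\<^bsub>A'\<^esub> a') b b' \<cdot>\<^bsub>C\<^esub> (im_deltaR ?I b a a' \<oplus>\<^sub>a\<^bsub>C\<^esub> im_deltaR ?I b' a a') =
      im_deltaR ?I (b \<oplus>\<^sub>o\<^bsub>B'\<^esub> b') a a' \<cdot>\<^bsub>C\<^esub> (im_deltaL ?I a b b' \<oplus>\<^sub>a\<^bsub>C\<^esub> im_deltaL ?I a' b b') \<cdot>\<^bsub>C\<^esub> midswap C
      (im_obj ?I (a, b)) (im_obj ?I (a', b)) (im_obj ?I (a, b')) (im_obj ?I (a', b'))"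
      by (simp add: gen_simps delta_delta flip: C.interchange)
  next
    \<comment> \<open>Naturality of \<zeta> at \<open>F_0\<close> and at \<open>G_0\<close> turns
      both sides into \<open>F_0.G_0\<close> after the unit map at \<open>0.0\<close>.\<close>
    show "im_zetaL ?I (zero A') = im_zetaR ?I (zero B')"
      using zetaL_nat[of "funit F"] zetaR_nat[of "funit G"] by (simp add: gen_simps zeta_zeta)
  next
    \<comment> \<open>Naturality of \<zeta> at \<open>F_2\<close> carries the unit map at
      \<open>Fa + Fa'\<close> to the one at \<open>F(a + a')\<close>.\<close>
    fix a a' assume "a \<in> Obj A'" "a' \<in> Obj A'"
    then show "im_deltaR ?I (zero B') a a' \<cdot>\<^bsub>C\<^esub> (im_zetaL ?I a \<oplus>\<^sub>a\<^bsub>C\<^esub> im_zetaL ?I a') = im_zetaL ?I (a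
      \<oplus>\<^sub>o\<^bsub>A'\<^esub> a')"
      using zetaL_nat[of "fmult F a a'"] by (simp add: gen_simps deltaR_zetaL flip: C.interchange)
  next
    fix b b' assume "b \<in> Obj B'" "b' \<in> Obj B'"
    then show "im_deltaL ?I (zero A') b b' \<cdot>\<^bsub>C\<^esub> (im_zetaR ?I b \<oplus>\<^sub>a\<^bsub>C\<^esub> im_zetaR ?I b') = im_zetaR ?I (b
      \<oplus>\<^sub>o\<^bsub>B'\<^esub> b')"
      using zetaR_nat[of "fmult G b b'"] by (simp add: gen_simps deltaL_zetaR flip: C.interchange)
  qed (simp_all add: gen_simps iso_gen F.farr_comp G.farr_comp F.fmult_unit G.fmult_unit deltaL_unit deltaR_unit)
qed

text \<open>The universal bilinear map \<open>A, B -> A \<otimes> B\<close>.\<close>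

definition univ_images ::
  "('a, 'f, 'z) pcat_scheme \<Rightarrow> ('b, 'g, 'y) pcat_scheme \<Rightarrow>
    ('a, 'f, 'b, 'g, ('a \<times> 'b) list, ('a, 'f, 'b, 'g) trm set) images" where
  "univ_images A B =
    \<lparr>im_obj = \<lambda>p. [p], im_gen = \<lambda>f g. tcls A B (Gen f g),
     im_deltaL = \<lambda>a b b'. tcls A B (Iso (DeltaL a b b')), im_deltaR = \<lambda>b a a'. tcls A B (Iso (DeltaR b a a')),
     im_zetaL = \<lambda>a. tcls A B (Iso (ZetaL a)), im_zetaR = \<lambda>b. tcls A B (Iso (ZetaR b))\<rparr>"

lemma univ_images_sel [simp]:
  "im_obj (univ_images A B) p = [p]" "im_gen (univ_images A B) f g = tcls A B (Gen f g)"
  "im_deltaL (univ_images A B) a b b' = tcls A B (Iso (DeltaL a b b'))"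
  "im_deltaR (univ_images A B) b a a' = tcls A B (Iso (DeltaR b a a'))"
  "im_zetaL (univ_images A B) a = tcls A B (Iso (ZetaL a))"
  "im_zetaR (univ_images A B) b = tcls A B (Iso (ZetaR b))"
  by (simp_all add: univ_images_def)

text \<open>Each requirement is a clause of \<open>teq\<close> read on classes. Those that mention
  \<beta> need a translation, because the symmetry of the tensor product is defined through
  \<open>tbeta\<close>.\<close>

lemma (in tensor_cat) bilinear_univ_images: "bilinear A B (tensor A B) (univ_images A B)"
proof -
  let ?I = "univ_images A B"
  show ?thesis
  proof unfold_locales
    fix a a' b b' assume o: "a \<in> Obj A" "a' \<in> Obj A" "b \<in> Obj B" "b' \<in> Obj B"
    show "im_deltaL ?I (a \<oplus>\<^sub>o\<^bsub>A\<^esub> a') b b' \<cdot>\<^bsub>tensor A B\<^esub> (im_deltaR ?I b a a' \<oplus>\<^sub>a\<^bsub>tensor A B\<^esub> im_deltaR ?I b'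
      a a') = im_deltaR ?I (b \<oplus>\<^sub>o\<^bsub>B\<^esub> b') a a' \<cdot>\<^bsub>tensor A B\<^esub> (im_deltaL ?I a b b' \<oplus>\<^sub>a\<^bsub>tensor A B\<^esub> im_deltaL
      ?I a' b b') \<cdot>\<^bsub>tensor A B\<^esub> midswap (tensor A B) (im_obj ?I (a, b)) (im_obj ?I (a', b)) (im_obj ?I (a,
      b')) (im_obj ?I (a', b'))"
      using o tcls_eq[OF teq.delta_delta[OF o]]
      by (simp add: midswap_def tensor_id_sym(1) comp_tcls plus_tcls flip: beta_cell del: tcls_id_sym(1))
  next
    fix a b b' assume "a \<in> Obj A" "b \<in> Obj B" "b' \<in> Obj B"
    then show "im_gen ?I (Id A a) (sym B b b') \<cdot>\<^bsub>tensor A B\<^esub> im_deltaL ?I a b b' = im_deltaL ?I a b' b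
      \<cdot>\<^bsub>tensor A B\<^esub> sym (tensor A B) (im_obj ?I (a, b)) (im_obj ?I (a, b'))"
      using tcls_eq[OF teq.deltaL_sym[of a A b B b']] by (simp add: comp_tcls flip: beta_cell)
  next
    fix b a a' assume "b \<in> Obj B" "a \<in> Obj A" "a' \<in> Obj A"
    then show "im_gen ?I (sym A a a') (Id B b) \<cdot>\<^bsub>tensor A B\<^esub> im_deltaR ?I b a a' = im_deltaR ?I b a' a
      \<cdot>\<^bsub>tensor A B\<^esub> sym (tensor A B) (im_obj ?I (a, b)) (im_obj ?I (a', b))"
      using tcls_eq[OF teq.deltaR_sym[of b B a A a']] by (simp add: comp_tcls flip: beta_cell)
  qed (simp_all add: tensor_id_sym(1) comp_tcls plus_tcls del: tcls_id_sym(1),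
      (rule tcls_eq; rule teq.intros; assumption)+)
qed

text \<open>Recognises \<open>F \<otimes> G\<close> as induced by a pulled back bilinear map; its
  well-definedness then comes from \<open>bilinear_pullback\<close>.\<close>

lemma tensor_smf_eq:
  "tensor_smf A' B' A B F G =
    strict_extension A' B' (tensor A B) (pullback_images A B (tensor A B) (univ_images A B) F G)"
  by (simp add: tensor_smf_def pullback_images_def)

lemma (in bilinear) tensor_strict_extension: "tensor_strict A B C (strict_extension A B C I)"
  by (intro tensor_strictI tensor_cat_axioms strict_extension_strict)

text \<open>Strictness forces the components at sums, and naturality propagates through composites,
  sums and inverses. A monoidal transformation between strict functors is therefore given by its
  components at \<open>a.b\<close>, tested on generators only; \<beta> needs no test because the
  symmetry of \<open>C\<close> is natural.\<close>

lemma asum_is_mtrans: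
  fixes K L :: "(('a \<times> 'b) list, ('a, 'f, 'b, 'g) trm set, 'c, 'h) smf"
  assumes "tensor_strict A B C K" "tensor_strict A B C L"
    and arr: "\<And>a b. a \<in> Obj A \<Longrightarrow> b \<in> Obj B \<Longrightarrow> \<theta> (a, b) \<in> Arr C \<and>
      Dom C (\<theta> (a, b)) = fobj K [(a, b)] \<and> Cod C (\<theta> (a, b)) = fobj L [(a, b)]"
    and gen: "\<And>f g. f \<in> Arr A \<Longrightarrow> g \<in> Arr B \<Longrightarrow>
      \<theta> (Cod A f, Cod B g) \<cdot>\<^bsub>C\<^esub> farr K (tcls A B (Gen f g)) =
      farr L (tcls A B (Gen f g)) \<cdot>\<^bsub>C\<^esub> \<theta> (Dom A f, Dom B g)"
    and deltaL: "\<And>a b b'. a \<in> Obj A \<Longrightarrow> b \<in> Obj B \<Longrightarrow> b' \<in> Obj B \<Longrightarrow>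
      \<theta> (a, b \<oplus>\<^sub>o\<^bsub>B\<^esub> b') \<cdot>\<^bsub>C\<^esub> farr K (tcls A B (Iso (DeltaL a b b'))) =
      farr L (tcls A B (Iso (DeltaL a b b'))) \<cdot>\<^bsub>C\<^esub> (\<theta> (a, b) \<oplus>\<^sub>a\<^bsub>C\<^esub> \<theta> (a, b'))"
    and deltaR: "\<And>b a a'. b \<in> Obj B \<Longrightarrow> a \<in> Obj A \<Longrightarrow> a' \<in> Obj A \<Longrightarrow>
      \<theta> (a \<oplus>\<^sub>o\<^bsub>A\<^esub> a', b) \<cdot>\<^bsub>C\<^esub> farr K (tcls A B (Iso (DeltaR b a a'))) =
      farr L (tcls A B (Iso (DeltaR b a a'))) \<cdot>\<^bsub>C\<^esub> (\<theta> (a, b) \<oplus>\<^sub>a\<^bsub>C\<^esub> \<theta> (a', b))"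
    and zetaL: "\<And>a. a \<in> Obj A \<Longrightarrow>
      \<theta> (a, zero B) \<cdot>\<^bsub>C\<^esub> farr K (tcls A B (Iso (ZetaL a))) = farr L (tcls A B (Iso (ZetaL a)))"
    and zetaR: "\<And>b. b \<in> Obj B \<Longrightarrow>
      \<theta> (zero A, b) \<cdot>\<^bsub>C\<^esub> farr K (tcls A B (Iso (ZetaR b))) = farr L (tcls A B (Iso (ZetaR b)))"
  shows "is_mtrans (tensor A B) C \<lparr>msrc = K, mtgt = L, mcomp = \<lambda>xs\<in>tobj A B. asum C \<theta> xs\<rparr>"
proof -
  interpret K: tensor_strict A B C K by fact
  interpret L: tensor_strict A B C L by fact
  note K.K_obj [simp] L.K_obj [simp]
  have \<theta> [simp]: "\<theta> p \<in> Arr C" "Dom C (\<theta> p) = fobj K [p]" "Cod C (\<theta> p) = fobj L [p]"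
    if "p \<in> Obj A \<times> Obj B" for p
    using that arr by auto
  have typing: "asum C \<theta> xs \<in> Arr C \<and> Dom C (asum C \<theta> xs) = fobj K xs \<and> Cod C (asum C \<theta> xs) = fobj L xs"
    if "xs \<in> tobj A B" for xs
    using that
  proof (induction xs)
    case (Cons p xs)
    then show ?case using K.K_Cons[of p xs] L.K_Cons[of p xs] by auto
  qed simp
  then have asum [simp]: "asum C \<theta> xs \<in> Arr C" "Dom C (asum C \<theta> xs) = fobj K xs"
    "Cod C (asum C \<theta> xs) = fobj L xs" if "xs \<in> tobj A B" for xs
    using that by blast+
  have append: "asum C \<theta> (xs @ ys) = asum C \<theta> xs \<oplus>\<^sub>a\<^bsub>C\<^esub> asum C \<theta> ys"
    if "xs \<in> tobj A B" "ys \<in> tobj A B" for xs ys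
    using that by (intro K.K.B.asum_append \<theta>) (auto simp: tobj_def)
  have cell: "asum C \<theta> (cell_cod A B c) \<cdot>\<^bsub>C\<^esub> farr K (tcls A B (Iso c)) =
    farr L (tcls A B (Iso c)) \<cdot>\<^bsub>C\<^esub> asum C \<theta> (cell_dom A B c)" if "cell_wf A B c" for c
  proof (cases c)
    case (Beta p q)
    then show ?thesis
      using that K.K.B.sym_nat[of "\<theta> p" "\<theta> q"]
      by (auto simp: K.beta_cell K.K.farr_sym L.K.farr_sym)
  qed (use that in \<open>simp_all add: deltaL deltaR zetaL zetaR\<close>)
  have nat: "asum C \<theta> (tcod A B t) \<cdot>\<^bsub>C\<^esub> farr K (tcls A B t) = farr L (tcls A B t) \<cdot>\<^bsub>C\<^esub> asum C \<theta> (tdom A B t)"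
    if "twf A B t" for t
    using that
  proof (induction t)
    case (Gen f g)
    then show ?case by (simp add: gen)
  next
    case (Iso c)
    then show ?case by (simp add: cell)
  next
    case (Inv c)
    then have c: "cell_wf A B c" by simp
    let ?k = "farr K (tcls A B (Iso c))" and ?l = "farr L (tcls A B (Iso c))"
    have i: "is_iso C ?k" "is_iso C ?l"
      using c by simp_all
    have k: "farr K (tcls A B (Inv c)) = inv_arr C ?k" "farr L (tcls A B (Inv c)) = inv_arr C ?l"
      using c K.K.farr_inv[OF K.iso_cell[OF c]] L.K.farr_inv[OF K.iso_cell[OF c]] by (simp_all add: K.inv_cell)
    \<comment> \<open>The naturality square at an inverse results from the one at
      \<open>Iso c\<close> by cancelling on both sides.\<close>
    have "asum C \<theta> (cell_dom A B c) \<cdot>\<^bsub>C\<^esub> inv_arr C ?k =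
      inv_arr C ?l \<cdot>\<^bsub>C\<^esub> ((?l \<cdot>\<^bsub>C\<^esub> asum C \<theta> (cell_dom A B c)) \<cdot>\<^bsub>C\<^esub> inv_arr C ?k)"
      using c i by (simp add: K.cell_obj)
    also have "\<dots> = inv_arr C ?l \<cdot>\<^bsub>C\<^esub> asum C \<theta> (cell_cod A B c)"
      unfolding cell[OF c, symmetric] using c i by (simp add: K.cell_obj)
    finally show ?case
      using k by simp
  next
    case (TComp t u)
    have "asum C \<theta> (tcod A B t) \<cdot>\<^bsub>C\<^esub> (farr K (tcls A B t) \<cdot>\<^bsub>C\<^esub> farr K (tcls A B u)) =
      (asum C \<theta> (tcod A B t) \<cdot>\<^bsub>C\<^esub> farr K (tcls A B t)) \<cdot>\<^bsub>C\<^esub> farr K (tcls A B u)"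
      using TComp.prems by simp
    also have "\<dots> = farr L (tcls A B t) \<cdot>\<^bsub>C\<^esub> (asum C \<theta> (tcod A B u) \<cdot>\<^bsub>C\<^esub> farr K (tcls A B u))"
      using TComp by simp
    also have "\<dots> = (farr L (tcls A B t) \<cdot>\<^bsub>C\<^esub> farr L (tcls A B u)) \<cdot>\<^bsub>C\<^esub> asum C \<theta> (tdom A B u)"
      using TComp by simp
    finally show ?case
      using TComp.prems by (simp add: K.K.farr_comp L.K.farr_comp flip: K.comp_tcls)
  next
    case (TPlus t u)
    then show ?case
      by (simp add: K.K.farr_plus L.K.farr_plus append K.K.B.interchange flip: K.plus_tcls)
  qed simp
  let ?\<phi> = "\<lparr>msrc = K, mtgt = L, mcomp = \<lambda>xs\<in>tobj A B. asum C \<theta> xs\<rparr>"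
  show ?thesis
  proof (rule is_mtransI)
    fix X assume "X \<in> Arr (tensor A B)"
    then show "mcomp ?\<phi> (Cod (tensor A B) X) \<cdot>\<^bsub>C\<^esub>
         farr (msrc ?\<phi>) X =
         farr (mtgt ?\<phi>) X \<cdot>\<^bsub>C\<^esub>
         mcomp ?\<phi> (Dom (tensor A B) X)"
      by (auto elim!: K.tensor_arrE simp: nat)
  qed (simp_all add: K.K.is_smf L.K.is_smf append)
qed

section \<open>Tensor products of 2-cells\<close>

lemma tensor_mtrans_sel [simp]:
  "msrc (tensor_mtrans A B A' B' \<phi> \<psi>) = tensor_smf A B A' B' (msrc \<phi>) (msrc \<psi>)"
  "mtgt (tensor_mtrans A B A' B' \<phi> \<psi>) = tensor_smf A B A' B' (mtgt \<phi>) (mtgt \<psi>)"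
  "mcomp (tensor_mtrans A B A' B' \<phi> \<psi>) = (\<lambda>xs\<in>tobj A B.
       asum (tensor A' B') (\<lambda>(a, b). tcls A' B' (Gen (mcomp \<phi> a) (mcomp \<psi> b))) xs)"
  by (simp_all add: tensor_mtrans_def)

text \<open>Once the generators are collected, the squares at \<delta> and \<zeta> become
  monoidality of \<open>\<phi>\<close> or \<open>\<psi>\<close> inside a single generator.\<close>

lemma (in bilinear) pullback_is_mtrans:
  assumes "is_mtrans A' A \<phi>" "is_mtrans B' B \<psi>"
  shows "is_mtrans (tensor A' B') C
    \<lparr>msrc = strict_extension A' B' C (pullback_images A B C I (msrc \<phi>) (msrc \<psi>)),
     mtgt = strict_extension A' B' C (pullback_images A B C I (mtgt \<phi>) (mtgt \<psi>)),
     mcomp = \<lambda>xs\<in>tobj A' B'. asum C (\<lambda>(a, b). im_gen I (mcomp \<phi> a) (mcomp \<psi> b)) xs\<rparr>"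
proof -
  interpret f: mtransf A' A \<phi> by (rule mtransfI) fact
  interpret g: mtransf B' B \<psi> by (rule mtransfI) fact
  interpret K: bilinear A' B' C "pullback_images A B C I (msrc \<phi>) (msrc \<psi>)"
    by (rule bilinear_pullback f.F.is_smf g.F.is_smf)+
  interpret L: bilinear A' B' C "pullback_images A B C I (mtgt \<phi>) (mtgt \<psi>)"
    by (rule bilinear_pullback f.G.is_smf g.G.is_smf)+
  show ?thesis
  proof (rule asum_is_mtrans[OF K.tensor_strict_extension L.tensor_strict_extension], goal_cases)
    case (5 a)
    then show ?case
      using zetaL_nat[of "mcomp \<phi> a"]
      by (simp add: K.farr_strict_extension L.farr_strict_extension gen_simps g.mcomp_zero)
  next
    case (6 b)
    then show ?case
      using zetaR_nat[of "mcomp \<psi> b"]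
      by (simp add: K.farr_strict_extension L.farr_strict_extension gen_simps f.mcomp_zero)
  qed (simp_all add: K.farr_strict_extension L.farr_strict_extension gen_simps f.mcomp_nat g.mcomp_nat
      f.mcomp_plus g.mcomp_plus)
qed

lemma tensor_mtrans_is_mtrans:
  assumes "tensor_cat A B" "is_mtrans A' A \<phi>" "is_mtrans B' B \<psi>"
  shows "is_mtrans (tensor A' B') (tensor A B) (tensor_mtrans A' B' A B \<phi> \<psi>)"
  using bilinear.pullback_is_mtrans[OF tensor_cat.bilinear_univ_images[OF assms(1)] assms(2,3)]
  by (simp add: tensor_mtrans_def tensor_smf_eq)

section \<open>Composition of symmetric monoidal functors\<close>

lemma smf_comp_sel [simp]:
  "fobj (smf_comp A C G F) = (\<lambda>x\<in>Obj A. fobj G (fobj F x))"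
  "farr (smf_comp A C G F) = (\<lambda>f\<in>Arr A. farr G (farr F f))"
  "fmult (smf_comp A C G F) = (\<lambda>x\<in>Obj A. \<lambda>y\<in>Obj A. farr G (fmult F x y) \<cdot>\<^bsub>C\<^esub> fmult G (fobj F x) (fobj F y))"
  "funit (smf_comp A C G F) = farr G (funit F) \<cdot>\<^bsub>C\<^esub> funit G"
  by (simp_all add: smf_comp_def)

lemma mtrans_hcomp_sel [simp]:
  "msrc (mtrans_hcomp A C \<psi> \<phi>) = smf_comp A C (msrc \<psi>) (msrc \<phi>)"
  "mtgt (mtrans_hcomp A C \<psi> \<phi>) = smf_comp A C (mtgt \<psi>) (mtgt \<phi>)"
  "mcomp (mtrans_hcomp A C \<psi> \<phi>) =
    (\<lambda>x\<in>Obj A. mcomp \<psi> (fobj (mtgt \<phi>) x) \<cdot>\<^bsub>C\<^esub> farr (msrc \<psi>) (mcomp \<phi> x))"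
  by (simp_all add: mtrans_hcomp_def)

lemma smf_comp_is_smf:
  assumes "is_smf A B F" "is_smf B C G"
  shows "is_smf A C (smf_comp A C G F)"
proof -
  interpret F: smfunctor A B F by (rule smfunctorI) fact
  interpret G: smfunctor B C G by (rule smfunctorI) fact
  let ?H = "smf_comp A C G F"
  show ?thesis
  proof (rule is_smfI)
    fix f g assume a: "f \<in> Arr A" "g \<in> Arr A"
    have "farr G (fmult F (Cod A f) (Cod A g)) \<cdot>\<^bsub>C\<^esub> (fmult G (fobj F (Cod A f)) (fobj F (Cod A g)) \<cdot>\<^bsub>C\<^esub>
        (farr G (farr F f) \<oplus>\<^sub>a\<^bsub>C\<^esub> farr G (farr F g))) =
      farr G (fmult F (Cod A f) (Cod A g) \<cdot>\<^bsub>B\<^esub> (farr F f \<oplus>\<^sub>a\<^bsub>B\<^esub> farr F g)) \<cdot>\<^bsub>C\<^esub>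
        fmult G (fobj F (Dom A f)) (fobj F (Dom A g))"
      using a G.fmult_nat[of "farr F f" "farr F g"] by (simp add: G.farr_comp)
    also have "\<dots> = farr G (farr F (f \<oplus>\<^sub>a\<^bsub>A\<^esub> g)) \<cdot>\<^bsub>C\<^esub> (farr G (fmult F (Dom A f) (Dom A g)) \<cdot>\<^bsub>C\<^esub>
        fmult G (fobj F (Dom A f)) (fobj F (Dom A g)))"
      using a by (simp add: F.fmult_nat G.farr_comp)
    finally show "fmult ?H (Cod A f) (Cod A g) \<cdot>\<^bsub>C\<^esub> (farr ?H f \<oplus>\<^sub>a\<^bsub>C\<^esub> farr ?H g) = farr ?H (f \<oplus>\<^sub>a\<^bsub>A\<^esub> g) \<cdot>\<^bsub>C\<^esub>
      fmult ?H (Dom A f) (Dom A g)"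
      using a by simp
  next
    fix x y z assume o: "x \<in> Obj A" "y \<in> Obj A" "z \<in> Obj A"
    let ?x = "fobj F x" and ?y = "fobj F y" and ?z = "fobj F z"
    \<comment> \<open>Naturality of \<open>G_2\<close> at a whiskered constraint of \<open>F\<close>
      sorts each composite into \<open>G\<close> of the axiom for \<open>F\<close>, preceded by the
      axiom for \<open>G\<close>.\<close>
    have 1: "fmult G (fobj F (x \<oplus>\<^sub>o\<^bsub>A\<^esub> y)) ?z \<cdot>\<^bsub>C\<^esub> (farr G (fmult F x y) \<oplus>\<^sub>a\<^bsub>C\<^esub> Id C (fobj G ?z)) =
      farr G (fmult F x y \<oplus>\<^sub>a\<^bsub>B\<^esub> Id B ?z) \<cdot>\<^bsub>C\<^esub> fmult G (?x \<oplus>\<^sub>o\<^bsub>B\<^esub> ?y) ?z"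
      using o G.fmult_nat[of "fmult F x y" "Id B ?z"] by simp
    have 2: "fmult G ?x (fobj F (y \<oplus>\<^sub>o\<^bsub>A\<^esub> z)) \<cdot>\<^bsub>C\<^esub> (Id C (fobj G ?x) \<oplus>\<^sub>a\<^bsub>C\<^esub> farr G (fmult F y z)) =
      farr G (Id B ?x \<oplus>\<^sub>a\<^bsub>B\<^esub> fmult F y z) \<cdot>\<^bsub>C\<^esub> fmult G ?x (?y \<oplus>\<^sub>o\<^bsub>B\<^esub> ?z)"
      using o G.fmult_nat[of "Id B ?x" "fmult F y z"] by simp
    have "fmult ?H (x \<oplus>\<^sub>o\<^bsub>A\<^esub> y) z \<cdot>\<^bsub>C\<^esub> (fmult ?H x y \<oplus>\<^sub>a\<^bsub>C\<^esub> Id C (fobj ?H z)) = farr G (fmult F (x \<oplus>\<^sub>o\<^bsub>A\<^esub> y)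
      z \<cdot>\<^bsub>B\<^esub> (fmult F x y \<oplus>\<^sub>a\<^bsub>B\<^esub> Id B ?z)) \<cdot>\<^bsub>C\<^esub> (fmult G (?x \<oplus>\<^sub>o\<^bsub>B\<^esub> ?y) ?z \<cdot>\<^bsub>C\<^esub> (fmult G ?x ?y \<oplus>\<^sub>a\<^bsub>C\<^esub> Id C
      (fobj G ?z)))"
      using o by (simp add: G.B.whisker G.B.comp_reassoc[OF 1] G.farr_comp)
    also have "\<dots> = farr G (fmult F x (y \<oplus>\<^sub>o\<^bsub>A\<^esub> z) \<cdot>\<^bsub>B\<^esub> (Id B ?x \<oplus>\<^sub>a\<^bsub>B\<^esub> fmult F y z)) \<cdot>\<^bsub>C\<^esub>
        (fmult G ?x (?y \<oplus>\<^sub>o\<^bsub>B\<^esub> ?z) \<cdot>\<^bsub>C\<^esub> (Id C (fobj G ?x) \<oplus>\<^sub>a\<^bsub>C\<^esub> fmult G ?y ?z))"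
      using o by (simp add: F.fmult_assoc G.fmult_assoc)
    also have "\<dots> = fmult ?H x (y \<oplus>\<^sub>o\<^bsub>A\<^esub> z) \<cdot>\<^bsub>C\<^esub> (Id C (fobj ?H x) \<oplus>\<^sub>a\<^bsub>C\<^esub> fmult ?H y z)"
      using o by (simp add: G.B.whisker G.B.comp_reassoc[OF 2] G.farr_comp)
    finally show "fmult ?H (x \<oplus>\<^sub>o\<^bsub>A\<^esub> y) z \<cdot>\<^bsub>C\<^esub> (fmult ?H x y \<oplus>\<^sub>a\<^bsub>C\<^esub> Id C (fobj ?H z)) = fmult ?H x (y \<oplus>\<^sub>o\<^bsub>A\<^esub>
      z) \<cdot>\<^bsub>C\<^esub> (Id C (fobj ?H x) \<oplus>\<^sub>a\<^bsub>C\<^esub> fmult ?H y z)" .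
  next
    fix x assume x: "x \<in> Obj A"
    let ?x = "fobj F x" and ?z = "fobj F (zero A)"
    have 1: "fmult G ?x ?z \<cdot>\<^bsub>C\<^esub> (Id C (fobj G ?x) \<oplus>\<^sub>a\<^bsub>C\<^esub> farr G (funit F)) =
        farr G (Id B ?x \<oplus>\<^sub>a\<^bsub>B\<^esub> funit F) \<cdot>\<^bsub>C\<^esub> fmult G ?x (zero B)"
      using x G.fmult_nat[of "Id B ?x" "funit F"] by simp
    have "fmult ?H x (zero A) \<cdot>\<^bsub>C\<^esub> (Id C (fobj ?H x) \<oplus>\<^sub>a\<^bsub>C\<^esub> funit ?H) = farr G (fmult F x (zero A) \<cdot>\<^bsub>B\<^esub> (Id
      B ?x \<oplus>\<^sub>a\<^bsub>B\<^esub> funit F)) \<cdot>\<^bsub>C\<^esub> (fmult G ?x (zero B) \<cdot>\<^bsub>C\<^esub> (Id C (fobj G ?x) \<oplus>\<^sub>a\<^bsub>C\<^esub> funit G))"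
      using x by (simp add: G.B.whisker G.B.comp_reassoc[OF 1] G.farr_comp)
    then show "fmult ?H x (zero A) \<cdot>\<^bsub>C\<^esub> (Id C (fobj ?H x) \<oplus>\<^sub>a\<^bsub>C\<^esub> funit ?H) = Id C (fobj ?H x)"
      using x by (simp add: F.fmult_unit G.fmult_unit)
    have 2: "fmult G ?z ?x \<cdot>\<^bsub>C\<^esub> (farr G (funit F) \<oplus>\<^sub>a\<^bsub>C\<^esub> Id C (fobj G ?x)) =
        farr G (funit F \<oplus>\<^sub>a\<^bsub>B\<^esub> Id B ?x) \<cdot>\<^bsub>C\<^esub> fmult G (zero B) ?x"
      using x G.fmult_nat[of "funit F" "Id B ?x"] by simp
    have "fmult ?H (zero A) x \<cdot>\<^bsub>C\<^esub> (funit ?H \<oplus>\<^sub>a\<^bsub>C\<^esub> Id C (fobj ?H x)) = farr G (fmult F (zero A) x \<cdot>\<^bsub>B\<^esub>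
      (funit F \<oplus>\<^sub>a\<^bsub>B\<^esub> Id B ?x)) \<cdot>\<^bsub>C\<^esub> (fmult G (zero B) ?x \<cdot>\<^bsub>C\<^esub> (funit G \<oplus>\<^sub>a\<^bsub>C\<^esub> Id C (fobj G ?x)))"
      using x by (simp add: G.B.whisker G.B.comp_reassoc[OF 2] G.farr_comp)
    then show "fmult ?H (zero A) x \<cdot>\<^bsub>C\<^esub> (funit ?H \<oplus>\<^sub>a\<^bsub>C\<^esub> Id C (fobj ?H x)) = Id C (fobj ?H x)"
      using x by (simp add: F.fmult_unit G.fmult_unit)
  next
    fix x y assume o: "x \<in> Obj A" "y \<in> Obj A"
    have "farr G (farr F (sym A x y) \<cdot>\<^bsub>B\<^esub> fmult F x y) \<cdot>\<^bsub>C\<^esub> fmult G (fobj F x) (fobj F y) =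
      farr G (fmult F y x) \<cdot>\<^bsub>C\<^esub> (farr G (sym B (fobj F x) (fobj F y)) \<cdot>\<^bsub>C\<^esub> fmult G (fobj F x) (fobj F y))"
      using o by (simp add: F.fmult_sym G.farr_comp)
    then show "farr ?H (sym A x y) \<cdot>\<^bsub>C\<^esub> fmult ?H x y = fmult ?H y x \<cdot>\<^bsub>C\<^esub> sym C (fobj ?H x) (fobj ?H y)"
      using o by (simp add: G.fmult_sym G.farr_comp)
  qed (simp_all add: F.A.permcat_axioms G.B.permcat_axioms F.farr_comp G.farr_comp)
qed

lemma smf_comp_is_strict_smf:
  assumes "is_strict_smf A B F" "is_strict_smf B C G"
  shows "is_strict_smf A C (smf_comp A C G F)"
proof -
  interpret F: strict_smfunctor A B F by (rule strict_smfunctorI) fact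
  interpret G: strict_smfunctor B C G by (rule strict_smfunctorI) fact
  show ?thesis
    by (rule is_strict_smfI[OF smf_comp_is_smf[OF F.is_smf G.is_smf]]) simp_all
qed

lemma mtrans_hcomp_is_mtrans:
  assumes "is_mtrans A B \<phi>" "is_mtrans B C \<psi>"
  shows "is_mtrans A C (mtrans_hcomp A C \<psi> \<phi>)"
proof -
  interpret f: mtransf A B \<phi> by (rule mtransfI) fact
  interpret g: mtransf B C \<psi> by (rule mtransfI) fact
  let ?F = "msrc \<phi>" and ?F' = "mtgt \<phi>" and ?G = "msrc \<psi>" and ?G' = "mtgt \<psi>"
    and ?h = "mtrans_hcomp A C \<psi> \<phi>"
  show ?thesis
  proof (rule is_mtransI)
    fix h assume h: "h \<in> Arr A"
    have "farr ?G (mcomp \<phi> (Cod A h)) \<cdot>\<^bsub>C\<^esub> farr ?G (farr ?F h) = farr ?G (farr ?F' h) \<cdot>\<^bsub>C\<^esub> farr ?G (mcomp \<phi> (Dom A h))"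
      using h f.mcomp_nat[OF h] by (simp flip: g.F.farr_comp)
    moreover have "mcomp \<psi> (fobj ?F' (Cod A h)) \<cdot>\<^bsub>C\<^esub> (farr ?G (farr ?F' h) \<cdot>\<^bsub>C\<^esub> farr ?G (mcomp \<phi> (Dom A h))) =
      farr ?G' (farr ?F' h) \<cdot>\<^bsub>C\<^esub> (mcomp \<psi> (fobj ?F' (Dom A h)) \<cdot>\<^bsub>C\<^esub> farr ?G (mcomp \<phi> (Dom A h)))"
      using h g.F.B.comp_reassoc[OF g.mcomp_nat[of "farr ?F' h"], of "farr ?G (mcomp \<phi> (Dom A h))"] by simp
    ultimately show "mcomp ?h (Cod A h) \<cdot>\<^bsub>C\<^esub> farr (msrc ?h) h = farr (mtgt ?h) h \<cdot>\<^bsub>C\<^esub> mcomp ?h (Dom A h)"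
      using h by simp
  next
    fix x y assume o: "x \<in> Obj A" "y \<in> Obj A"
    let ?p = "mcomp \<phi>" and ?x = "fobj ?F' x" and ?y = "fobj ?F' y"
    have "farr ?G (?p (x \<oplus>\<^sub>o\<^bsub>A\<^esub> y)) \<cdot>\<^bsub>C\<^esub> (farr ?G (fmult ?F x y) \<cdot>\<^bsub>C\<^esub> fmult ?G (fobj ?F x) (fobj ?F y)) =
      farr ?G (?p (x \<oplus>\<^sub>o\<^bsub>A\<^esub> y) \<cdot>\<^bsub>B\<^esub> fmult ?F x y) \<cdot>\<^bsub>C\<^esub> fmult ?G (fobj ?F x) (fobj ?F y)"
      using o by (simp add: g.F.farr_comp)
    also have "\<dots> = farr ?G (fmult ?F' x y) \<cdot>\<^bsub>C\<^esub> (farr ?G (?p x \<oplus>\<^sub>a\<^bsub>B\<^esub> ?p y) \<cdot>\<^bsub>C\<^esub> fmult ?G (fobj ?F x) (fobj ?F y))"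
      using o by (simp add: f.mcomp_plus g.F.farr_comp)
    also have "\<dots> = farr ?G (fmult ?F' x y) \<cdot>\<^bsub>C\<^esub> (fmult ?G ?x ?y \<cdot>\<^bsub>C\<^esub> (farr ?G (?p x) \<oplus>\<^sub>a\<^bsub>C\<^esub> farr ?G (?p y)))"
      using o g.F.fmult_nat[of "?p x" "?p y"] by simp
    finally have "mcomp ?h (x \<oplus>\<^sub>o\<^bsub>A\<^esub> y) \<cdot>\<^bsub>C\<^esub> fmult (msrc ?h) x y = mcomp \<psi> (fobj ?F' (x \<oplus>\<^sub>o\<^bsub>A\<^esub> y)) \<cdot>\<^bsub>C\<^esub>
      (farr ?G (fmult ?F' x y) \<cdot>\<^bsub>C\<^esub> (fmult ?G ?x ?y \<cdot>\<^bsub>C\<^esub> (farr ?G (?p x) \<oplus>\<^sub>a\<^bsub>C\<^esub> farr ?G (?p y))))"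
      using o by simp
    \<comment> \<open>Naturality of \<open>\<psi>\<close> at the constraint of
      \<open>mtgt \<phi>\<close>; its monoidality follows in the next step.\<close>
    also have "\<dots> = farr ?G' (fmult ?F' x y) \<cdot>\<^bsub>C\<^esub> (mcomp \<psi> (?x \<oplus>\<^sub>o\<^bsub>B\<^esub> ?y) \<cdot>\<^bsub>C\<^esub>
        (fmult ?G ?x ?y \<cdot>\<^bsub>C\<^esub> (farr ?G (?p x) \<oplus>\<^sub>a\<^bsub>C\<^esub> farr ?G (?p y))))"
      using o g.F.B.comp_reassoc[OF g.mcomp_nat[of "fmult ?F' x y"]] by simp
    also have "\<dots> = farr ?G' (fmult ?F' x y) \<cdot>\<^bsub>C\<^esub> (fmult ?G' ?x ?y \<cdot>\<^bsub>C\<^esub>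
        ((mcomp \<psi> ?x \<oplus>\<^sub>a\<^bsub>C\<^esub> mcomp \<psi> ?y) \<cdot>\<^bsub>C\<^esub> (farr ?G (?p x) \<oplus>\<^sub>a\<^bsub>C\<^esub> farr ?G (?p y))))"
      using o g.F.B.comp_reassoc[OF g.mcomp_plus[of ?x ?y]] by simp
    finally show "mcomp ?h (x \<oplus>\<^sub>o\<^bsub>A\<^esub> y) \<cdot>\<^bsub>C\<^esub> fmult (msrc ?h) x y = fmult (mtgt ?h) x y \<cdot>\<^bsub>C\<^esub> (mcomp ?h x
      \<oplus>\<^sub>a\<^bsub>C\<^esub> mcomp ?h y)"
      using o by (simp add: g.F.B.interchange)
  next
    have "farr ?G (mcomp \<phi> (zero A)) \<cdot>\<^bsub>C\<^esub> farr ?G (funit ?F) = farr ?G (funit ?F')"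
      using f.mcomp_zero by (simp flip: g.F.farr_comp)
    then have "farr ?G (mcomp \<phi> (zero A)) \<cdot>\<^bsub>C\<^esub> (farr ?G (funit ?F) \<cdot>\<^bsub>C\<^esub> funit ?G) = farr ?G (funit ?F') \<cdot>\<^bsub>C\<^esub> funit ?G"
      by (simp add: g.F.B.comp_reassoc)
    moreover have "mcomp \<psi> (fobj ?F' (zero A)) \<cdot>\<^bsub>C\<^esub> (farr ?G (funit ?F') \<cdot>\<^bsub>C\<^esub> funit ?G) = farr ?G' (funit ?F') \<cdot>\<^bsub>C\<^esub> funit ?G'"
      using g.F.B.comp_reassoc[OF g.mcomp_nat[of "funit ?F'"], of "funit ?G"] g.mcomp_zero by simp
    ultimately show "mcomp ?h (zero A) \<cdot>\<^bsub>C\<^esub> funit (msrc ?h) = funit (mtgt ?h)"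
      by simp
  qed (simp_all add: smf_comp_is_smf[OF f.F.is_smf g.F.is_smf] smf_comp_is_smf[OF f.G.is_smf g.G.is_smf])
qed

section \<open>Naturality of strictification\<close>

abbreviation act_smf where
  "act_smf P' P C C' T H K \<equiv> smf_comp P' C' H (smf_comp P' C K T)"

abbreviation act_mtrans where
  "act_mtrans P' P C C' T H \<alpha> \<equiv>
    mtrans_hcomp P' C' (mtrans_id C C' H) (mtrans_hcomp P' C \<alpha> (mtrans_id P' P T))"

lemma act_mtrans_is_mtrans:
  assumes "is_smf P' P T" "is_smf C C' H" "is_mtrans P C \<alpha>"
  shows "is_mtrans P' C' (act_mtrans P' P C C' T H \<alpha>)"
  using assms by (intro mtrans_hcomp_is_mtrans[of P' C] mtrans_hcomp_is_mtrans[of P' P]) simp_all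

text \<open>The identity factors of both horizontal composites disappear, which leaves the form in
  which whiskerings are compared below.\<close>

lemma mcomp_act_mtrans:
  assumes "is_smf P' P T" "is_smf C C' H" "is_mtrans P C \<alpha>"
  shows "mcomp (act_mtrans P' P C C' T H \<alpha>) = (\<lambda>x\<in>Obj P'. farr H (mcomp \<alpha> (fobj T x)))"
proof -
  interpret T: smfunctor P' P T by (rule smfunctorI) fact
  interpret H: smfunctor C C' H by (rule smfunctorI) fact
  interpret a: mtransf P C \<alpha> by (rule mtransfI) fact
  show ?thesis
    by (auto intro!: restrict_ext)
qed

lemma act_mtrans_id:
  assumes "is_smf P' P T" "is_smf C C' H" "is_smf P C K"
  shows "act_mtrans P' P C C' T H (mtrans_id P C K) = mtrans_id P' C' (act_smf P' P C C' T H K)"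
proof -
  interpret T: smfunctor P' P T by (rule smfunctorI) fact
  interpret H: smfunctor C C' H by (rule smfunctorI) fact
  interpret K: smfunctor P C K by (rule smfunctorI) fact
  show ?thesis
    by (rule mtrans_eqI[where X = "Obj P'"])
      (simp_all add: mcomp_act_mtrans assms del: mtrans_hcomp_sel(3))
qed

lemma act_mtrans_vcomp:
  assumes "is_smf P' P T" "is_smf C C' H" "is_mtrans P C \<alpha>" "is_mtrans P C \<beta>" "mtgt \<alpha> = msrc \<beta>"
  shows "act_mtrans P' P C C' T H (mtrans_vcomp P C \<beta> \<alpha>) =
    mtrans_vcomp P' C' (act_mtrans P' P C C' T H \<beta>) (act_mtrans P' P C C' T H \<alpha>)"
proof -
  interpret T: smfunctor P' P T by (rule smfunctorI) fact
  interpret H: smfunctor C C' H by (rule smfunctorI) fact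
  interpret a: mtransf P C \<alpha> by (rule mtransfI) fact
  interpret b: mtransf P C \<beta> by (rule mtransfI) fact
  show ?thesis
    by (rule mtrans_eqI[where X = "Obj P'"])
      (use assms in \<open>simp_all add: mcomp_act_mtrans mtrans_vcomp_is_mtrans H.farr_comp del: mtrans_hcomp_sel(3)\<close>)
qed

lemma hom_act1_PermCat_functor:
  assumes "is_smf P' P T" "is_smf C C' H"
  shows "is_functor (PermCat P C) (PermCat P' C') (hom_act1 (PermCat P C) P' P C C' T H)"
proof -
  interpret T: smfunctor P' P T by (rule smfunctorI) fact
  interpret H: smfunctor C C' H by (rule smfunctorI) fact
  have cat: "is_cat (PermCat P C)" "is_cat (PermCat P' C')"
    using PermCat_is_permutative[OF T.B.is_permutative H.A.is_permutative]
      PermCat_is_permutative[OF T.A.is_permutative H.B.is_permutative]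
    by (simp_all add: is_permutative_def is_strict_monoidal_def)
  have act: "is_smf P' C' (act_smf P' P C C' T H K)" if "is_smf P C K" for K
    by (rule smf_comp_is_smf[OF smf_comp_is_smf[OF assms(1) that] assms(2)])
  show ?thesis
    unfolding is_functor_def hom_act1_def
    by (auto simp: cat hom_def assms is_mtrans_smf act act_mtrans_is_mtrans act_mtrans_id act_mtrans_vcomp
        mtrans_vcomp_is_mtrans)
qed

lemma hom_act2_sel [simp]:
  "msrc (hom_act2 P' P C C' \<tau> \<chi> K) = act_smf P' P C C' (msrc \<tau>) (msrc \<chi>) K"
  "mtgt (hom_act2 P' P C C' \<tau> \<chi> K) = act_smf P' P C C' (mtgt \<tau>) (mtgt \<chi>) K"
  by (simp_all add: hom_act2_def)

lemma hom_act2_is_mtrans: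
  assumes "is_mtrans P' P \<tau>" "is_mtrans C C' \<chi>" "is_smf P C K"
  shows "is_mtrans P' C' (hom_act2 P' P C C' \<tau> \<chi> K)"
  unfolding hom_act2_def
  using assms by (intro mtrans_hcomp_is_mtrans[of P' C] mtrans_hcomp_is_mtrans[of P' P]) simp_all

lemma mcomp_hom_act2:
  assumes "is_mtrans P' P \<tau>" "is_mtrans C C' \<chi>" "is_smf P C K"
  shows "mcomp (hom_act2 P' P C C' \<tau> \<chi> K) = (\<lambda>x\<in>Obj P'.
    mcomp \<chi> (fobj K (fobj (mtgt \<tau>) x)) \<cdot>\<^bsub>C'\<^esub> farr (msrc \<chi>) (farr K (mcomp \<tau> x)))"
proof -
  interpret t: mtransf P' P \<tau> by (rule mtransfI) fact
  interpret c: mtransf C C' \<chi> by (rule mtransfI) fact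
  interpret K: smfunctor P C K by (rule smfunctorI) fact
  show ?thesis
    by (auto simp: hom_act2_def intro!: restrict_ext)
qed

text \<open>Naturality of \<open>\<alpha>\<close> at the components of \<open>\<tau>\<close>, mapped
  by the source of \<open>\<chi>\<close>, followed by naturality of \<open>\<chi>\<close> at the
  components of \<open>\<alpha>\<close>.\<close>

lemma hom_act2_nat:
  assumes "is_mtrans P' P \<tau>" "is_mtrans C C' \<chi>" "is_mtrans P C \<alpha>"
  shows "mtrans_vcomp P' C' (hom_act2 P' P C C' \<tau> \<chi> (mtgt \<alpha>)) (act_mtrans P' P C C' (msrc \<tau>) (msrc \<chi>) \<alpha>) =
    mtrans_vcomp P' C' (act_mtrans P' P C C' (mtgt \<tau>) (mtgt \<chi>) \<alpha>) (hom_act2 P' P C C' \<tau> \<chi> (msrc \<alpha>))"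
proof -
  interpret t: mtransf P' P \<tau> by (rule mtransfI) fact
  interpret c: mtransf C C' \<chi> by (rule mtransfI) fact
  interpret a: mtransf P C \<alpha> by (rule mtransfI) fact
  have "mcomp \<chi> (fobj (mtgt \<alpha>) (fobj (mtgt \<tau>) x)) \<cdot>\<^bsub>C'\<^esub> (farr (msrc \<chi>) (farr (mtgt \<alpha>) (mcomp \<tau> x)) \<cdot>\<^bsub>C'\<^esub>
      farr (msrc \<chi>) (mcomp \<alpha> (fobj (msrc \<tau>) x))) =
    farr (mtgt \<chi>) (mcomp \<alpha> (fobj (mtgt \<tau>) x)) \<cdot>\<^bsub>C'\<^esub> (mcomp \<chi> (fobj (msrc \<alpha>) (fobj (mtgt \<tau>) x)) \<cdot>\<^bsub>C'\<^esub>
      farr (msrc \<chi>) (farr (msrc \<alpha>) (mcomp \<tau> x)))" if x: "x \<in> Obj P'" for x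
  proof -
    let ?y = "fobj (mtgt \<tau>) x"
    have "farr (msrc \<chi>) (farr (mtgt \<alpha>) (mcomp \<tau> x)) \<cdot>\<^bsub>C'\<^esub> farr (msrc \<chi>) (mcomp \<alpha> (fobj (msrc \<tau>) x)) =
      farr (msrc \<chi>) (mcomp \<alpha> ?y) \<cdot>\<^bsub>C'\<^esub> farr (msrc \<chi>) (farr (msrc \<alpha>) (mcomp \<tau> x))"
      using x a.mcomp_nat[of "mcomp \<tau> x"] by (simp flip: c.F.farr_comp)
    then show ?thesis
      using x c.F.B.comp_reassoc[OF c.mcomp_nat[of "mcomp \<alpha> ?y"], of "farr (msrc \<chi>) (farr (msrc \<alpha>) (mcomp \<tau> x))"]
      by simp
  qed
  then show ?thesis
    by (intro mtrans_eqI[where X = "Obj P'"])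
      (use assms in \<open>simp_all add: mcomp_act_mtrans mcomp_hom_act2 a.F.is_smf a.G.is_smf
        t.F.is_smf t.G.is_smf c.F.is_smf c.G.is_smf del: mtrans_hcomp_sel(3)\<close>)
qed

text \<open>Strictness of \<open>H\<close> makes \<open>H K T\<close> strict for strict
  \<open>K\<close>, so that the action restricts to \<open>PermCat_s\<close>. \<open>F\<close> and
  \<open>G\<close> may be general because \<open>T\<close> is strict in any case.\<close>

locale tensor_action = dom: tensor_cat A' B' + cod: tensor_cat A B + F: smfunctor A' A F + G: smfunctor B' B G +
  H: strict_smfunctor C C' H
  for A' :: "('a1, 'f1, 'z) pcat_scheme" and B' :: "('b1, 'g1, 'y) pcat_scheme"
    and A :: "('a, 'f, 'z1) pcat_scheme" and B :: "('b, 'g, 'y1) pcat_scheme"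
    and C :: "('c, 'h, 'x) pcat_scheme" and C' :: "('c1, 'h1, 'x1) pcat_scheme" and F G H
begin

abbreviation T where "T \<equiv> tensor_smf A' B' A B F G"
abbreviation act where "act \<equiv> act_smf (tensor A' B') (tensor A B) C C' T H"
abbreviation acta where "acta \<equiv> act_mtrans (tensor A' B') (tensor A B) C C' T H"

sublocale I: bilinear A' B' "tensor A B" "pullback_images A B (tensor A B) (univ_images A B) F G"
  by (intro bilinear.bilinear_pullback[OF cod.bilinear_univ_images] F.is_smf G.is_smf)

sublocale T: tensor_strict A' B' "tensor A B" T
  using I.tensor_strict_extension by (simp add: tensor_smf_eq)

lemma T_single [simp]:
  "a \<in> Obj A' \<Longrightarrow> b \<in> Obj B' \<Longrightarrow> fobj T [(a, b)] = [(fobj F a, fobj G b)]"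
  by (simp add: tensor_smf_eq)

lemma T_gens:
  "f \<in> Arr A' \<Longrightarrow> g \<in> Arr B' \<Longrightarrow> farr T (tcls A' B' (Gen f g)) = tcls A B (Gen (farr F f) (farr G g))"
  "a \<in> Obj A' \<Longrightarrow> b \<in> Obj B' \<Longrightarrow> b' \<in> Obj B' \<Longrightarrow> farr T (tcls A' B' (Iso (DeltaL a b b'))) =
    tcls A B (Gen (Id A (fobj F a)) (fmult G b b')) \<cdot>\<^bsub>tensor A B\<^esub> tcls A B (Iso (DeltaL (fobj F a) (fobj G b) (fobj G b')))"
  "b \<in> Obj B' \<Longrightarrow> a \<in> Obj A' \<Longrightarrow> a' \<in> Obj A' \<Longrightarrow> farr T (tcls A' B' (Iso (DeltaR b a a'))) =
    tcls A B (Gen (fmult F a a') (Id B (fobj G b))) \<cdot>\<^bsub>tensor A B\<^esub> tcls A B (Iso (DeltaR (fobj G b) (fobj F a) (fobj F a')))"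
  "a \<in> Obj A' \<Longrightarrow> farr T (tcls A' B' (Iso (ZetaL a))) =
    tcls A B (Gen (Id A (fobj F a)) (funit G)) \<cdot>\<^bsub>tensor A B\<^esub> tcls A B (Iso (ZetaL (fobj F a)))"
  "b \<in> Obj B' \<Longrightarrow> farr T (tcls A' B' (Iso (ZetaR b))) =
    tcls A B (Gen (funit F) (Id B (fobj G b))) \<cdot>\<^bsub>tensor A B\<^esub> tcls A B (Iso (ZetaR (fobj G b)))"
  by (simp_all add: tensor_smf_eq I.farr_strict_extension)

lemma act_is_smf: "is_smf (tensor A B) C K \<Longrightarrow> is_smf (tensor A' B') C' (act K)"
  by (intro smf_comp_is_smf[of _ C] smf_comp_is_smf[of _ "tensor A B"] T.K.is_smf H.is_smf)

lemma act_is_strict_smf: "is_strict_smf (tensor A B) C K \<Longrightarrow> is_strict_smf (tensor A' B') C' (act K)"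
  by (intro smf_comp_is_strict_smf[of _ C] smf_comp_is_strict_smf[of _ "tensor A B"]
      T.K.is_strict_smf H.is_strict_smf)

text \<open>Both sides are strict, so generators suffice. As \<open>T\<close> sends
  \<open>a.b\<close> to a single summand and \<open>T\<close> and \<open>H\<close> are strict, the
  constraint of \<open>H K T\<close> on two such summands is \<open>H\<close> of the one of
  \<open>K\<close>. Both sides then send a generator to \<open>H\<close> of the value of
  \<open>K\<close> on its image under \<open>T\<close>, composed with that constraint where \<delta>
  or \<zeta> requires it.\<close>

lemma strictify_act:
  assumes "is_smf (tensor A B) C K"
  shows "strictify A' B' C' (act K) = act (strictify A B C K)"
proof -
  interpret K: tensor_smfunctor A B C K
    by (rule tensor_smfunctorI) (simp_all add: cod.tensor_cat_axioms assms)
  interpret s: tensor_strict A B C "strictify A B C K"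
    by (rule tensor_strictI) (simp_all add: cod.tensor_cat_axioms K.strictify_strict)
  interpret L: tensor_smfunctor A' B' C' "act K"
    by (rule tensor_smfunctorI) (simp_all add: dom.tensor_cat_axioms act_is_smf assms)
  show ?thesis
  proof (rule strict_smf_eqI[OF dom.tensor_cat_axioms L.strictify_strict])
    show "is_strict_smf (tensor A' B') C' (act (strictify A B C K))"
      by (intro act_is_strict_smf K.strictify_strict)
    show "images_eq A' B' (gens A' B' (strictify A' B' C' (act K))) (gens A' B' (act (strictify A B C K)))"
      by (simp add: images_eq_def gens_def L.farr_strictify K.farr_strictify T_gens K.F.farr_comp s.K.farr_comp
          H.farr_comp)
  qed
qed

text \<open>\<open>T\<close> maps one summand to one summand and \<open>H\<close> preserves sums, so
  a sum of components over \<open>xs\<close> is \<open>H\<close> of the sum over the image of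
  \<open>xs\<close> under \<open>T\<close>.\<close>

lemma strictify_acta:
  assumes "is_mtrans (tensor A B) C \<alpha>"
  shows "strictify_mtrans A' B' C' (acta \<alpha>) = acta (strictify_mtrans A B C \<alpha>)"
proof -
  interpret a: tensor_mtransf A B C \<alpha>
    by (rule tensor_mtransfI) (simp_all add: cod.tensor_cat_axioms assms)
  note act = mcomp_act_mtrans[OF T.K.is_smf H.is_smf]
  have "asum C' (\<lambda>p. farr H (mcomp \<alpha> (fobj T [p]))) xs = farr H (asum C (\<lambda>p. mcomp \<alpha> [p]) (fobj T xs))"
    if "xs \<in> tobj A' B'" for xs
    using that
  proof (induction xs)
    case (Cons p xs)
    obtain a b where p: "p = (a, b)" by (cases p)
    then show ?case
      using Cons T.K_Cons[of p xs] T.K_obj[of xs] by (simp add: H.farr_plus)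
  qed simp
  moreover have "asum C' (\<lambda>p. mcomp (acta \<alpha>) [p]) xs = asum C' (\<lambda>p. farr H (mcomp \<alpha> (fobj T [p]))) xs"
    if "xs \<in> tobj A' B'" for xs
    using that by (intro asum_cong) (auto simp: act[OF assms] tobj_def)
  ultimately show ?thesis
    by (intro mtrans_eqI[where X = "tobj A' B'"])
      (use T.K_obj in \<open>simp_all add: strictify_act a.f.F.is_smf a.f.G.is_smf assms act[OF a.strictify_mtrans_is_mtrans]
        del: mtrans_hcomp_sel(3)\<close>)
qed

end

lemma tensor_actionI:
  assumes "is_smf A' A F" "is_smf B' B G" "is_strict_smf C C' H"
  shows "tensor_action A' B' A B C C' F G H"
  using assms
  by (simp add: tensor_action_def smfunctorI strict_smfunctorI tensor_catI is_smf_def)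

lemma tensor_J_S:
  assumes "is_permutative A" "is_permutative B" "is_permutative C"
  shows "strictifier.J (PermCat_s A B C) = inclusion A B C"
    and "strictifier.S (PermCat (tensor A B) C) (strictify A B C) (strictify_mtrans A B C) = strictification A B C"
  using strictifier.J_def[OF strictifier_PermCat[OF assms]] strictifier.S_def[OF strictifier_PermCat[OF assms]]
  by (simp_all add: inclusion_def strictification_def)

lemma inclusion_strictification_functor:
  assumes "is_permutative A" "is_permutative B" "is_permutative C"
  shows "is_functor (PermCat_s A B C) (PermCat (tensor A B) C) (inclusion A B C)"
    and "is_functor (PermCat (tensor A B) C) (PermCat_s A B C) (strictification A B C)"
  using strictifier.J_functor[OF strictifier_PermCat[OF assms]] strictifier.S_functor[OF strictifier_PermCat[OF assms]]
  by (simp_all add: tensor_J_S[OF assms])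

section \<open>Naturality at 1-cells\<close>

context tensor_action
begin

lemma perm: "is_permutative A" "is_permutative B" "is_permutative C"
  "is_permutative A'" "is_permutative B'" "is_permutative C'"
  by (rule cod.A.is_permutative cod.B.is_permutative dom.A.is_permutative dom.B.is_permutative
      H.A.is_permutative H.B.is_permutative)+

abbreviation "X \<equiv> PermCat_s A B C"
abbreviation "Y \<equiv> PermCat (tensor A B) C"
abbreviation "X' \<equiv> PermCat_s A' B' C'"
abbreviation "Y' \<equiv> PermCat (tensor A' B') C'"
abbreviation "U \<equiv> hom_act1 X (tensor A' B') (tensor A B) C C' T H"
abbreviation "V \<equiv> hom_act1 Y (tensor A' B') (tensor A B) C C' T H"

lemma V_functor: "is_functor Y Y' V"
  by (rule hom_act1_PermCat_functor[OF T.K.is_smf H.is_smf])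

lemma U_functor: "is_functor X X' U"
proof -
  have cat: "is_cat X" "is_cat X'"
    using inclusion_strictification_functor(1)[OF perm(1-3)] inclusion_strictification_functor(1)[OF perm(4-6)] by (simp_all add: is_functor_def)
  show ?thesis
    unfolding is_functor_def hom_act1_def
    by (auto simp: cat hom_def act_mtrans_is_mtrans[OF T.K.is_smf H.is_smf] act_mtrans_id[OF T.K.is_smf H.is_smf]
        act_mtrans_vcomp[OF T.K.is_smf H.is_smf] mtrans_vcomp_is_mtrans act_is_strict_smf strict_smf_smf)
qed

lemma inclusion_natural: "natural_at_1cell X Y X' Y' (inclusion A B C) (inclusion A' B' C') U V"
proof -
  have "func_comp X (inclusion A' B' C') U = func_comp X V (inclusion A B C)"
    by (auto simp: func_comp_def inclusion_def hom_act1_def strict_smf_smf act_is_strict_smf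
        act_mtrans_is_mtrans[OF T.K.is_smf H.is_smf] intro!: restrict_ext)
  then show ?thesis
    by (simp add: natural_at_1cell_def inclusion_strictification_functor[OF perm(1-3)] inclusion_strictification_functor[OF perm(4-6)]
        U_functor V_functor del: PermCat_sel PermCat_s_sel)
qed

lemma strictification_natural: "natural_at_1cell Y X Y' X' (strictification A B C) (strictification A' B' C') V U"
proof -
  have "func_comp Y (strictification A' B' C') V = func_comp Y U (strictification A B C)"
    by (auto simp: func_comp_def strictification_def hom_act1_def act_is_smf strictify_act strictify_acta
        act_mtrans_is_mtrans[OF T.K.is_smf H.is_smf]
        tensor_smfunctor.strictify_strict[OF tensor_smfunctorI] tensor_mtransf.strictify_mtrans_is_mtrans[OF tensor_mtransfI]
        cod.tensor_cat_axioms is_mtrans_smf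
        intro!: restrict_ext)
  then show ?thesis
    by (simp add: natural_at_1cell_def inclusion_strictification_functor[OF perm(1-3)] inclusion_strictification_functor[OF perm(4-6)]
        U_functor V_functor del: PermCat_sel PermCat_s_sel)
qed

end

section \<open>Naturality at 2-cells\<close>

locale tensor_action2 = S: tensor_action A' B' A B C C' "msrc \<phi>" "msrc \<psi>" "msrc \<chi>" +
  T: tensor_action A' B' A B C C' "mtgt \<phi>" "mtgt \<psi>" "mtgt \<chi>" +
  f: mtransf A' A \<phi> + g: mtransf B' B \<psi> + c: mtransf C C' \<chi>
  for A' :: "('a1, 'f1, 'z) pcat_scheme" and B' :: "('b1, 'g1, 'y) pcat_scheme"
    and A :: "('a, 'f, 'z1) pcat_scheme" and B :: "('b, 'g, 'y1) pcat_scheme"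
    and C :: "('c, 'h, 'x) pcat_scheme" and C' :: "('c1, 'h1, 'x1) pcat_scheme"
    and \<phi> :: "('a1, 'f1, 'a, 'f) mtrans" and \<psi> :: "('b1, 'g1, 'b, 'g) mtrans" and \<chi> :: "('c, 'h, 'c1, 'h1) mtrans"
begin

abbreviation \<tau> where "\<tau> \<equiv> tensor_mtrans A' B' A B \<phi> \<psi>"
abbreviation w where "w \<equiv> hom_act2 (tensor A' B') (tensor A B) C C' \<tau> \<chi>"

lemma tau: "is_mtrans (tensor A' B') (tensor A B) \<tau>"
  by (rule tensor_mtrans_is_mtrans[OF S.cod.tensor_cat_axioms f.is_mtrans g.is_mtrans])

lemma w_is_mtrans: "is_smf (tensor A B) C K \<Longrightarrow> is_mtrans (tensor A' B') C' (w K)"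
  by (rule hom_act2_is_mtrans[OF tau c.is_mtrans])

lemma w_nat_PermCat: "nat_trans S.Y S.Y' S.V T.V w"
  unfolding nat_trans_def
  using S.V_functor T.V_functor hom_act2_nat[OF tau c.is_mtrans] w_is_mtrans
  by (auto simp: hom_act1_def hom_def is_mtrans_smf)

lemma w_nat_PermCat_s: "nat_trans S.X S.X' S.U T.U w"
  unfolding nat_trans_def
  using S.U_functor T.U_functor hom_act2_nat[OF tau c.is_mtrans] w_is_mtrans
  by (auto simp: hom_act1_def hom_def strict_smf_smf S.act_is_strict_smf T.act_is_strict_smf)

text \<open>At \<open>K^s\<close> the transformation \<open>w\<close> runs between strict functors
  and is fixed by strictification, so one-term components suffice. These involve \<open>K\<close>
  only on one-term objects and generators \<open>f.g\<close>, where \<open>K\<close> and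
  \<open>K^s\<close> coincide.\<close>

lemma strictify_w:
  assumes "is_smf (tensor A B) C K"
  shows "strictify_mtrans A' B' C' (w K) = w (strictify A B C K)"
proof -
  interpret K: tensor_smfunctor A B C K
    by (rule tensor_smfunctorI) (simp_all add: S.cod.tensor_cat_axioms assms)
  interpret w: tensor_mtransf A' B' C' "w (strictify A B C K)"
    by (rule tensor_mtransfI) (simp_all add: S.dom.tensor_cat_axioms w_is_mtrans K.strictify_is_smf)
  have "w (strictify A B C K) = strictify_mtrans A' B' C' (w (strictify A B C K))"
    by (rule w.strictify_mtrans_of_strict[symmetric])
      (simp_all add: S.act_is_strict_smf T.act_is_strict_smf K.strictify_strict)
  also have "\<dots> = strictify_mtrans A' B' C' (w K)"
  proof (rule mtrans_eqI[where X = "tobj A' B'"])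
    fix xs assume xs: "xs \<in> tobj A' B'"
    have "mcomp (w (strictify A B C K)) [p] = mcomp (w K) [p]" if p: "p \<in> set xs" for p
    proof -
      obtain a b where p: "p = (a, b)" "a \<in> Obj A'" "b \<in> Obj B'"
        using tobj_mem[OF xs p] by auto
      then show ?thesis
        by (simp add: mcomp_hom_act2[OF tau c.is_mtrans] assms K.strictify_is_smf K.farr_strictify)
    qed
    then have "asum C' (\<lambda>p. mcomp (w (strictify A B C K)) [p]) xs = asum C' (\<lambda>p. mcomp (w K) [p]) xs"
      by (rule asum_cong)
    then show "mcomp (strictify_mtrans A' B' C' (w (strictify A B C K))) xs =
      mcomp (strictify_mtrans A' B' C' (w K)) xs"
      using xs by simp
  qed (use S.strictify_act[OF assms] T.strictify_act[OF assms] S.strictify_act[OF K.strictify_is_smf]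
      T.strictify_act[OF K.strictify_is_smf] K.strictify_strict in
      \<open>simp_all add: tensor_smfunctor.strictify_of_strict[OF tensor_smfunctorI[OF S.cod.tensor_cat_axioms K.strictify_is_smf]]\<close>)
  finally show ?thesis ..
qed

lemma inclusion_natural2:
  "natural_at_2cell S.X S.Y S.X' S.Y' (inclusion A B C) (inclusion A' B' C') S.U T.U w S.V T.V w"
proof -
  have "farr (inclusion A' B' C') (w K) = w (fobj (inclusion A B C) K)" if "K \<in> Obj S.X" for K
    using that by (simp add: inclusion_def w_is_mtrans strict_smf_smf S.act_is_strict_smf T.act_is_strict_smf)
  then show ?thesis
    by (simp add: natural_at_2cell_def inclusion_strictification_functor[OF S.perm(1-3)] inclusion_strictification_functor[OF S.perm(4-6)]
        w_nat_PermCat w_nat_PermCat_s del: PermCat_sel PermCat_s_sel)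
qed

lemma strictification_natural2:
  "natural_at_2cell S.Y S.X S.Y' S.X' (strictification A B C) (strictification A' B' C') S.V T.V w S.U T.U w"
proof -
  have "farr (strictification A' B' C') (w K) = w (fobj (strictification A B C) K)" if "K \<in> Obj S.Y" for K
    using that by (simp add: strictification_def w_is_mtrans strictify_w)
  then show ?thesis
    by (simp add: natural_at_2cell_def inclusion_strictification_functor[OF S.perm(1-3)] inclusion_strictification_functor[OF S.perm(4-6)]
        w_nat_PermCat w_nat_PermCat_s del: PermCat_sel PermCat_s_sel)
qed

end

lemma tensor_action2I:
  assumes "is_mtrans A' A \<phi>" "is_mtrans B' B \<psi>" "is_mtrans C C' \<chi>"
    "is_strict_smf C C' (msrc \<chi>)" "is_strict_smf C C' (mtgt \<chi>)"
  shows "tensor_action2 A' B' A B C C' \<phi> \<psi> \<chi>"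
  using assms by (simp add: tensor_action2_def tensor_actionI mtransfI is_mtrans_def)

theorem proposition6p8:
  fixes A :: "('a, 'f) pcat" and B :: "('b, 'g) pcat" and C :: "('c, 'h) pcat"
    and A' :: "('a1, 'f1) pcat" and B' :: "('b1, 'g1) pcat" and C' :: "('c1, 'h1) pcat"
  assumes "is_permutative A" and "is_permutative B" and "is_permutative C"
  shows
    "fully_faithful (PermCat_s A B C) (PermCat (tensor A B) C) (inclusion A B C) \<and>
     (\<exists>\<eta> \<epsilon>. adjoint_equivalence (PermCat_s A B C) (PermCat (tensor A B) C)
       (inclusion A B C) (strictification A B C) \<eta> \<epsilon>) \<and>
     (is_permutative A' \<and> is_permutative B' \<and> is_permutative C' \<longrightarrow>
     (\<forall>F G H. is_smf A' A F \<and> is_smf B' B G \<and> is_strict_smf C C' H \<longrightarrow>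
       (let X = PermCat_s A B C; Y = PermCat (tensor A B) C;
            X' = PermCat_s A' B' C'; Y' = PermCat (tensor A' B') C';
            T = tensor_smf A' B' A B F G;
            U = hom_act1 X (tensor A' B') (tensor A B) C C' T H;
            V = hom_act1 Y (tensor A' B') (tensor A B) C C' T H
        in natural_at_1cell X Y X' Y' (inclusion A B C) (inclusion A' B' C') U V \<and>
           natural_at_1cell Y X Y' X' (strictification A B C) (strictification A' B' C') V U)) \<and>
     (\<forall>\<phi> \<psi> \<chi>. is_mtrans A' A \<phi> \<and> is_mtrans B' B \<psi> \<and> is_mtrans C C' \<chi> \<and>
       is_strict_smf C C' (msrc \<chi>) \<and> is_strict_smf C C' (mtgt \<chi>) \<longrightarrow>
       (let X = PermCat_s A B C; Y = PermCat (tensor A B) C;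
            X' = PermCat_s A' B' C'; Y' = PermCat (tensor A' B') C';
            \<tau> = tensor_mtrans A' B' A B \<phi> \<psi>;
            act = (\<lambda>Z. hom_act1 Z (tensor A' B') (tensor A B) C C');
            U\<^sub>0 = act X (msrc \<tau>) (msrc \<chi>); U\<^sub>1 = act X (mtgt \<tau>) (mtgt \<chi>);
            V\<^sub>0 = act Y (msrc \<tau>) (msrc \<chi>); V\<^sub>1 = act Y (mtgt \<tau>) (mtgt \<chi>);
            w = hom_act2 (tensor A' B') (tensor A B) C C' \<tau> \<chi>
        in natural_at_2cell X Y X' Y' (inclusion A B C) (inclusion A' B' C') U\<^sub>0 U\<^sub>1 w V\<^sub>0 V\<^sub>1 w \<and>
           natural_at_2cell Y X Y' X' (strictification A B C) (strictification A' B' C')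
             V\<^sub>0 V\<^sub>1 w U\<^sub>0 U\<^sub>1 w))) \<and>
     (\<exists>J. is_smf (PermCat_s A B C) (PermCat (tensor A B) C) J \<and>
       func.truncate J = inclusion A B C) \<and>
     (\<exists>S. is_strict_smf (PermCat (tensor A B) C) (PermCat_s A B C) S \<and>
       func.truncate S = strictification A B C)"
  \<comment> \<open>Source and target of the tensor product of 2-cells become tensor products of
    1-cells, the form in which the locales state the action.\<close>
  unfolding Let_def tensor_mtrans_sel
proof (intro conjI impI allI)
  let ?X = "PermCat_s A B C" and ?Y = "PermCat (tensor A B) C"
  interpret R: strictifier ?Y ?X "strictify A B C" "strictify_mtrans A B C" "strictify_counit A B C"
    by (rule strictifier_PermCat) fact+
  note JS = tensor_J_S[OF assms]
  show "fully_faithful ?X ?Y (inclusion A B C)"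
    using R.J_fully_faithful by (simp only: JS)
  show "\<exists>\<eta> \<epsilon>. adjoint_equivalence ?X ?Y (inclusion A B C) (strictification A B C) \<eta> \<epsilon>"
    using R.J_S_adjoint_equivalence unfolding JS by blast
  show "\<exists>J. is_smf ?X ?Y J \<and> func.truncate J = inclusion A B C"
    using R.J_smf by (simp only: JS)
  show "\<exists>S. is_strict_smf ?Y ?X S \<and> func.truncate S = strictification A B C"
    using R.S_strict_smf by (simp only: JS)
next
  fix F G H assume "is_smf A' A F \<and> is_smf B' B G \<and> is_strict_smf C C' H"
  then interpret tensor_action A' B' A B C C' F G H
    by (intro tensor_actionI) simp_all
  show "natural_at_1cell X Y X' Y' (inclusion A B C) (inclusion A' B' C') U V"
    by (rule inclusion_natural)
  show "natural_at_1cell Y X Y' X' (strictification A B C) (strictification A' B' C') V U"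
    by (rule strictification_natural)
next
  fix \<phi> \<psi> \<chi> assume "is_mtrans A' A \<phi> \<and> is_mtrans B' B \<psi> \<and> is_mtrans C C' \<chi> \<and>
       is_strict_smf C C' (msrc \<chi>) \<and> is_strict_smf C C' (mtgt \<chi>)"
  then interpret tensor_action2 A' B' A B C C' \<phi> \<psi> \<chi>
    by (intro tensor_action2I) simp_all
  show "natural_at_2cell S.X S.Y S.X' S.Y' (inclusion A B C) (inclusion A' B' C') S.U T.U w S.V T.V w"
    by (rule inclusion_natural2)
  show "natural_at_2cell S.Y S.X S.Y' S.X' (strictification A B C) (strictification A' B' C') S.V T.V w S.U T.U w"
    by (rule strictification_natural2)
qed

end
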